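(* Let $\mathcal{C}$ be an $\infty$-category, $\mathcal{P}$ a poset, and $F:\mathcal{C}\to N\mathcal{P}$ a functor. Then the functor $p_F:\mathcal{C}_F(\mathcal{P})\to\mathcal{C}$ is cofinal.
   Context: An $\infty$-category is a quasi-category, and $N$ denotes the nerve. A map of simplicial sets is cofinal in the sense of Lurie (Higher Topos Theory, 4.1.1.1); in particular, restriction along it preserves colimits of diagrams in any $\infty$-category. For a poset $(\mathcal{P},\le)$, the barycentric subdivision $\mathrm{sd}(\mathcal{P})$ is the poset of all finite nonempty strictly increasing sequences $\underline{x}=(x_0<x_1<\dots<x_n)$ in $\mathcal{P}$, ordered by inclusion of the underlying sets $\{\underline x\}$. The simplicial set $\mathcal{C}_F(\mathcal{P})$ over $N\,\mathrm{sd}(\mathcal{P})^{\rm op}$ is defined as follows. Let $\mathcal{U}(\mathcal{P})=\{(\underline{x},x):\underline{x}\in\mathrm{sd}(\mathcal{P}),\,x\in\underline{x}\}$ with $(\underline{x},x)\le(\underline{x}',x')$ iff $\{\underline{x}\}\supseteq\{\underline{x}'\}$ and $x\le x'$, with poset maps $q:\mathcal{U}(\mathcal{P})\to\mathrm{sd}(\mathcal{P})^{\rm op}$, $(\underline{x},x)\mapsto\underline{x}$; $\pi:\mathcal{U}(\mathcal{P})\to\mathcal{P}$, $(\underline{x},x)\mapsto x$; and the section $s:\mathrm{sd}(\mathcal{P})^{\rm op}\to\mathcal{U}(\mathcal{P})$, $\underline{x}\mapsto(\underline{x},\min\underline{x})$ of $q$. Let $q_*:\mathrm{sSet}_{/N\mathcal{U}(\mathcal{P})}\to\mathrm{sSet}_{/N\mathrm{sd}(\mathcal{P})^{\rm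 op}}$ be the right adjoint of the base-change functor $q^*$ along $Nq$. Then $$\mathcal{C}_F(\mathcal{P}):=q_*(\mathcal{D}),\qquad\mathcal{D}:=N\mathcal{U}(\mathcal{P})\times_{N\mathcal{P}}\mathcal{C}$$ (fibre product along $N\pi$ and $F$), and $p_F$ is the composite $$\mathcal{C}_F(\mathcal{P})=s^*q^*q_*\mathcal{D}\to s^*\mathcal{D}=N\mathrm{sd}(\mathcal{P})^{\rm op}\times_{N\mathcal{P}}\mathcal{C}\to\mathcal{C},$$ where the first map is $s^*$ of the counit $q^*q_*\mathcal{D}\to\mathcal{D}$ and the second is the projection. Explicitly: an $m$-simplex of $\mathcal{C}_F(\mathcal{P})$ is a pair $(\sigma,\Theta)$ where $\sigma=(\underline{x}^{(0)}\supseteq\underline{x}^{(1)}\supseteq\dots\supseteq\underline{x}^{(m)})$ is an $m$-simplex of $N\mathrm{sd}(\mathcal{P})^{\rm op}$ and $\Theta:N(V_\sigma)\to\mathcal{C}$ is a simplicial map over $N\mathcal{P}$ (i.e. $F\Theta(i,x)=x$), where $V_\sigma=\{(i,x):0\le i\le m,\ x\in\underline{x}^{(i)}\}\subseteq[m]\times\underline{x}^{(0)}$ has the product order; $p_F(\sigma,\Theta)$ is the $m$-simplex of $\mathcal{C}$ obtained by restricting $\Theta$ along $[m]\to V_\sigma$, $i\mapsto(i,\min\underline{x}^{(i)})$. Thus objects are pairs $(\underline{x},\underline{c})$ with $\underline{c}:\Delta[n]\to\mathcal{C}$ a chain $c_0\to c_1\to\dots\to c_n$ lying over $\underline{x}=(x_0<\dots<x_n)$,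 and $p_F(\underline{x},\underline{c})=c_0$. $\mathcal{C}_F(\mathcal{P})$ is an $\infty$-category. *)

theory Defs
  imports "HOL-Library.FuncSet"
begin

section \<open>Simplicial sets\<close>

text \<open>Morphisms \<open>[m] \<rightarrow> [n]\<close> of the simplex category. They are taken extensional (undefined outside
  \<open>{..m}\<close>), so that equality of HOL functions is equality of morphisms; \<open>compose {..k} \<beta> \<alpha>\<close> is the
  composite of \<open>\<alpha> : [k] \<rightarrow> [m]\<close> and \<open>\<beta> : [m] \<rightarrow> [n]\<close>.\<close>

definition Delta :: "nat \<Rightarrow> nat \<Rightarrow> (nat \<Rightarrow> nat) set" where
  "Delta m n = {\<alpha> \<in> {..m} \<rightarrow>\<^sub>E {..n}. mono_on {..m} \<alpha>}"

text \<open>\<open>pull X k m \<alpha> : X\<^sub>m \<rightarrow> X\<^sub>k\<close> is the action of \<open>\<alpha> : [k] \<rightarrow> [m]\<close>.\<close>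

record 'a sset =
  simps :: "nat \<Rightarrow> 'a set"
  pull :: "nat \<Rightarrow> nat \<Rightarrow> (nat \<Rightarrow> nat) \<Rightarrow> 'a \<Rightarrow> 'a"

definition simplicial_set :: "'a sset \<Rightarrow> bool" where
  "simplicial_set X \<longleftrightarrow>
     (\<forall>k m. \<forall>\<alpha>\<in>Delta k m. \<forall>x\<in>simps X m. pull X k m \<alpha> x \<in> simps X k) \<and>
     (\<forall>m. \<forall>x\<in>simps X m. pull X m m (\<lambda>i\<in>{..m}. i) x = x) \<and>
     (\<forall>k l m. \<forall>\<alpha>\<in>Delta k l. \<forall>\<beta>\<in>Delta l m. \<forall>x\<in>simps X m.
        pull X k m (compose {..k} \<beta> \<alpha>) x = pull X k l \<alpha> (pull X l m \<beta> x))"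

text \<open>A simplicial map is the family of its components, each extensional on the simplices of the
  source, so that equality of families is equality of simplicial maps.\<close>

definition sset_hom :: "'a sset \<Rightarrow> 'b sset \<Rightarrow> (nat \<Rightarrow> 'a \<Rightarrow> 'b) set" where
  "sset_hom X Y = {f. (\<forall>m. f m \<in> simps X m \<rightarrow>\<^sub>E simps Y m) \<and>
     (\<forall>k m. \<forall>\<alpha>\<in>Delta k m. \<forall>x\<in>simps X m. f k (pull X k m \<alpha> x) = pull Y k m \<alpha> (f m x))}"

definition sset_id :: "'a sset \<Rightarrow> nat \<Rightarrow> 'a \<Rightarrow> 'a" where
  "sset_id X m = (\<lambda>x\<in>simps X m. x)"

definition sset_comp ::
    "'a sset \<Rightarrow> (nat \<Rightarrow> 'b \<Rightarrow> 'c) \<Rightarrow> (nat \<Rightarrow> 'a \<Rightarrow> 'b) \<Rightarrow> nat \<Rightarrow> 'a \<Rightarrow> 'c" where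
  "sset_comp X g f m = compose (simps X m) (g m) (f m)"

definition sset_prod :: "'a sset \<Rightarrow> 'b sset \<Rightarrow> ('a \<times> 'b) sset" where
  "sset_prod X Y = \<lparr> simps = (\<lambda>m. simps X m \<times> simps Y m),
                     pull = (\<lambda>k m \<alpha> (x, y). (pull X k m \<alpha> x, pull Y k m \<alpha> y)) \<rparr>"

definition simplex :: "nat \<Rightarrow> (nat \<Rightarrow> nat) sset" where
  "simplex n = \<lparr> simps = (\<lambda>m. Delta m n), pull = (\<lambda>k m \<alpha> \<beta>. compose {..k} \<beta> \<alpha>) \<rparr>"

text \<open>\<open>\<Lambda>\<^sup>n\<^sub>i\<close>: the simplices of \<open>\<Delta>\<^sup>n\<close> missing some vertex other than \<open>i\<close>.\<close>

definition horn :: "nat \<Rightarrow> nat \<Rightarrow> (nat \<Rightarrow> nat) sset" where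
  "horn n i = \<lparr> simps = (\<lambda>m. {\<beta> \<in> Delta m n. \<not> {..n} - {i} \<subseteq> \<beta> ` {..m}}),
                pull = (\<lambda>k m \<alpha> \<beta>. compose {..k} \<beta> \<alpha>) \<rparr>"

definition quasi_category :: "'a sset \<Rightarrow> bool" where
  "quasi_category X \<longleftrightarrow> simplicial_set X \<and>
     (\<forall>n i. 0 < i \<and> i < n \<longrightarrow> (\<forall>u\<in>sset_hom (horn n i) X. \<exists>w\<in>sset_hom (simplex n) X.
        sset_comp (horn n i) w (sset_id (horn n i)) = u))"

definition right_fibration :: "'a sset \<Rightarrow> 'b sset \<Rightarrow> (nat \<Rightarrow> 'a \<Rightarrow> 'b) \<Rightarrow> bool" where
  "right_fibration X T f \<longleftrightarrow> simplicial_set X \<and> simplicial_set T \<and> f \<in> sset_hom X T \<and>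
     (\<forall>n i. 0 < i \<and> i \<le> n \<longrightarrow> (\<forall>u\<in>sset_hom (horn n i) X. \<forall>v\<in>sset_hom (simplex n) T.
        sset_comp (horn n i) f u = sset_comp (horn n i) v (sset_id (horn n i)) \<longrightarrow>
        (\<exists>w\<in>sset_hom (simplex n) X.
           sset_comp (horn n i) w (sset_id (horn n i)) = u \<and> sset_comp (simplex n) f w = v)))"


section \<open>Cofinal maps\<close>

definition homotopic ::
    "'a sset \<Rightarrow> 'b sset \<Rightarrow> (nat \<Rightarrow> 'a \<Rightarrow> 'b) \<Rightarrow> (nat \<Rightarrow> 'a \<Rightarrow> 'b) \<Rightarrow> bool" where
  "homotopic X Y f g \<longleftrightarrow> (\<exists>H\<in>sset_hom (sset_prod X (simplex 1)) Y. \<forall>m. \<forall>x\<in>simps X m.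
     H m (x, \<lambda>i\<in>{..m}. 0) = f m x \<and> H m (x, \<lambda>i\<in>{..m}. 1) = g m x)"

text \<open>Only used below between Kan complexes, where one-step simplicial homotopy is an equivalence
  relation and the notion agrees with weak homotopy equivalence.\<close>

definition homotopy_equivalence :: "'a sset \<Rightarrow> 'b sset \<Rightarrow> (nat \<Rightarrow> 'a \<Rightarrow> 'b) \<Rightarrow> bool" where
  "homotopy_equivalence X Y f \<longleftrightarrow> f \<in> sset_hom X Y \<and>
     (\<exists>g\<in>sset_hom Y X. homotopic X X (sset_comp X g f) (sset_id X) \<and>
                        homotopic Y Y (sset_comp Y f g) (sset_id Y))"

text \<open>\<open>map_over S p X f\<close> is the simplicial set \<open>Map\<^sub>T(S, X)\<close> for \<open>p : S \<rightarrow> T\<close> and \<open>f : X \<rightarrow> T\<close>: its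
  \<open>n\<close>-simplices are the maps \<open>S \<times> \<Delta>\<^sup>n \<rightarrow> X\<close> over \<open>T\<close>.\<close>

definition map_over ::
    "'s sset \<Rightarrow> (nat \<Rightarrow> 's \<Rightarrow> 't) \<Rightarrow> 'x sset \<Rightarrow> (nat \<Rightarrow> 'x \<Rightarrow> 't)
      \<Rightarrow> (nat \<Rightarrow> 's \<times> (nat \<Rightarrow> nat) \<Rightarrow> 'x) sset" where
  "map_over S p X f =
     \<lparr> simps = (\<lambda>n. {h \<in> sset_hom (sset_prod S (simplex n)) X.
                      \<forall>m. \<forall>s\<in>simps S m. \<forall>\<beta>\<in>Delta m n. f m (h m (s, \<beta>)) = p m s}),
       pull = (\<lambda>k n \<alpha> h m. \<lambda>(s, \<beta>)\<in>simps S m \<times> Delta m k. h m (s, compose {..m} \<alpha> \<beta>)) \<rparr>"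

definition map_over_precomp ::
    "'s sset \<Rightarrow> 't sset \<Rightarrow> (nat \<Rightarrow> 's \<Rightarrow> 't) \<Rightarrow> 'x sset \<Rightarrow> (nat \<Rightarrow> 'x \<Rightarrow> 't)
      \<Rightarrow> nat \<Rightarrow> (nat \<Rightarrow> 't \<times> (nat \<Rightarrow> nat) \<Rightarrow> 'x) \<Rightarrow> (nat \<Rightarrow> 's \<times> (nat \<Rightarrow> nat) \<Rightarrow> 'x)" where
  "map_over_precomp S T p X f n =
     (\<lambda>h\<in>simps (map_over T (sset_id T) X f) n.
        \<lambda>m. \<lambda>(s, \<beta>)\<in>simps S m \<times> Delta m n. h m (p m s, \<beta>))"

text \<open>Cofinality in the sense of Higher Topos Theory, 4.1.1.1: for every right fibration \<open>X \<rightarrow> T\<close>,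
  the map \<open>Map\<^sub>T(T, X) \<rightarrow> Map\<^sub>T(S, X)\<close> is a homotopy equivalence. A HOL definition cannot quantify
  over the type holding the simplices of \<open>X\<close>, so this type is an argument; a statement about
  \<open>cofinal_map TYPE('x)\<close> for a free type variable \<open>'x\<close> concerns all right fibrations.\<close>

definition cofinal_map ::
    "'x itself \<Rightarrow> 's sset \<Rightarrow> 't sset \<Rightarrow> (nat \<Rightarrow> 's \<Rightarrow> 't) \<Rightarrow> bool" where
  "cofinal_map (_ :: 'x itself) S T p \<longleftrightarrow> simplicial_set S \<and> simplicial_set T \<and> p \<in> sset_hom S T \<and>
     (\<forall>(X :: 'x sset) f. right_fibration X T f \<longrightarrow>
        homotopy_equivalence (map_over T (sset_id T) X f) (map_over S p X f)
          (map_over_precomp S T p X f))"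


section \<open>Nerves and barycentric subdivision\<close>

text \<open>The nerve of the set \<open>A\<close> with the order \<open>r\<close> (restricted to \<open>A\<close>, if \<open>r\<close> is larger).\<close>

definition nerve :: "'a set \<Rightarrow> 'a rel \<Rightarrow> (nat \<Rightarrow> 'a) sset" where
  "nerve A r =
     \<lparr> simps = (\<lambda>m. {\<sigma> \<in> {..m} \<rightarrow>\<^sub>E A. \<forall>i j. i \<le> j \<and> j \<le> m \<longrightarrow> (\<sigma> i, \<sigma> j) \<in> r}),
       pull = (\<lambda>k m \<alpha> \<sigma>. compose {..k} \<sigma> \<alpha>) \<rparr>"

definition nerve_map :: "'a set \<Rightarrow> 'a rel \<Rightarrow> ('a \<Rightarrow> 'b) \<Rightarrow> nat \<Rightarrow> (nat \<Rightarrow> 'a) \<Rightarrow> (nat \<Rightarrow> 'b)" where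
  "nerve_map A r g m = (\<lambda>\<sigma>\<in>simps (nerve A r) m. compose {..m} g \<sigma>)"

definition sd :: "'p set \<Rightarrow> 'p rel \<Rightarrow> 'p list set" where
  "sd P r = {xs. xs \<noteq> [] \<and> set xs \<subseteq> P \<and> sorted_wrt (\<lambda>x y. (x, y) \<in> r \<and> x \<noteq> y) xs}"

definition sd_le :: "'p set \<Rightarrow> 'p rel \<Rightarrow> 'p list rel" where
  "sd_le P r = {(xs, ys). xs \<in> sd P r \<and> ys \<in> sd P r \<and> set xs \<subseteq> set ys}"

abbreviation nerve_sd_op :: "'p set \<Rightarrow> 'p rel \<Rightarrow> (nat \<Rightarrow> 'p list) sset" where
  "nerve_sd_op P r \<equiv> nerve (sd P r) ((sd_le P r)\<inverse>)"


section \<open>The simplicial set of chains\<close>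

text \<open>The poset \<open>V\<^sub>\<sigma> \<subseteq> [m] \<times> P\<close> of an \<open>m\<close>-simplex \<open>\<sigma>\<close> of \<open>N sd(P)\<^sup>o\<^sup>p\<close>, with the product order. Its
  nerve is the fibre product of \<open>\<Delta>\<^sup>m\<close> and \<open>N U(P)\<close> over \<open>N sd(P)\<^sup>o\<^sup>p\<close>.\<close>

definition V_poset :: "nat \<Rightarrow> (nat \<Rightarrow> 'p list) \<Rightarrow> (nat \<times> 'p) set" where
  "V_poset m \<sigma> = {(i, x). i \<le> m \<and> x \<in> set (\<sigma> i)}"

definition V_le :: "'p rel \<Rightarrow> (nat \<times> 'p) rel" where
  "V_le r = {((i, x), (j, y)). i \<le> j \<and> (x, y) \<in> r}"

text \<open>\<open>CF C P r F\<close> is \<open>q\<^sub>*(N U(P) \<times>\<^bsub>NP\<^esub> C)\<close>, in the model where an \<open>m\<close>-simplex is a pair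
  \<open>(\<sigma>, \<Theta>)\<close> of an \<open>m\<close>-simplex \<open>\<sigma>\<close> of \<open>N sd(P)\<^sup>o\<^sup>p\<close> and a map \<open>\<Theta> : N V\<^sub>\<sigma> \<rightarrow> C\<close> over \<open>NP\<close>; the operator
  \<open>\<alpha> : [k] \<rightarrow> [m]\<close> acts on \<open>\<Theta>\<close> by restriction along \<open>(i, x) \<mapsto> (\<alpha> i, x)\<close>.\<close>

definition CF ::
    "'c sset \<Rightarrow> 'p set \<Rightarrow> 'p rel \<Rightarrow> (nat \<Rightarrow> 'c \<Rightarrow> (nat \<Rightarrow> 'p))
      \<Rightarrow> ((nat \<Rightarrow> 'p list) \<times> (nat \<Rightarrow> (nat \<Rightarrow> nat \<times> 'p) \<Rightarrow> 'c)) sset" where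
  "CF C P r F =
     \<lparr> simps = (\<lambda>m. {(\<sigma>, \<Theta>). \<sigma> \<in> simps (nerve_sd_op P r) m \<and>
          \<Theta> \<in> sset_hom (nerve (V_poset m \<sigma>) (V_le r)) C \<and>
          sset_comp (nerve (V_poset m \<sigma>) (V_le r)) F \<Theta> = nerve_map (V_poset m \<sigma>) (V_le r) snd}),
       pull = (\<lambda>k m \<alpha> (\<sigma>, \<Theta>).
          (let \<tau> = pull (nerve_sd_op P r) k m \<alpha> \<sigma> in
            (\<tau>, sset_comp (nerve (V_poset k \<tau>) (V_le r)) \<Theta>
                  (nerve_map (V_poset k \<tau>) (V_le r) (\<lambda>(i, x). (\<alpha> i, x)))))) \<rparr>"

text \<open>\<open>p\<^sub>F\<close> restricts \<open>\<Theta>\<close> along \<open>i \<mapsto> (i, min \<sigma>\<^sub>i)\<close>; the minimum of a strictly increasing list is its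
  head.\<close>

definition pF ::
    "'c sset \<Rightarrow> 'p set \<Rightarrow> 'p rel \<Rightarrow> (nat \<Rightarrow> 'c \<Rightarrow> (nat \<Rightarrow> 'p))
      \<Rightarrow> nat \<Rightarrow> (nat \<Rightarrow> 'p list) \<times> (nat \<Rightarrow> (nat \<Rightarrow> nat \<times> 'p) \<Rightarrow> 'c) \<Rightarrow> 'c" where
  "pF C P r F m = (\<lambda>(\<sigma>, \<Theta>)\<in>simps (CF C P r F) m. \<Theta> m (\<lambda>i\<in>{..m}. (i, hd (\<sigma> i))))"

end

theory Submission
  imports Defs
begin

text \<open>Let \<open>X \<rightarrow> \<C>\<close> be a right fibration. There is a cylinder \<open>M\<close> of \<open>p\<^sub>F\<close> over \<open>\<C>\<close>
  that contains both \<open>\<C>\<close> and \<open>\<C>\<^sub>F(\<P>)\<close>, with additional simplices \<open>\<Delta>\<^sup>a \<star> N V\<^sub>\<sigma> \<rightarrow> \<C>\<close> running from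
  \<open>\<C>\<close> to \<open>\<C>\<^sub>F(\<P>)\<close>. Every section of \<open>X\<close> over \<open>\<C>\<^sub>F(\<P>)\<close> extends to \<open>M\<close>, relatively to any parameters \<open>Y\<^sub>0 \<subseteq> Y\<close>;
  restricting the extension to \<open>\<C>\<close> gives the homotopy inverse, and the evident transformation from
  \<open>\<C>\<^sub>F(\<P>) \<rightarrow> \<C> \<subseteq> M\<close> to the inclusion \<open>\<C>\<^sub>F(\<P>) \<subseteq> M\<close> and a second extension give the two homotopies.

  The extension exists because \<open>M\<close> arises from \<open>\<C>\<^sub>F(\<P>)\<close> by filling right horns. Fix a simplex of \<open>\<C>\<close>, with
  last vertex \<open>c\<close> over \<open>x\<close>. On the chains \<open>k\<close> under \<open>c\<close> there is the operation \<open>T\<close> that adds \<open>c\<close> to a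
  chain, in place of its entry over \<open>x\<close> if it has one, and there are natural maps \<open>k \<leftarrow> T k \<rightarrow> ({x}, c)\<close>.
  A simplex \<open>(k\<^sub>0, \<dots>, k\<^sub>n)\<close> whose first \<open>q\<close> vertices, and no more, are of the form \<open>T k\<close> is paired with the one in
  which \<open>T k\<^sub>q\<close> is inserted before \<open>k\<^sub>q\<close>, an inner horn; if all its vertices are of this form, it is paired with the one in which
  \<open>({x}, c)\<close> is inserted before the final vertices equal to \<open>({x}, c)\<close>.\<close>

section \<open>The simplex category\<close>

text \<open>The cylinder runs from \<C> to the chains, so an inserted vertex always has a vertex of
  \<C> before it and position 0 is never the missing one. The last position is missing only when
  \<open>({x}, c)\<close> is appended at the end of a simplex; this is where outer right horns
  enter. The vertex \<open>c\<close> changes when the last vertex in \<C> is deleted. The missing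
  simplex to be attached is therefore one with the fewest vertices in \<C>, then of least dimension:
  a face that changes \<open>c\<close> is present already, and the pairing has to be compatible only
  with operators that keep \<open>c\<close>. Degenerate simplices are not separated off. The stages
  are closed under every admissible insertion, degenerate ones included, and the free attachment of
  a new simplex follows from the absence of one face and the presence of all others. The parameters
  serve the mapping spaces: with the sections over the chains as parameters, one extension yields
  the inverse as a simplicial map; with an additional interval it yields a homotopy.\<close>

lemma DeltaI:
  assumes "\<alpha> \<in> extensional {..m}" "\<And>i. i \<le> m \<Longrightarrow> \<alpha> i \<le> n"
    "\<And>i j. i \<le> j \<Longrightarrow> j \<le> m \<Longrightarrow> \<alpha> i \<le> \<alpha> j"
  shows "\<alpha> \<in> Delta m n"
  using assms by (auto simp: Delta_def PiE_def mono_on_def)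

lemma Delta_le: "\<alpha> \<in> Delta m n \<Longrightarrow> i \<le> m \<Longrightarrow> \<alpha> i \<le> n"
  by (auto simp: Delta_def)

lemma Delta_mono: "\<alpha> \<in> Delta m n \<Longrightarrow> i \<le> j \<Longrightarrow> j \<le> m \<Longrightarrow> \<alpha> i \<le> \<alpha> j"
  by (auto simp: Delta_def mono_on_def)

lemma Delta_ext: "\<alpha> \<in> Delta m n \<Longrightarrow> \<alpha> \<in> extensional {..m}"
  by (auto simp: Delta_def PiE_def)

lemma Delta_eqI:
  "\<alpha> \<in> Delta m n \<Longrightarrow> \<beta> \<in> Delta m n' \<Longrightarrow> (\<And>i. i \<le> m \<Longrightarrow> \<alpha> i = \<beta> i) \<Longrightarrow> \<alpha> = \<beta>"
  by (rule extensionalityI[of _ "{..m}"]) (auto dest: Delta_ext)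

lemma Delta_compose: "\<alpha> \<in> Delta k m \<Longrightarrow> \<beta> \<in> Delta m n \<Longrightarrow> compose {..k} \<beta> \<alpha> \<in> Delta k n"
  by (rule DeltaI) (auto simp: compose_def intro: Delta_le Delta_mono)

definition Delta_id :: "nat \<Rightarrow> nat \<Rightarrow> nat" where
  "Delta_id n = (\<lambda>i\<in>{..n}. i)"

lemma Delta_id_in: "Delta_id n \<in> Delta n n"
  by (rule DeltaI) (auto simp: Delta_id_def)

lemma Delta_id_apply: "i \<le> n \<Longrightarrow> Delta_id n i = i"
  by (simp add: Delta_id_def)

lemma compose_Delta_id_left: "\<alpha> \<in> Delta m n \<Longrightarrow> compose {..m} (Delta_id n) \<alpha> = \<alpha>"
  by (rule Delta_eqI[OF Delta_compose[OF _ Delta_id_in]])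
    (auto simp: compose_def Delta_id_apply Delta_le)

lemma compose_Delta_id_right: "f \<in> extensional {..n} \<Longrightarrow> compose {..n} f (Delta_id n) = f"
  by (rule extensionalityI[of _ "{..n}"]) (auto simp: compose_def Delta_id_apply)

section \<open>Faces, degeneracies and sections of operators\<close>

definition face :: "nat \<Rightarrow> nat \<Rightarrow> nat \<Rightarrow> nat" where
  "face n i = (\<lambda>j\<in>{..n}. if j < i then j else Suc j)"

definition dgn :: "nat \<Rightarrow> nat \<Rightarrow> nat \<Rightarrow> nat" where
  "dgn n q = (\<lambda>j\<in>{..Suc n}. if j \<le> q then j else j - 1)"

lemma face_in: "face n i \<in> Delta n (Suc n)"
  by (rule DeltaI) (auto simp: face_def)

lemma dgn_in: "q \<le> n \<Longrightarrow> dgn n q \<in> Delta (Suc n) n"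
  by (rule DeltaI) (auto simp: dgn_def)

lemma face_apply: "j \<le> n \<Longrightarrow> face n i j = (if j < i then j else Suc j)"
  by (simp add: face_def)

lemma dgn_apply: "j \<le> Suc n \<Longrightarrow> dgn n q j = (if j \<le> q then j else j - 1)"
  by (simp add: dgn_def)

lemma face_cases:
  assumes "v \<le> Suc n" "v \<noteq> i" "i \<le> Suc n"
  obtains u where "u \<le> n" "face n i u = v"
proof (cases "v < i")
  case True then show ?thesis using that[of v] assms by (auto simp: face_def)
next
  case False then show ?thesis using that[of "v - 1"] assms by (auto simp: face_def)
qed

text \<open>Covering \<open>n + 1\<close> values forces injectivity, and a strictly increasing map
  is recovered from its image: its value at \<open>u\<close> is the element with exactly
  \<open>u\<close> elements of the image below it.\<close>

lemma face_surj_unique: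
  assumes z: "\<zeta> \<in> Delta n (Suc n)" and i: "i \<le> Suc n" and cov: "{..Suc n} - {i} \<subseteq> \<zeta> ` {..n}"
  shows "\<zeta> = face n i"
proof -
  have card: "card ({..Suc n} - {i}) = card {..n}" using i by simp
  have im: "\<zeta> ` {..n} = {..Suc n} - {i}"
    by (rule sym, rule card_seteq) (use cov card card_image_le[of "{..n}" \<zeta>] in auto)
  have inj: "inj_on \<zeta> {..n}"
    by (rule eq_card_imp_inj_on) (use im card in auto)
  have sm: "\<zeta> u < \<zeta> v" if "u < v" "v \<le> n" for u v
    using Delta_mono[OF z, of u v] inj_onD[OF inj, of u v] that by force
  have cnt: "card {w \<in> g ` {..n}. w < g u} = u"
    if g: "\<And>u v. u < v \<Longrightarrow> v \<le> n \<Longrightarrow> g u < g v" and "u \<le> n" for g :: "nat \<Rightarrow> nat" and u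
  proof -
    have "{w \<in> g ` {..n}. w < g u} = g ` {..<u}"
    proof (intro equalityI subsetI)
      fix w assume "w \<in> {w \<in> g ` {..n}. w < g u}"
      then obtain v where v: "v \<le> n" "w = g v" "g v < g u" by auto
      then have "v < u" using g[of u v] by (metis less_asym linorder_cases)
      then show "w \<in> g ` {..<u}" using v by auto
    next
      fix w assume "w \<in> g ` {..<u}"
      then show "w \<in> {w \<in> g ` {..n}. w < g u}" using g \<open>u \<le> n\<close> by auto
    qed
    moreover have "inj_on g {..<u}"
      by (rule linorder_inj_onI) (use g \<open>u \<le> n\<close> in \<open>auto simp: less_le\<close>)
    ultimately show ?thesis by (simp add: card_image)
  qed
  have fim: "face n i ` {..n} = {..Suc n} - {i}"
  proof (intro equalityI subsetI)
    show "v \<in> {..Suc n} - {i}" if "v \<in> face n i ` {..n}" for v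
      using that by (auto simp: face_def split: if_splits)
    show "v \<in> face n i ` {..n}" if "v \<in> {..Suc n} - {i}" for v
      using that face_cases[of v n i] i by (metis DiffE atMost_iff image_eqI singletonI)
  qed
  have fm: "face n i u < face n i v" if "u < v" "v \<le> n" for u v
    using that by (auto simp: face_def)
  show ?thesis
  proof (rule Delta_eqI[OF z face_in])
    fix u assume u: "u \<le> n"
    let ?D = "{..Suc n} - {i}"
    have c: "card {w \<in> ?D. w < \<zeta> u} = u" "card {w \<in> ?D. w < face n i u} = u"
      using cnt[of \<zeta> u] cnt[of "face n i" u] sm fm u im fim by auto
    have lt: "card {w \<in> ?D. w < a} < card {w \<in> ?D. w < b}" if "a < b" "a \<in> ?D" for a b
      by (rule psubset_card_mono) (use that in auto)
    have "\<zeta> u \<in> ?D" "face n i u \<in> ?D" using u im fim by auto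
    then show "\<zeta> u = face n i u"
      using lt[of "\<zeta> u" "face n i u"] lt[of "face n i u" "\<zeta> u"] c by (cases "\<zeta> u" "face n i u" rule: linorder_cases) auto
  qed
qed

lemma Delta_factor_face:
  assumes b: "\<beta> \<in> Delta m (Suc n)" and j: "j \<le> Suc n" "j \<notin> \<beta> ` {..m}"
  obtains \<gamma> where "\<gamma> \<in> Delta m n" "\<beta> = compose {..m} (face n j) \<gamma>"
proof
  let ?g = "\<lambda>t\<in>{..m}. if \<beta> t < j then \<beta> t else \<beta> t - 1"
  have le: "\<beta> t \<le> Suc n" "\<beta> t \<noteq> j" if "t \<le> m" for t using that b j Delta_le by auto
  show g: "?g \<in> Delta m n"
  proof (rule DeltaI)
    fix t assume "t \<le> m" then show "?g t \<le> n" using le[of t] j by auto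
  next
    fix s t assume "s \<le> t" "t \<le> m"
    then show "?g s \<le> ?g t" using le[of s] le[of t] Delta_mono[OF b, of s t] by auto
  qed simp
  show "\<beta> = compose {..m} (face n j) ?g"
  proof (rule Delta_eqI[OF b Delta_compose[OF g face_in]])
    fix t assume "t \<le> m"
    then show "\<beta> t = compose {..m} (face n j) ?g t"
      using le[of t] Delta_le[OF g, of t] j by (auto simp: compose_def face_apply)
  qed
qed

text \<open>Any choice of preimages is monotone because \<gamma> is strictly increasing. One value
  of \<delta> can be prescribed, which later allows two operators to be compared one argument at a
  time.\<close>

lemma Delta_section:
  assumes b: "\<beta> \<in> Delta m l" and g: "\<gamma> \<in> Delta n l" and sm: "\<And>u v. u < v \<Longrightarrow> v \<le> n \<Longrightarrow> \<gamma> u < \<gamma> v"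
    and cov: "\<gamma> ` {..n} \<subseteq> \<beta> ` {..m}" and t: "t \<le> m" "u0 \<le> n" "\<beta> t = \<gamma> u0"
  obtains \<delta> where "\<delta> \<in> Delta n m" "compose {..n} \<beta> \<delta> = \<gamma>" "\<delta> u0 = t"
proof -
  have "\<exists>s\<le>m. \<beta> s = \<gamma> u \<and> (u = u0 \<longrightarrow> s = t)" if "u \<le> n" for u
  proof (cases "u = u0")
    case False
    have "\<gamma> u \<in> \<beta> ` {..m}" using cov that by auto
    then show ?thesis using False by auto
  qed (use t in auto)
  then obtain d where d: "\<And>u. u \<le> n \<Longrightarrow> d u \<le> m \<and> \<beta> (d u) = \<gamma> u \<and> (u = u0 \<longrightarrow> d u = t)" by metis
  show thesis
  proof
    show D: "restrict d {..n} \<in> Delta n m"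
    proof (rule DeltaI)
      fix i j assume ij: "i \<le> j" "j \<le> n"
      show "restrict d {..n} i \<le> restrict d {..n} j"
      proof (cases "i = j")
        case False
        then have "\<beta> (d i) < \<beta> (d j)" using sm[of i j] d[of i] d[of j] ij by auto
        then have "\<not> d j \<le> d i" using Delta_mono[OF b, of "d j" "d i"] d[of i] ij by auto
        then show ?thesis using ij by auto
      qed simp
    qed (use d in auto)
    show "compose {..n} \<beta> (restrict d {..n}) = \<gamma>"
      by (rule Delta_eqI[OF Delta_compose[OF D b] g]) (use d in \<open>auto simp: compose_def\<close>)
    show "restrict d {..n} u0 = t" using d t by auto
  qed
qed

section \<open>Lifting along a relative cell complex of right horns\<close>

lemma sset_pull_in:
  "simplicial_set X \<Longrightarrow> \<alpha> \<in> Delta k m \<Longrightarrow> x \<in> simps X m \<Longrightarrow> pull X k m \<alpha> x \<in> simps X k"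
  by (auto simp: simplicial_set_def)

lemma sset_pull_id: "simplicial_set X \<Longrightarrow> x \<in> simps X m \<Longrightarrow> pull X m m (Delta_id m) x = x"
  by (auto simp: simplicial_set_def Delta_id_def)

lemma sset_pull_comp:
  "simplicial_set X \<Longrightarrow> \<alpha> \<in> Delta k l \<Longrightarrow> \<beta> \<in> Delta l m \<Longrightarrow> x \<in> simps X m \<Longrightarrow>
    pull X k l \<alpha> (pull X l m \<beta> x) = pull X k m (compose {..k} \<beta> \<alpha>) x"
  by (auto simp: simplicial_set_def)

lemma simplicial_setI:
  assumes "\<And>k m \<alpha> x. \<alpha> \<in> Delta k m \<Longrightarrow> x \<in> simps X m \<Longrightarrow> pull X k m \<alpha> x \<in> simps X k"
    and "\<And>m x. x \<in> simps X m \<Longrightarrow> pull X m m (Delta_id m) x = x"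
    and "\<And>k l m \<alpha> \<beta> x. \<alpha> \<in> Delta k l \<Longrightarrow> \<beta> \<in> Delta l m \<Longrightarrow> x \<in> simps X m \<Longrightarrow>
      pull X k m (compose {..k} \<beta> \<alpha>) x = pull X k l \<alpha> (pull X l m \<beta> x)"
  shows "simplicial_set X"
  using assms unfolding simplicial_set_def Delta_id_def by blast

lemma sset_hom_in: "f \<in> sset_hom X Y \<Longrightarrow> x \<in> simps X m \<Longrightarrow> f m x \<in> simps Y m"
  by (auto simp: sset_hom_def PiE_def)

lemma sset_hom_pull:
  "f \<in> sset_hom X Y \<Longrightarrow> \<alpha> \<in> Delta k m \<Longrightarrow> x \<in> simps X m \<Longrightarrow>
    f k (pull X k m \<alpha> x) = pull Y k m \<alpha> (f m x)"
  by (auto simp: sset_hom_def)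

lemma sset_hom_ext: "f \<in> sset_hom X Y \<Longrightarrow> f m \<in> extensional (simps X m)"
  by (auto simp: sset_hom_def PiE_def)

lemma sset_homI:
  assumes "\<And>m. f m \<in> extensional (simps X m)" "\<And>m x. x \<in> simps X m \<Longrightarrow> f m x \<in> simps Y m"
    "\<And>k m \<alpha> x. \<alpha> \<in> Delta k m \<Longrightarrow> x \<in> simps X m \<Longrightarrow> f k (pull X k m \<alpha> x) = pull Y k m \<alpha> (f m x)"
  shows "f \<in> sset_hom X Y"
  using assms unfolding sset_hom_def PiE_def by auto

lemma sset_hom_eqI:
  assumes "f \<in> sset_hom X Y" "g \<in> sset_hom X Z" "\<And>m x. x \<in> simps X m \<Longrightarrow> f m x = g m x"
  shows "f = g"
proof
  show "f m = g m" for m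
    by (rule extensionalityI[of _ "simps X m"]) (use assms sset_hom_ext in auto)
qed

lemma simps_simplex [simp]: "simps (simplex n) m = Delta m n"
  and pull_simplex [simp]: "pull (simplex n) k m \<alpha> \<beta> = compose {..k} \<beta> \<alpha>"
  by (simp_all add: simplex_def)

lemma simps_horn [simp]: "simps (horn n i) m = {\<beta> \<in> Delta m n. \<not> {..n} - {i} \<subseteq> \<beta> ` {..m}}"
  and pull_horn [simp]: "pull (horn n i) k m \<alpha> \<beta> = compose {..k} \<beta> \<alpha>"
  by (simp_all add: horn_def)

text \<open>A simplex all of whose faces but the \<open>i\<close>-th lie in \<open>S\<close> is attached to \<open>S\<close> along a horn: the
  operators whose value on it is not in \<open>S\<close> act freely.\<close>

lemma horn_attach:
  assumes B: "simplicial_set B" and S: "\<And>m n x \<alpha>. (n, x) \<in> S \<Longrightarrow> \<alpha> \<in> Delta m n \<Longrightarrow> (m, pull B m n \<alpha> x) \<in> S"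
    and b: "b \<in> simps B (Suc n)" and i: "i \<le> Suc n"
    and faces: "\<And>j. j \<le> Suc n \<Longrightarrow> j \<noteq> i \<Longrightarrow> (n, pull B n (Suc n) (face n j) b) \<in> S"
    and miss: "(n, pull B n (Suc n) (face n i) b) \<notin> S"
    and be: "\<beta> \<in> Delta m (Suc n)"
  shows "(m, pull B m (Suc n) \<beta> b) \<in> S \<longleftrightarrow> \<not> {..Suc n} - {i} \<subseteq> \<beta> ` {..m}" (is ?A)
    and "(m, pull B m (Suc n) \<beta> b) \<notin> S \<Longrightarrow> \<gamma> \<in> Delta m (Suc n) \<Longrightarrow>
      pull B m (Suc n) \<beta> b = pull B m (Suc n) \<gamma> b \<Longrightarrow> \<beta> = \<gamma>"
proof -
  have inS: "(m, pull B m (Suc n) \<beta> b) \<in> S"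
    if be: "\<beta> \<in> Delta m (Suc n)" and nc: "\<not> {..Suc n} - {i} \<subseteq> \<beta> ` {..m}" for \<beta> m
  proof -
    obtain j where j: "j \<le> Suc n" "j \<noteq> i" "j \<notin> \<beta> ` {..m}" using nc by auto
    obtain \<gamma> where g: "\<gamma> \<in> Delta m n" "\<beta> = compose {..m} (face n j) \<gamma>"
      using Delta_factor_face[OF be j(1,3)] .
    have "pull B m (Suc n) \<beta> b = pull B m n \<gamma> (pull B n (Suc n) (face n j) b)"
      using sset_pull_comp[OF B g(1) face_in b] g(2) by simp
    then show ?thesis using S[OF faces[OF j(1,2)] g(1)] by simp
  qed
  have fm: "face n i u < face n i v" if "u < v" "v \<le> n" for u v
    using that by (auto simp: face_def)
  have fim: "face n i u \<in> {..Suc n} - {i}" if "u \<le> n" for u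
    using that by (auto simp: face_def)
  have sec: "\<exists>\<delta>\<in>Delta n m. compose {..n} \<beta> \<delta> = face n i \<and> \<delta> u = t"
    if be: "\<beta> \<in> Delta m (Suc n)" "{..Suc n} - {i} \<subseteq> \<beta> ` {..m}" and tu: "t \<le> m" "u \<le> n" "\<beta> t = face n i u"
    for \<beta> m t u
  proof -
    have cov: "face n i ` {..n} \<subseteq> \<beta> ` {..m}" using fim that by blast
    show ?thesis
      by (rule Delta_section[OF be(1) face_in fm cov tu]) auto
  qed
  \<comment> \<open>An operator with the same value as the missing face cannot omit a vertex other
    than \<open>i\<close>, since its value would then lie in \<open>S\<close>.\<close>
  have free: "\<zeta> = face n i"
    if z: "\<zeta> \<in> Delta n (Suc n)" "pull B n (Suc n) \<zeta> b = pull B n (Suc n) (face n i) b" for \<zeta>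
    by (rule face_surj_unique[OF z(1) i]) (use inS[OF z(1)] miss z(2) in auto)
  have sec': "\<exists>\<delta>\<in>Delta n m. compose {..n} \<beta> \<delta> = face n i"
    if be: "\<beta> \<in> Delta m (Suc n)" "{..Suc n} - {i} \<subseteq> \<beta> ` {..m}" for \<beta> m
  proof -
    have "face n i 0 \<in> \<beta> ` {..m}" using fim[of 0] be by auto
    then obtain t where "t \<le> m" "\<beta> t = face n i 0" by auto
    then show ?thesis using sec[OF be, of t 0] by auto
  qed
  show 1: ?A
  proof
    assume *: "(m, pull B m (Suc n) \<beta> b) \<in> S"
    show "\<not> {..Suc n} - {i} \<subseteq> \<beta> ` {..m}"
    proof
      assume "{..Suc n} - {i} \<subseteq> \<beta> ` {..m}"
      then obtain \<delta> where d: "\<delta> \<in> Delta n m" "compose {..n} \<beta> \<delta> = face n i"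
        using sec'[OF be] by auto
      have "(n, pull B n m \<delta> (pull B m (Suc n) \<beta> b)) \<in> S" using S[OF * d(1)] .
      then show False using miss sset_pull_comp[OF B d(1) be b] d(2) by simp
    qed
  qed (rule inS[OF be])
  show "\<beta> = \<gamma>" if bS: "(m, pull B m (Suc n) \<beta> b) \<notin> S" and ga: "\<gamma> \<in> Delta m (Suc n)"
    and eq: "pull B m (Suc n) \<beta> b = pull B m (Suc n) \<gamma> b"
  proof -
    \<comment> \<open>Choose \<delta> through \<open>t\<close> so that \<beta> after \<delta> is the
      missing face. Then \<gamma> after \<delta> has the same value on \<open>b\<close>, hence is
      the same face by \<open>free\<close>, and evaluation at \<open>u\<close> compares \<beta> and
      \<gamma> at \<open>t\<close>.\<close>
    have half: "\<beta> t = \<gamma> t"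
      if be: "\<beta> \<in> Delta m (Suc n)" "{..Suc n} - {i} \<subseteq> \<beta> ` {..m}" and ga: "\<gamma> \<in> Delta m (Suc n)"
        and eq: "pull B m (Suc n) \<beta> b = pull B m (Suc n) \<gamma> b" and t: "t \<le> m" "\<beta> t \<noteq> i" for \<beta> \<gamma> t
    proof -
      obtain u where u: "u \<le> n" "face n i u = \<beta> t"
        using face_cases[of "\<beta> t" n i] Delta_le[OF be(1) t(1)] t i by auto
      obtain \<delta> where d: "\<delta> \<in> Delta n m" "compose {..n} \<beta> \<delta> = face n i" "\<delta> u = t"
        using sec[OF be t(1) u(1)] u(2) by auto
      have "pull B n (Suc n) (compose {..n} \<gamma> \<delta>) b = pull B n (Suc n) (face n i) b"
        using sset_pull_comp[OF B d(1) be(1) b] sset_pull_comp[OF B d(1) ga b] eq d(2) by simp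
      then have "compose {..n} \<gamma> \<delta> = face n i" using free Delta_compose[OF d(1) ga] by auto
      then have "compose {..n} \<gamma> \<delta> u = \<beta> t" using u by simp
      then show ?thesis using u d by (simp add: compose_def)
    qed
    have gS: "(m, pull B m (Suc n) \<gamma> b) \<notin> S" using bS eq by simp
    have cov: "{..Suc n} - {i} \<subseteq> \<beta> ` {..m}" "{..Suc n} - {i} \<subseteq> \<gamma> ` {..m}"
      using inS[OF be] inS[OF ga] bS gS by auto
    show ?thesis
    proof (rule Delta_eqI[OF be ga])
      \<comment> \<open>If only one of the two values is \<open>i\<close>, \<open>half\<close>
        applied to the other operator gives a contradiction; if both are \<open>i\<close> there is
        nothing to show.\<close>
      show "\<beta> t = \<gamma> t" if "t \<le> m" for t
        using half[OF be cov(1) ga eq that] half[OF ga cov(2) be eq[symmetric] that] by metis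
    qed
  qed
qed


text \<open>\<open>G\<close> is the graph of a lift of \<open>v\<close> over a subcomplex of
  \<open>B\<close>. The last two conclusions say that \<phi> agrees with this lift and depends only
  on the simplex of \<open>B\<close>, so the union of \<open>G\<close> with the values of \<phi> is
  again the graph of a function.\<close>

lemma right_fibration_extend_horn:
  assumes rf: "right_fibration X T f" and B: "simplicial_set B" and v: "v \<in> sset_hom B T"
    and G: "\<And>n x y. (n, x, y) \<in> G \<Longrightarrow> x \<in> simps B n \<and> y \<in> simps X n \<and> f n y = v n x"
    and fn: "\<And>n x y y'. (n, x, y) \<in> G \<Longrightarrow> (n, x, y') \<in> G \<Longrightarrow> y = y'"
    and cl: "\<And>m n x y \<alpha>. (n, x, y) \<in> G \<Longrightarrow> \<alpha> \<in> Delta m n \<Longrightarrow> (m, pull B m n \<alpha> x, pull X m n \<alpha> y) \<in> G"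
    and b: "b \<in> simps B (Suc n)" and i: "0 < i" "i \<le> Suc n"
    and faces: "\<And>j. j \<le> Suc n \<Longrightarrow> j \<noteq> i \<Longrightarrow> \<exists>y. (n, pull B n (Suc n) (face n j) b, y) \<in> G"
    and miss: "\<And>y. (n, pull B n (Suc n) (face n i) b, y) \<notin> G"
  obtains \<phi> where "\<phi> \<in> sset_hom (simplex (Suc n)) X"
    "\<And>m \<beta>. \<beta> \<in> Delta m (Suc n) \<Longrightarrow> f m (\<phi> m \<beta>) = v m (pull B m (Suc n) \<beta> b)"
    "\<And>m \<beta> y. \<beta> \<in> Delta m (Suc n) \<Longrightarrow> (m, pull B m (Suc n) \<beta> b, y) \<in> G \<Longrightarrow> y = \<phi> m \<beta>"
    "\<And>m \<beta> \<gamma>. \<beta> \<in> Delta m (Suc n) \<Longrightarrow> \<gamma> \<in> Delta m (Suc n) \<Longrightarrow>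
       pull B m (Suc n) \<beta> b = pull B m (Suc n) \<gamma> b \<Longrightarrow> \<phi> m \<beta> = \<phi> m \<gamma>"
proof -
  let ?S = "{(n, x). \<exists>y. (n, x, y) \<in> G}"
  let ?H = "horn (Suc n) i" and ?D = "simplex (Suc n)"
  let ?p = "\<lambda>m \<beta>. pull B m (Suc n) \<beta> b"
  have T: "simplicial_set T" and X: "simplicial_set X" using rf by (auto simp: right_fibration_def)
  have Scl: "(m, pull B m n \<alpha> x) \<in> ?S" if "(n, x) \<in> ?S" "\<alpha> \<in> Delta m n" for m n x \<alpha>
    using that cl by blast
  have Sf: "(n, pull B n (Suc n) (face n j) b) \<in> ?S" if "j \<le> Suc n" "j \<noteq> i" for j
    using faces that by blast
  have Sm: "(n, pull B n (Suc n) (face n i) b) \<notin> ?S"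
    using miss by blast
  note att = horn_attach[where S = ?S, OF B Scl b i(2) Sf Sm]
  have S1: "(m, ?p m \<beta>) \<in> ?S \<longleftrightarrow> \<beta> \<in> simps ?H m" if "\<beta> \<in> Delta m (Suc n)" for m \<beta>
    using att(1)[OF _ _ _ _ that] that by simp
  have S2: "\<beta> = \<gamma>" if "\<beta> \<in> Delta m (Suc n)" "\<gamma> \<in> Delta m (Suc n)" "(m, ?p m \<beta>) \<notin> ?S"
    "?p m \<beta> = ?p m \<gamma>" for m \<beta> \<gamma>
    using att(2)[OF _ _ _ _ that(1,3,2,4)] by simp
  define w where "w m x = (SOME y. (m, x, y) \<in> G)" for m x
  have w: "w m x = y" if "(m, x, y) \<in> G" for m x y
    unfolding w_def by (rule some_equality) (use that fn in auto)
  define u where "u m = (\<lambda>\<beta>\<in>simps ?H m. w m (?p m \<beta>))" for m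
  have uG: "(m, ?p m \<beta>, u m \<beta>) \<in> G" if be: "\<beta> \<in> simps ?H m" for m \<beta>
  proof -
    have "(m, ?p m \<beta>) \<in> ?S" using S1[of \<beta> m] be by auto
    then obtain y where "(m, ?p m \<beta>, y) \<in> G" by auto
    then show ?thesis using w be by (simp add: u_def)
  qed
  have sub: "\<beta> \<in> Delta m (Suc n)" if "\<beta> \<in> simps ?H m" for m \<beta> using that by simp
  have Hpull: "compose {..k} \<beta> \<alpha> \<in> simps ?H k" if "\<alpha> \<in> Delta k m" "\<beta> \<in> simps ?H m" for k m \<alpha> \<beta>
  proof -
    have "compose {..k} \<beta> \<alpha> ` {..k} \<subseteq> \<beta> ` {..m}"
      using Delta_le[OF that(1)] by (auto simp: compose_def)
    moreover have "compose {..k} \<beta> \<alpha> \<in> Delta k (Suc n)"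
      using Delta_compose[OF that(1) sub[OF that(2)]] .
    ultimately show ?thesis using that(2) by (simp only: simps_horn mem_Collect_eq) blast
  qed
  have u: "u \<in> sset_hom ?H X"
  proof (rule sset_homI)
    fix k m \<alpha> \<beta> assume a: "\<alpha> \<in> Delta k m" and be: "\<beta> \<in> simps ?H m"
    have "(k, ?p k (compose {..k} \<beta> \<alpha>), pull X k m \<alpha> (u m \<beta>)) \<in> G"
      using cl[OF uG[OF be] a] sset_pull_comp[OF B a sub[OF be] b] by simp
    moreover have "(k, ?p k (compose {..k} \<beta> \<alpha>), u k (compose {..k} \<beta> \<alpha>)) \<in> G"
      by (rule uG[OF Hpull[OF a be]])
    ultimately show "u k (pull ?H k m \<alpha> \<beta>) = pull X k m \<alpha> (u m \<beta>)"
      using fn by simp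
  next
    show "u m \<beta> \<in> simps X m" if "\<beta> \<in> simps ?H m" for m \<beta>
      using G[OF uG[OF that]] by blast
  qed (simp add: u_def)
  define z where "z m = (\<lambda>\<beta>\<in>Delta m (Suc n). v m (?p m \<beta>))" for m
  have z: "z \<in> sset_hom ?D T"
  proof (rule sset_homI)
    fix k m \<alpha> \<beta> assume a: "\<alpha> \<in> Delta k m" and be: "\<beta> \<in> simps ?D m"
    then have be: "\<beta> \<in> Delta m (Suc n)" by simp
    have "v k (pull B k m \<alpha> (?p m \<beta>)) = pull T k m \<alpha> (v m (?p m \<beta>))"
      by (rule sset_hom_pull[OF v a sset_pull_in[OF B be b]])
    then show "z k (pull ?D k m \<alpha> \<beta>) = pull T k m \<alpha> (z m \<beta>)"
      using be Delta_compose[OF a be] sset_pull_comp[OF B a be b] by (simp add: z_def)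
  qed (use sset_hom_in[OF v] sset_pull_in[OF B _ b] in \<open>auto simp: z_def\<close>)
  have "sset_comp ?H f u = sset_comp ?H z (sset_id ?H)"
  proof (intro ext)
    show "sset_comp ?H f u m \<beta> = sset_comp ?H z (sset_id ?H) m \<beta>" for m \<beta>
      using uG[of \<beta> m] G sub[of \<beta> m]
      by (auto simp: sset_comp_def sset_id_def compose_def z_def split: if_splits)
  qed
  then obtain \<phi> where phi: "\<phi> \<in> sset_hom ?D X" "sset_comp ?H \<phi> (sset_id ?H) = u" "sset_comp ?D f \<phi> = z"
    using rf u z i unfolding right_fibration_def by blast
  have phi2: "\<phi> m \<beta> = u m \<beta>" if "\<beta> \<in> simps ?H m" for m \<beta>
    using fun_cong[OF fun_cong[OF phi(2)], of m \<beta>] that by (simp add: sset_comp_def sset_id_def compose_def)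
  show thesis
  proof
    show "\<phi> \<in> sset_hom ?D X" by (rule phi(1))
    show "f m (\<phi> m \<beta>) = v m (?p m \<beta>)" if "\<beta> \<in> Delta m (Suc n)" for m \<beta>
      using fun_cong[OF fun_cong[OF phi(3)], of m \<beta>] that
      by (simp add: sset_comp_def compose_def z_def)
    show *: "y = \<phi> m \<beta>" if "\<beta> \<in> Delta m (Suc n)" "(m, ?p m \<beta>, y) \<in> G" for m \<beta> y
    proof -
      have "\<beta> \<in> simps ?H m" using S1[OF that(1)] that(2) by auto
      then show ?thesis using uG phi2 that fn by metis
    qed
    show "\<phi> m \<beta> = \<phi> m \<gamma>" if bg: "\<beta> \<in> Delta m (Suc n)" "\<gamma> \<in> Delta m (Suc n)" "?p m \<beta> = ?p m \<gamma>" for m \<beta> \<gamma>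
    proof (cases "(m, ?p m \<beta>) \<in> ?S")
      case True
      then obtain y where "(m, ?p m \<beta>, y) \<in> G" by auto
      then show ?thesis using *[OF bg(1)] *[OF bg(2)] bg(3) by metis
    next
      case False
      then show ?thesis using S2[OF bg(1,2) False bg(3)] by simp
    qed
  qed
qed

text \<open>The relation \<open>R\<close> will send a simplex to those obtained from it by
  insertion. With it a stage of the cell complex retains that the partner of a simplex is attached
  together with it.\<close>

definition closed_under :: "'a sset \<Rightarrow> ((nat \<times> 'a) \<times> (nat \<times> 'a)) set \<Rightarrow> (nat \<times> 'a) set \<Rightarrow> bool" where
  "closed_under B R S \<longleftrightarrow> (\<forall>(n, x)\<in>S. x \<in> simps B n) \<and>
     (\<forall>m n x. \<forall>\<alpha>\<in>Delta m n. (n, x) \<in> S \<longrightarrow> (m, pull B m n \<alpha> x) \<in> S) \<and>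
     (\<forall>z z'. (z, z') \<in> R \<longrightarrow> z \<in> S \<longrightarrow> z' \<in> S)"

definition generated :: "'a sset \<Rightarrow> nat \<Rightarrow> 'a \<Rightarrow> (nat \<times> 'a) set" where
  "generated B n b = {(m, pull B m n \<beta> b) |m \<beta>. \<beta> \<in> Delta m n}"

text \<open>A relative cell complex of right horns, whose stages are the subcomplexes closed under \<open>R\<close>.\<close>

lemma right_fibration_extend:
  fixes B :: "'a sset" and X :: "'x sset"
  assumes rf: "right_fibration X T f" and B: "simplicial_set B" and v: "v \<in> sset_hom B T"
    and A0: "closed_under B R A0"
    and u: "\<And>n x. (n, x) \<in> A0 \<Longrightarrow> u n x \<in> simps X n" "\<And>n x. (n, x) \<in> A0 \<Longrightarrow> f n (u n x) = v n x"
      "\<And>m n x \<alpha>. (n, x) \<in> A0 \<Longrightarrow> \<alpha> \<in> Delta m n \<Longrightarrow> u m (pull B m n \<alpha> x) = pull X m n \<alpha> (u n x)"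
    and step: "\<And>S n x. closed_under B R S \<Longrightarrow> A0 \<subseteq> S \<Longrightarrow> x \<in> simps B n \<Longrightarrow> (n, x) \<notin> S \<Longrightarrow>
      \<exists>n i b. b \<in> simps B (Suc n) \<and> 0 < i \<and> i \<le> Suc n \<and> (n, pull B n (Suc n) (face n i) b) \<notin> S \<and>
        (\<forall>j\<le>Suc n. j \<noteq> i \<longrightarrow> (n, pull B n (Suc n) (face n j) b) \<in> S) \<and>
        closed_under B R (S \<union> generated B (Suc n) b)"
  obtains w where "w \<in> sset_hom B X" "\<And>n x. (n, x) \<in> A0 \<Longrightarrow> w n x = u n x"
    "\<And>n x. x \<in> simps B n \<Longrightarrow> f n (w n x) = v n x"
proof -
  have X: "simplicial_set X" using rf by (auto simp: right_fibration_def)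
  let ?dom = "\<lambda>G :: (nat \<times> 'a \<times> 'x) set. {(n, x). \<exists>y. (n, x, y) \<in> G}"
  \<comment> \<open>Zorn's lemma is applied to graphs of partial lifts. Closure of the domain under
    \<open>R\<close> is part of the condition, so that \<open>step\<close> is available at a maximal
    one.\<close>
  define ok where "ok G \<longleftrightarrow>
      (\<forall>(n, x, y)\<in>G. x \<in> simps B n \<and> y \<in> simps X n \<and> f n y = v n x) \<and>
      (\<forall>n x y y'. (n, x, y) \<in> G \<longrightarrow> (n, x, y') \<in> G \<longrightarrow> y = y') \<and>
      (\<forall>m n x y. \<forall>\<alpha>\<in>Delta m n. (n, x, y) \<in> G \<longrightarrow> (m, pull B m n \<alpha> x, pull X m n \<alpha> y) \<in> G) \<and>
      (\<forall>n x. (n, x) \<in> A0 \<longrightarrow> (n, x, u n x) \<in> G) \<and>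
      (\<forall>z z'. (z, z') \<in> R \<longrightarrow> z \<in> ?dom G \<longrightarrow> z' \<in> ?dom G)" for G
  let ?Z = "Collect ok"
  have "{(n, x, u n x) |n x. (n, x) \<in> A0} \<in> ?Z"
    using A0 u unfolding ok_def closed_under_def by auto
  then have ne: "?Z \<noteq> {}" by blast
  have chain: "\<Union>\<C> \<in> ?Z" if "\<C> \<noteq> {}" "subset.chain ?Z \<C>" for \<C>
  proof -
    have okC: "ok G" if "G \<in> \<C>" for G using that \<open>subset.chain ?Z \<C>\<close> by (auto simp: subset.chain_def)
    have tot: "G \<subseteq> G' \<or> G' \<subseteq> G" if "G \<in> \<C>" "G' \<in> \<C>" for G G'
      using that \<open>subset.chain ?Z \<C>\<close> by (auto simp: subset_chain_def)
    have "ok (\<Union>\<C>)"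
      unfolding ok_def
    proof (intro conjI)
      show "\<forall>(n, x, y)\<in>\<Union>\<C>. x \<in> simps B n \<and> y \<in> simps X n \<and> f n y = v n x"
        using okC unfolding ok_def by blast
      show "\<forall>n x y y'. (n, x, y) \<in> \<Union>\<C> \<longrightarrow> (n, x, y') \<in> \<Union>\<C> \<longrightarrow> y = y'"
      proof (intro allI impI)
        fix n x y y' assume "(n, x, y) \<in> \<Union>\<C>" "(n, x, y') \<in> \<Union>\<C>"
        then obtain G G' where "G \<in> \<C>" "G' \<in> \<C>" "(n, x, y) \<in> G" "(n, x, y') \<in> G'" by auto
        then obtain G where "G \<in> \<C>" "(n, x, y) \<in> G" "(n, x, y') \<in> G" using tot by blast
        then show "y = y'" using okC unfolding ok_def by blast
      qed
      show "\<forall>m n x y. \<forall>\<alpha>\<in>Delta m n. (n, x, y) \<in> \<Union>\<C> \<longrightarrow> (m, pull B m n \<alpha> x, pull X m n \<alpha> y) \<in> \<Union>\<C>"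
        using okC unfolding ok_def by blast
      show "\<forall>n x. (n, x) \<in> A0 \<longrightarrow> (n, x, u n x) \<in> \<Union>\<C>"
        using okC \<open>\<C> \<noteq> {}\<close> unfolding ok_def by blast
      show "\<forall>z z'. (z, z') \<in> R \<longrightarrow> z \<in> ?dom (\<Union>\<C>) \<longrightarrow> z' \<in> ?dom (\<Union>\<C>)"
      proof (intro allI impI)
        fix z z' assume zz: "(z, z') \<in> R" and "z \<in> ?dom (\<Union>\<C>)"
        then obtain G where G: "G \<in> \<C>" "z \<in> ?dom G" by auto
        then have "z' \<in> ?dom G" using okC[OF G(1)] zz unfolding ok_def by blast
        then show "z' \<in> ?dom (\<Union>\<C>)" using G(1) by auto
      qed
    qed
    then show ?thesis by simp
  qed
  obtain G where "ok G" and max: "\<And>G'. ok G' \<Longrightarrow> G \<subseteq> G' \<Longrightarrow> G' = G"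
    using subset_Zorn_nonempty[OF ne chain] by auto
  have G: "\<And>n x y. (n, x, y) \<in> G \<Longrightarrow> x \<in> simps B n \<and> y \<in> simps X n \<and> f n y = v n x"
    and fn: "\<And>n x y y'. (n, x, y) \<in> G \<Longrightarrow> (n, x, y') \<in> G \<Longrightarrow> y = y'"
    and cl: "\<And>m n x y \<alpha>. (n, x, y) \<in> G \<Longrightarrow> \<alpha> \<in> Delta m n \<Longrightarrow> (m, pull B m n \<alpha> x, pull X m n \<alpha> y) \<in> G"
    and uG: "\<And>n x. (n, x) \<in> A0 \<Longrightarrow> (n, x, u n x) \<in> G"
    and RG: "\<And>z z'. (z, z') \<in> R \<Longrightarrow> z \<in> ?dom G \<Longrightarrow> z' \<in> ?dom G"
    using \<open>ok G\<close> unfolding ok_def by blast+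
  have all: "\<exists>y. (n, x, y) \<in> G" if x: "x \<in> simps B n" for n x
  proof (rule ccontr)
    assume "\<nexists>y. (n, x, y) \<in> G"
    then have nS: "(n, x) \<notin> ?dom G" by auto
    have cu: "closed_under B R (?dom G)"
      unfolding closed_under_def
    proof (intro conjI)
      show "\<forall>z z'. (z, z') \<in> R \<longrightarrow> z \<in> ?dom G \<longrightarrow> z' \<in> ?dom G" using RG by blast
    qed (use G cl in blast)+
    obtain n i b where b: "b \<in> simps B (Suc n)" and i: "0 < i" "i \<le> Suc n"
      and miss: "(n, pull B n (Suc n) (face n i) b) \<notin> ?dom G"
      and faces: "\<And>j. j \<le> Suc n \<Longrightarrow> j \<noteq> i \<Longrightarrow> (n, pull B n (Suc n) (face n j) b) \<in> ?dom G"
      and cu': "closed_under B R (?dom G \<union> generated B (Suc n) b)"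
      using step[OF cu _ x nS] uG by blast
    have faces': "\<exists>y. (n, pull B n (Suc n) (face n j) b, y) \<in> G" if "j \<le> Suc n" "j \<noteq> i" for j
      using faces[OF that] by blast
    have miss': "(n, pull B n (Suc n) (face n i) b, y) \<notin> G" for y
      using miss by blast
    obtain \<phi> where phi: "\<phi> \<in> sset_hom (simplex (Suc n)) X"
      "\<And>m \<beta>. \<beta> \<in> Delta m (Suc n) \<Longrightarrow> f m (\<phi> m \<beta>) = v m (pull B m (Suc n) \<beta> b)"
      "\<And>m \<beta> y. \<beta> \<in> Delta m (Suc n) \<Longrightarrow> (m, pull B m (Suc n) \<beta> b, y) \<in> G \<Longrightarrow> y = \<phi> m \<beta>"
      "\<And>m \<beta> \<gamma>. \<beta> \<in> Delta m (Suc n) \<Longrightarrow> \<gamma> \<in> Delta m (Suc n) \<Longrightarrow>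
         pull B m (Suc n) \<beta> b = pull B m (Suc n) \<gamma> b \<Longrightarrow> \<phi> m \<beta> = \<phi> m \<gamma>"
      by (rule right_fibration_extend_horn[OF rf B v G fn cl b i faces' miss'], assumption+) (rule that)
    let ?N = "{(m, pull B m (Suc n) \<beta> b, \<phi> m \<beta>) |m \<beta>. \<beta> \<in> Delta m (Suc n)}"
    have dom: "?dom (G \<union> ?N) = ?dom G \<union> generated B (Suc n) b"
      by (auto simp: generated_def)
    have "ok (G \<union> ?N)"
      unfolding ok_def
    proof (intro conjI)
      show "\<forall>(n, x, y)\<in>G \<union> ?N. x \<in> simps B n \<and> y \<in> simps X n \<and> f n y = v n x"
        using G phi(2) sset_hom_in[OF phi(1)] sset_pull_in[OF B _ b] by auto
      show "\<forall>n x y y'. (n, x, y) \<in> G \<union> ?N \<longrightarrow> (n, x, y') \<in> G \<union> ?N \<longrightarrow> y = y'"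
      proof (intro allI impI)
        fix m x y y' assume y: "(m, x, y) \<in> G \<union> ?N" "(m, x, y') \<in> G \<union> ?N"
        have "y = \<phi> m \<beta>" if h: "x = pull B m (Suc n) \<beta> b" "\<beta> \<in> Delta m (Suc n)" "(m, x, y) \<in> G \<union> ?N" for \<beta> y
        proof (cases "(m, x, y) \<in> G")
          case True then show ?thesis using phi(3)[OF h(2)] h(1) by simp
        next
          case False
          then obtain \<gamma> where "\<gamma> \<in> Delta m (Suc n)" "x = pull B m (Suc n) \<gamma> b" "y = \<phi> m \<gamma>"
            using h(3) by blast
          then show ?thesis using phi(4)[OF h(2)] h(1) by simp
        qed
        note * = this
        show "y = y'"
        proof (cases "(m, x, y) \<in> G \<and> (m, x, y') \<in> G")
          case True then show ?thesis using fn by blast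
        next
          case False
          then obtain \<beta> where "\<beta> \<in> Delta m (Suc n)" "x = pull B m (Suc n) \<beta> b"
            using y by blast
          then show ?thesis using *[of \<beta> y] *[of \<beta> y'] y by simp
        qed
      qed
      show "\<forall>k m x y. \<forall>\<alpha>\<in>Delta k m. (m, x, y) \<in> G \<union> ?N \<longrightarrow> (k, pull B k m \<alpha> x, pull X k m \<alpha> y) \<in> G \<union> ?N"
      proof (intro allI ballI impI)
        fix k m x y \<alpha> assume a: "\<alpha> \<in> Delta k m" and xy: "(m, x, y) \<in> G \<union> ?N"
        show "(k, pull B k m \<alpha> x, pull X k m \<alpha> y) \<in> G \<union> ?N"
        proof (cases "(m, x, y) \<in> G")
          case True then show ?thesis using cl a by blast
        next
          case False
          then obtain \<beta> where be: "\<beta> \<in> Delta m (Suc n)" and x: "x = pull B m (Suc n) \<beta> b" and y: "y = \<phi> m \<beta>"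
            using xy by auto
          have "pull X k m \<alpha> y = \<phi> k (compose {..k} \<beta> \<alpha>)"
            using sset_hom_pull[OF phi(1) a, of \<beta>] be y by simp
          moreover have "pull B k m \<alpha> x = pull B k (Suc n) (compose {..k} \<beta> \<alpha>) b"
            using sset_pull_comp[OF B a be b] x by simp
          ultimately show ?thesis using Delta_compose[OF a be] by auto
        qed
      qed
      show "\<forall>n x. (n, x) \<in> A0 \<longrightarrow> (n, x, u n x) \<in> G \<union> ?N" using uG by auto
      show "\<forall>z z'. (z, z') \<in> R \<longrightarrow> z \<in> ?dom (G \<union> ?N) \<longrightarrow> z' \<in> ?dom (G \<union> ?N)"
        using cu' unfolding dom closed_under_def by blast
    qed
    then have "G \<union> ?N = G" using max by blast
    then have "(n, pull B n (Suc n) (face n i) b, \<phi> n (face n i)) \<in> G" using face_in by blast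
    then show False using miss by auto
  qed
  define w where "w n = (\<lambda>x\<in>simps B n. SOME y. (n, x, y) \<in> G)" for n
  have w: "(n, x, w n x) \<in> G" if "x \<in> simps B n" for n x
    using someI_ex[OF all[OF that]] that by (simp add: w_def)
  show thesis
  proof
    show "w \<in> sset_hom B X"
    proof (rule sset_homI)
      fix k m \<alpha> x assume a: "\<alpha> \<in> Delta k m" and x: "x \<in> simps B m"
      show "w k (pull B k m \<alpha> x) = pull X k m \<alpha> (w m x)"
        using fn w[OF sset_pull_in[OF B a x]] cl[OF w[OF x] a] by blast
    next
      show "w m x \<in> simps X m" if "x \<in> simps B m" for m x
        using G[OF w[OF that]] by blast
    qed (simp add: w_def)
    show "w n x = u n x" if "(n, x) \<in> A0" for n x
      using uG[OF that] G w fn by blast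
    show "f n (w n x) = v n x" if "x \<in> simps B n" for n x
      using w[OF that] G by blast
  qed
qed

section \<open>The pairing of simplices\<close>

lemma Delta_dgn_face:
  "q \<le> n \<Longrightarrow> compose {..n} (dgn n q) (face n q) = Delta_id n"
  "q \<le> n \<Longrightarrow> compose {..n} (dgn n q) (face n (Suc q)) = Delta_id n"
  by (rule Delta_eqI[OF Delta_compose[OF face_in dgn_in] Delta_id_in];
      auto simp: compose_def face_def dgn_def Delta_id_def)+

text \<open>The natural maps \<open>T k \<rightarrow> k\<close> and
  \<open>T k \<rightarrow> ({x}, c)\<close> both start at \<open>T k\<close>. Hence a simplex may
  pass once from mode 0 to another mode, and these profiles are the only ones needed.\<close>

definition cut :: "nat \<Rightarrow> nat \<Rightarrow> nat \<Rightarrow> nat" where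
  "cut t c j = (if j < c then 0 else t)"

text \<open>The effect of mode \<open>a\<close> after mode \<open>b\<close>: adding \<open>c\<close>
  is idempotent and leaves \<open>({x}, c)\<close> as it is, while mode 2 forgets what was there
  before.\<close>

definition mode_comp :: "nat \<Rightarrow> nat \<Rightarrow> nat" where
  "mode_comp a b = (if a = 2 \<or> a = 0 \<and> b = 2 then 2 else if a = 0 then 0 else b)"

text \<open>An abstract version of \<open>cyl_op\<close> below: \<open>p N k\<close> counts the vertices of \<open>k\<close> that lie in \<open>\<C>\<close>, which come
  first, and \<open>Op N k L \<alpha> \<mu>\<close> is \<open>\<alpha>\<^sup>*k\<close> with its vertex \<open>j\<close> replaced by \<open>T k\<^sub>\<alpha>\<^sub>j\<close>, kept, or replaced by \<open>({x}, c)\<close>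
  according to the mode \<open>\<mu> j = 0, 1, 2\<close>. The reference vertex \<open>c\<close> is always that of \<open>k\<close> and not that
  of \<open>\<alpha>\<^sup>*k\<close>.\<close>

locale cut_operators =
  fixes B :: "'b sset" and p :: "nat \<Rightarrow> 'b \<Rightarrow> nat"
    and Op :: "nat \<Rightarrow> 'b \<Rightarrow> nat \<Rightarrow> (nat \<Rightarrow> nat) \<Rightarrow> (nat \<Rightarrow> nat) \<Rightarrow> 'b"
    and Q :: "(nat \<times> 'b) set"
  assumes B: "simplicial_set B"
    and p_le: "k \<in> simps B N \<Longrightarrow> p N k \<le> Suc N"
    and p_pull: "k \<in> simps B N \<Longrightarrow> \<alpha> \<in> Delta L N \<Longrightarrow> j \<le> L \<Longrightarrow> j < p L (pull B L N \<alpha> k) \<longleftrightarrow> \<alpha> j < p N k"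
    and Op_in: "k \<in> simps B N \<Longrightarrow> 0 < p N k \<Longrightarrow> \<alpha> \<in> Delta L N \<Longrightarrow> t = 1 \<or> t = 2 \<Longrightarrow>
      Op N k L \<alpha> (cut t c) \<in> simps B L"
    and p_Op: "k \<in> simps B N \<Longrightarrow> 0 < p N k \<Longrightarrow> \<alpha> \<in> Delta L N \<Longrightarrow> t = 1 \<or> t = 2 \<Longrightarrow> j \<le> L \<Longrightarrow>
      j < p L (Op N k L \<alpha> (cut t c)) \<longleftrightarrow> \<alpha> j < p N k \<and> \<not> (t = 2 \<and> c \<le> j)"
    and Op_cong: "(\<And>j. j \<le> L \<Longrightarrow> \<mu> j = \<mu>' j) \<Longrightarrow> Op N k L \<alpha> \<mu> = Op N k L \<alpha> \<mu>'"
    and pull_Op: "k \<in> simps B N \<Longrightarrow> 0 < p N k \<Longrightarrow> \<alpha> \<in> Delta M N \<Longrightarrow> t = 1 \<or> t = 2 \<Longrightarrow> \<delta> \<in> Delta L M \<Longrightarrow>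
      pull B L M \<delta> (Op N k M \<alpha> (cut t c)) = Op N k L (compose {..L} \<alpha> \<delta>) (\<lambda>j. cut t c (\<delta> j))"
    and Op_pull: "k \<in> simps B N \<Longrightarrow> \<kappa> \<in> Delta M N \<Longrightarrow> 0 < p M (pull B M N \<kappa> k) \<Longrightarrow>
      \<kappa> (p M (pull B M N \<kappa> k) - 1) = p N k - 1 \<Longrightarrow> \<alpha> \<in> Delta L M \<Longrightarrow> t = 1 \<or> t = 2 \<Longrightarrow>
      Op M (pull B M N \<kappa> k) L \<alpha> (cut t c) = Op N k L (compose {..L} \<kappa> \<alpha>) (cut t c)"
    and Op_Op: "k \<in> simps B N \<Longrightarrow> 0 < p N k \<Longrightarrow> \<alpha> \<in> Delta M N \<Longrightarrow> t = 1 \<or> t = 2 \<Longrightarrow>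
      0 < p M (Op N k M \<alpha> (cut t c)) \<Longrightarrow> \<alpha> (p M (Op N k M \<alpha> (cut t c)) - 1) = p N k - 1 \<Longrightarrow>
      \<beta> \<in> Delta L M \<Longrightarrow> t' = 1 \<or> t' = 2 \<Longrightarrow>
      Op M (Op N k M \<alpha> (cut t c)) L \<beta> (cut t' c') =
        Op N k L (compose {..L} \<alpha> \<beta>) (\<lambda>j. mode_comp (cut t' c' j) (cut t c (\<beta> j)))"
    and Op_keep: "k \<in> simps B N \<Longrightarrow> 0 < p N k \<Longrightarrow> c \<le> p N k \<Longrightarrow> Op N k N (Delta_id N) (cut 1 c) = k"
    and Q_sub: "(N, k) \<in> Q \<Longrightarrow> k \<in> simps B N"
    and Q_pull: "(N, k) \<in> Q \<Longrightarrow> \<alpha> \<in> Delta L N \<Longrightarrow> (L, pull B L N \<alpha> k) \<in> Q"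
    and Q_Op: "(N, k) \<in> Q \<Longrightarrow> 0 < p N k \<Longrightarrow> \<alpha> \<in> Delta L N \<Longrightarrow> t = 1 \<or> t = 2 \<Longrightarrow>
      (L, Op N k L \<alpha> (cut t c)) \<in> Q"
begin

text \<open>\<open>fixed 1 q\<close> says that the chains of \<open>k\<close> before position \<open>q\<close> are of the form \<open>T\<close>, and \<open>fixed 2 e\<close> that all
  chains are and those from position \<open>e\<close> on equal \<open>({x}, c)\<close>. \<open>Ins t N k q\<close> has \<open>k\<close> as its face \<open>q\<close> if
  \<open>t = 1\<close> and as its face \<open>Suc q\<close> if \<open>t = 2\<close>.\<close>

definition fixed :: "nat \<Rightarrow> nat \<Rightarrow> nat \<Rightarrow> 'b \<Rightarrow> bool" where
  "fixed t c N k \<longleftrightarrow> Op N k N (Delta_id N) (cut t c) = k"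

definition Ins :: "nat \<Rightarrow> nat \<Rightarrow> 'b \<Rightarrow> nat \<Rightarrow> 'b" where
  "Ins t N k q = Op N k (Suc N) (dgn N q) (cut t (Suc q))"

definition insertable :: "nat \<Rightarrow> nat \<Rightarrow> 'b \<Rightarrow> nat \<Rightarrow> bool" where
  "insertable t N k q \<longleftrightarrow> k \<in> simps B N \<and> 0 < p N k \<and> q \<le> N \<and>
     (t = 1 \<and> p N k \<le> q \<and> fixed 1 q N k \<or> t = 2 \<and> p N k \<le> Suc q \<and> fixed 2 (Suc q) N k)"

text \<open>All admissible insertions are taken, not only the one that defines the partner of
  \<open>k\<close>. The others turn out to be degeneracies of \<open>k\<close>, so they ask nothing
  more of a subcomplex, and the relation becomes stable under surjective operators.\<close>

definition R :: "((nat \<times> 'b) \<times> (nat \<times> 'b)) set" where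
  "R = {((N, k), (Suc N, Ins t N k q)) |t N k q. insertable t N k q}"

definition A0 :: "(nat \<times> 'b) set" where
  "A0 = Q \<union> {(N, k). k \<in> simps B N \<and> p N k = 0}"

text \<open>The last vertex in \<C> of the pulled back simplex is the last one of \<open>k\<close>,
  so both simplices have the same reference vertex \<open>c\<close> and their operators can be
  compared.\<close>

definition keeps_ref :: "nat \<Rightarrow> nat \<Rightarrow> (nat \<Rightarrow> nat) \<Rightarrow> 'b \<Rightarrow> bool" where
  "keeps_ref M N \<kappa> k \<longleftrightarrow> \<kappa> \<in> Delta M N \<and> 0 < p M (pull B M N \<kappa> k) \<and> \<kappa> (p M (pull B M N \<kappa> k) - 1) = p N k - 1"

section \<open>Simplices fixed by an operator, and insertion into them\<close>

lemma fixed_Op: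
  assumes k: "k \<in> simps B N" "0 < p N k" and t: "t = 1 \<or> t = 2" "t' = 1 \<or> t' = 2"
    and f: "fixed t c N k" and a: "\<alpha> \<in> Delta L N"
  shows "Op N k L \<alpha> (cut t' c') = Op N k L \<alpha> (\<lambda>j. mode_comp (cut t' c' j) (cut t c (\<alpha> j)))"
proof -
  have e: "Op N k N (Delta_id N) (cut t c) = k" using f by (simp add: fixed_def)
  have id: "Delta_id N (p N k - 1) = p N k - 1" using p_le[OF k(1)] by (intro Delta_id_apply) auto
  show ?thesis
    using Op_Op[OF k Delta_id_in t(1), of c \<alpha> L t' c'] k id a t(2)
    by (simp add: e compose_Delta_id_left)
qed

lemma fixed_pull:
  assumes k: "k \<in> simps B N" "0 < p N k" and t: "t = 1 \<or> t = 2" and f: "fixed t c N k" and a: "\<alpha> \<in> Delta L N"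
  shows "pull B L N \<alpha> k = Op N k L \<alpha> (\<lambda>j. cut t c (\<alpha> j))"
  using pull_Op[OF k Delta_id_in t a, of c] f compose_Delta_id_left[OF a] by (simp add: fixed_def)

text \<open>A simplex fixed by one operator is fixed by a second one as soon as the second after the
  first has the modes of the first. The three cases are computations with
  \<open>mode_comp\<close>.\<close>

lemma fixed_mono:
  assumes k: "k \<in> simps B N" "0 < p N k"
  shows "fixed 1 c N k \<Longrightarrow> c' \<le> c \<Longrightarrow> fixed 1 c' N k"
    and "fixed 2 c N k \<Longrightarrow> c \<le> c' \<Longrightarrow> fixed 2 c' N k"
    and "fixed 2 c N k \<Longrightarrow> fixed 1 c' N k"
proof -
  have *: "fixed t' c' N k" if t: "t = 1 \<or> t = 2" "t' = 1 \<or> t' = 2" and f: "fixed t c N k"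
    and c: "\<And>j. mode_comp (cut t' c' j) (cut t c j) = cut t c j" for t t' c c'
  proof -
    have "Op N k N (Delta_id N) (cut t' c') = Op N k N (Delta_id N) (cut t c)"
      unfolding fixed_Op[OF k t f Delta_id_in] by (rule Op_cong) (use c in \<open>auto simp: Delta_id_def\<close>)
    then show ?thesis using f by (simp add: fixed_def)
  qed
  show "fixed 1 c N k \<Longrightarrow> c' \<le> c \<Longrightarrow> fixed 1 c' N k"
    by (rule *[of 1 1 c]) (auto simp: mode_comp_def cut_def)
  show "fixed 2 c N k \<Longrightarrow> c \<le> c' \<Longrightarrow> fixed 2 c' N k"
    by (rule *[of 2 2 c]) (auto simp: mode_comp_def cut_def)
  show "fixed 2 c N k \<Longrightarrow> fixed 1 c' N k"
    by (rule *[of 2 1 c]) (auto simp: mode_comp_def cut_def)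
qed

lemma fixed_all: "fixed 1 (Suc N) N k \<Longrightarrow> fixed 2 (Suc N) N k"
  using Op_cong[of N "cut 1 (Suc N)" "cut 2 (Suc N)" N k "Delta_id N"] by (simp add: fixed_def cut_def)

text \<open>In these cases the inserted vertex repeats the one at \<open>q\<close>: either
  \<open>T\<close> fixes it or it is \<open>({x}, c)\<close> already.\<close>

lemma Ins_degenerate:
  assumes k: "k \<in> simps B N" "0 < p N k" and q: "q \<le> N"
  shows "fixed 1 (Suc q) N k \<Longrightarrow> Ins 1 N k q = pull B (Suc N) N (dgn N q) k"
    and "fixed 2 q N k \<Longrightarrow> Ins 2 N k q = pull B (Suc N) N (dgn N q) k"
proof -
  have *: "Ins t N k q = pull B (Suc N) N (dgn N q) k"
    if t: "t = 1 \<or> t = 2" and f: "fixed t c N k"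
      and c: "\<And>j. j \<le> Suc N \<Longrightarrow> mode_comp (cut t (Suc q) j) (cut t c (dgn N q j)) = cut t c (dgn N q j)" for t c
    unfolding Ins_def fixed_Op[OF k t t f dgn_in[OF q]] fixed_pull[OF k t f dgn_in[OF q]]
    by (rule Op_cong) (use c in auto)
  show "fixed 1 (Suc q) N k \<Longrightarrow> Ins 1 N k q = pull B (Suc N) N (dgn N q) k"
    by (rule *[of 1 "Suc q"]) (auto simp: mode_comp_def cut_def dgn_def)
  show "fixed 2 q N k \<Longrightarrow> Ins 2 N k q = pull B (Suc N) N (dgn N q) k"
    by (rule *[of 2 q]) (auto simp: mode_comp_def cut_def dgn_def)
qed

lemma p_pull_eq:
  assumes k: "k \<in> simps B N" and kr: "keeps_ref L N \<kappa> k"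
  shows "0 < p N k"
proof -
  let ?P = "p L (pull B L N \<kappa> k)"
  have L: "\<kappa> \<in> Delta L N" "0 < ?P" using kr by (auto simp: keeps_ref_def)
  have "?P - 1 \<le> L" using p_le[OF sset_pull_in[OF B L(1) k]] by auto
  then have "\<kappa> (?P - 1) < p N k" using p_pull[OF k L(1), of "?P - 1"] L by auto
  then show ?thesis by simp
qed

lemma keeps_ref_surj:
  assumes k: "k \<in> simps B N" "0 < p N k" and a: "\<alpha> \<in> Delta L N" and s: "{..N} \<subseteq> \<alpha> ` {..L}"
  shows "keeps_ref L N \<alpha> k"
proof -
  let ?P = "p L (pull B L N \<alpha> k)"
  have "p N k - 1 \<le> N" using p_le[OF k(1)] by auto
  then obtain i where i: "i \<le> L" "\<alpha> i = p N k - 1" using s by (metis (no_types) atMost_iff imageE subsetD)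
  then have iP: "i < ?P" using p_pull[OF k(1) a i(1)] k by auto
  have PL: "?P - 1 \<le> L" using p_le[OF sset_pull_in[OF B a k(1)]] by auto
  then have "\<alpha> (?P - 1) < p N k" using p_pull[OF k(1) a PL] iP by auto
  moreover have "\<alpha> i \<le> \<alpha> (?P - 1)" using Delta_mono[OF a, of i "?P - 1"] iP PL by auto
  ultimately show ?thesis using a iP i unfolding keeps_ref_def by auto
qed

lemma keeps_ref_face:
  assumes k: "k \<in> simps B (Suc n)" "0 < p (Suc n) k" and l: "p (Suc n) k \<le> l" and pn: "p (Suc n) k \<le> Suc n"
  shows "keeps_ref n (Suc n) (face n l) k" "p n (pull B n (Suc n) (face n l) k) = p (Suc n) k"
proof -
  let ?P = "p n (pull B n (Suc n) (face n l) k)" and ?p = "p (Suc n) k"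
  have in': "pull B n (Suc n) (face n l) k \<in> simps B n" by (rule sset_pull_in[OF B face_in k(1)])
  have iff: "j < ?P \<longleftrightarrow> j < ?p" if "j \<le> n" for j
    using p_pull[OF k(1) face_in that, of l] that l by (auto simp: face_def split: if_splits)
  show "?P = ?p"
    using iff[of ?P] iff[of ?p] pn p_le[OF in'] by (metis le_antisym less_Suc_eq_le not_less order_less_irrefl leI)
  then show "keeps_ref n (Suc n) (face n l) k"
    using k l pn by (auto simp: keeps_ref_def face_in face_apply)
qed

lemma fixed_pull_iff:
  assumes k: "k \<in> simps B N" and kr: "keeps_ref L N \<kappa> k" and t: "t = 1 \<or> t = 2"
    and c: "\<And>j. j \<le> L \<Longrightarrow> \<kappa> j < c \<longleftrightarrow> j < c'"
  shows "fixed t c' L (pull B L N \<kappa> k) \<longleftrightarrow>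
    pull B L N \<kappa> (Op N k N (Delta_id N) (cut t c)) = pull B L N \<kappa> k"
proof -
  have ka: "\<kappa> \<in> Delta L N" using kr by (simp add: keeps_ref_def)
  have "Op L (pull B L N \<kappa> k) L (Delta_id L) (cut t c') = Op N k L \<kappa> (cut t c')"
    using Op_pull[OF k ka _ _ Delta_id_in t] kr Delta_ext[OF ka]
    by (simp add: keeps_ref_def compose_Delta_id_right)
  also have "\<dots> = Op N k L \<kappa> (\<lambda>j. cut t c (\<kappa> j))"
    by (rule Op_cong) (use c in \<open>auto simp: cut_def\<close>)
  also have "\<dots> = pull B L N \<kappa> (Op N k N (Delta_id N) (cut t c))"
    using pull_Op[OF k p_pull_eq[OF k kr] Delta_id_in t ka] compose_Delta_id_left[OF ka] by simp
  finally show ?thesis by (simp add: fixed_def)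
qed

lemma fixed_pullI:
  assumes "k \<in> simps B N" "keeps_ref L N \<kappa> k" "t = 1 \<or> t = 2"
    "\<And>j. j \<le> L \<Longrightarrow> \<kappa> j < c \<longleftrightarrow> j < c'" "fixed t c N k"
  shows "fixed t c' L (pull B L N \<kappa> k)"
  using fixed_pull_iff[OF assms(1-4)] assms(5) by (simp add: fixed_def)

text \<open>A surjective operator has a section; pulling the equation for the degenerate simplex
  back along the section gives the equation for \<open>k\<close>.\<close>

lemma fixed_pullD:
  assumes k: "k \<in> simps B N" "0 < p N k" and a: "\<alpha> \<in> Delta L N" and s: "{..N} \<subseteq> \<alpha> ` {..L}" and t: "t = 1 \<or> t = 2"
    and c: "\<And>j. j \<le> L \<Longrightarrow> \<alpha> j < c \<longleftrightarrow> j < c'" and f: "fixed t c' L (pull B L N \<alpha> k)"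
  shows "fixed t c N k"
proof -
  have im: "Delta_id N ` {..N} \<subseteq> \<alpha> ` {..L}" using s by (auto simp: Delta_id_def)
  then obtain i where i: "i \<le> L" "\<alpha> i = Delta_id N 0"
    by (metis (no_types) atMost_iff image_subset_iff imageE le0)
  have sm: "Delta_id N u < Delta_id N v" if "u < v" "v \<le> N" for u v
    using that by (simp add: Delta_id_def)
  obtain \<delta> where d: "\<delta> \<in> Delta N L" "compose {..N} \<alpha> \<delta> = Delta_id N"
    by (rule Delta_section[OF a Delta_id_in sm im i(1) le0 i(2)], assumption+)
  let ?o = "Op N k N (Delta_id N) (cut t c)"
  have "pull B L N \<alpha> ?o = pull B L N \<alpha> k"
    using fixed_pull_iff[OF k(1) keeps_ref_surj[OF k a s] t c] f by blast
  then have "pull B N L \<delta> (pull B L N \<alpha> ?o) = pull B N L \<delta> (pull B L N \<alpha> k)" by simp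
  then show ?thesis
    using sset_pull_comp[OF B d(1) a] sset_pull_id[OF B] d(2) k Op_in[OF k Delta_id_in t]
    by (simp add: fixed_def)
qed

text \<open>Naturality of insertion. The operator \<eta> is \<kappa> with its argument
  \<open>q'\<close> doubled, the two copies going to the two copies of \<open>q\<close>.\<close>

lemma Ins_pull:
  assumes k: "k \<in> simps B N" and kr: "keeps_ref L N \<kappa> k" and t: "t = 1 \<or> t = 2"
    and q: "q' \<le> L" "\<kappa> q' = q" and l: "\<eta> \<in> Delta (Suc L) (Suc N)"
    "\<And>j. j \<le> Suc L \<Longrightarrow> \<eta> j = (if j \<le> q' then \<kappa> j else Suc (\<kappa> (j - 1)))"
  shows "Ins t L (pull B L N \<kappa> k) q' = pull B (Suc L) (Suc N) \<eta> (Ins t N k q)"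
proof -
  have ka: "\<kappa> \<in> Delta L N" using kr by (simp add: keeps_ref_def)
  have qN: "q \<le> N" using Delta_le[OF ka q(1)] q(2) by simp
  have mono: "\<kappa> j \<le> q" if "j \<le> q'" for j using Delta_mono[OF ka that q(1)] q(2) by simp
  have mono': "q \<le> \<kappa> (j - 1)" if "\<not> j \<le> q'" "j \<le> Suc L" for j
    using Delta_mono[OF ka, of q' "j - 1"] that q by auto
  have "compose {..Suc L} \<kappa> (dgn L q') = compose {..Suc L} (dgn N q) \<eta>"
  proof (rule Delta_eqI[OF Delta_compose[OF dgn_in[OF q(1)] ka] Delta_compose[OF l(1) dgn_in[OF qN]]])
    fix j assume j: "j \<le> Suc L"
    have "\<eta> j \<le> Suc N" using Delta_le[OF l(1) j] .
    then show "compose {..Suc L} \<kappa> (dgn L q') j = compose {..Suc L} (dgn N q) \<eta> j"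
      using j l(2)[OF j] mono[of j] mono'[of j] by (auto simp: compose_def dgn_apply)
  qed
  moreover have "cut t (Suc q') j = cut t (Suc q) (\<eta> j)" if "j \<le> Suc L" for j
    using that l(2)[OF that] mono[of j] mono'[of j] by (auto simp: cut_def)
  ultimately show ?thesis
    unfolding Ins_def
    using Op_pull[OF k ka _ _ dgn_in[OF q(1)] t, of "Suc q'"] kr
      pull_Op[OF k p_pull_eq[OF k kr] dgn_in[OF qN] t l(1), of "Suc q"]
      Op_cong[of "Suc L" "cut t (Suc q')" "\<lambda>j. cut t (Suc q) (\<eta> j)" N k]
    by (simp add: keeps_ref_def)
qed

section \<open>Faces of insertions and closure under the pairing\<close>

lemma Ins_in: "insertable t N k q \<Longrightarrow> Ins t N k q \<in> simps B (Suc N)"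
  unfolding insertable_def Ins_def by (intro Op_in dgn_in) auto

text \<open>The bounds on \<open>q\<close> in \<open>insertable\<close> place the new vertex behind
  all vertices in \<C>, and the new vertex is a chain.\<close>

lemma p_Ins:
  assumes "insertable t N k q"
  shows "p (Suc N) (Ins t N k q) = p N k"
proof -
  let ?P = "p (Suc N) (Ins t N k q)"
  have k: "k \<in> simps B N" "0 < p N k" "q \<le> N" "t = 1 \<or> t = 2" "p N k \<le> Suc q" "t = 1 \<Longrightarrow> p N k \<le> q"
    using assms by (auto simp: insertable_def)
  have "j < ?P \<longleftrightarrow> j < p N k" if "j \<le> Suc N" for j
    unfolding Ins_def using p_Op[OF k(1,2) dgn_in[OF k(3)] k(4) that, of "Suc q"] k(5,6) that k(4)
    by (auto simp: dgn_apply split: if_splits)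
  from this[of ?P] this[of "p N k"] show ?thesis
    using p_le[OF Ins_in[OF assms]] p_le[OF k(1)]
    by (metis le_SucI le_antisym less_Suc_eq_le nat_less_le not_less_iff_gr_or_eq)
qed


text \<open>A face that keeps both copies of \<open>q\<close> and all vertices in \<C> is an
  insertion into a face of \<open>k\<close>. That face has smaller dimension, so a minimality
  argument and closure under \<open>R\<close> will cover it.\<close>

lemma Ins_face:
  assumes i: "insertable t N k q" and l: "p N k \<le> l" "l \<le> Suc N" "l < q \<or> Suc q < l"
  obtains N' q' k' where "N = Suc N'" "k' \<in> simps B N'" "p N' k' = p N k" "insertable t N' k' q'"
    "pull B N (Suc N) (face N l) (Ins t N k q) = Ins t N' k' q'"
proof -
  have k: "k \<in> simps B N" "0 < p N k" "q \<le> N" and t: "t = 1 \<or> t = 2"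
    and f: "fixed t (if t = 1 then q else Suc q) N k" and pq: "p N k \<le> (if t = 1 then q else Suc q)"
    using i by (auto simp: insertable_def)
  obtain N' where N: "N = Suc N'" using l k by (cases N) auto
  \<comment> \<open>\<open>m\<close> is the vertex of \<open>k\<close> that the face at
    \<open>l\<close> omits, and \<open>q'\<close> is the position of \<open>q\<close> once
    \<open>m\<close> is gone.\<close>
  define m where "m = (if l < q then l else l - 1)"
  define q' where "q' = (if l < q then q - 1 else q)"
  have m: "p N k \<le> m" "p N k \<le> Suc N'" "m \<le> N" using l pq k N by (auto simp: m_def split: if_splits)
  have q': "q' \<le> N'" "face N' m q' = q" using l k N by (auto simp: q'_def m_def face_def)
  let ?k = "pull B N' N (face N' m) k"
  have kr: "keeps_ref N' N (face N' m) k" and pk: "p N' ?k = p N k"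
    using keeps_ref_face[of k N' m] k m N by auto
  have k': "?k \<in> simps B N'" using sset_pull_in[OF B face_in] k N by blast
  have lift: "face N l j = (if j \<le> q' then face N' m j else Suc (face N' m (j - 1)))" if "j \<le> Suc N'" for j
    using that l k N by (auto simp: face_def m_def q'_def)
  have "Ins t N' ?k q' = pull B (Suc N') (Suc N) (face N l) (Ins t N k q)"
    by (rule Ins_pull[OF k(1) kr t q' _ lift]) (use face_in N in auto)
  moreover have "fixed t (if t = 1 then q' else Suc q') N' ?k"
    by (rule fixed_pullI[OF k(1) kr t _ f]) (use l k N in \<open>auto simp: face_def m_def q'_def\<close>)
  then have "insertable t N' ?k q'"
    using k' pk k(2) q'(1) t pq l N by (auto simp: insertable_def q'_def split: if_splits)
  ultimately show thesis using that[of N' ?k q'] N k' pk by auto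
qed

text \<open>Up to degeneracy, attaching \<open>b\<close> adds only \<open>b\<close> and its missing
  face. By \<open>Ins_pull\<close>, an insertion into a degenerate simplex comes from an insertion
  into the simplex below it, so closure under \<open>R\<close> has to be checked on these two
  alone.\<close>

lemma R_generated:
  assumes S: "closed_under B R S" and b: "b \<in> simps B (Suc n)" and i: "0 < i" "i \<le> Suc n"
    and miss: "(n, pull B n (Suc n) (face n i) b) \<notin> S"
    and faces: "\<And>j. j \<le> Suc n \<Longrightarrow> j \<noteq> i \<Longrightarrow> (n, pull B n (Suc n) (face n j) b) \<in> S"
    and Ins: "\<And>t W w q. (W, w) = (Suc n, b) \<or> (W, w) = (n, pull B n (Suc n) (face n i) b) \<Longrightarrow>
      insertable t W w q \<Longrightarrow> (Suc W, Ins t W w q) \<in> generated B (Suc n) b"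
  shows "closed_under B R (S \<union> generated B (Suc n) b)"
proof -
  let ?G = "generated B (Suc n) b"
  have Gpull: "(l, pull B l m \<alpha> x) \<in> ?G" if "(m, x) \<in> ?G" "\<alpha> \<in> Delta l m" for l m x \<alpha>
    using that sset_pull_comp[OF B _ _ b] Delta_compose unfolding generated_def by fastforce
  have R: "z' \<in> S \<union> ?G" if zR: "(z, z') \<in> R" and zS: "z \<in> S \<union> ?G" for z z'
  proof (cases "z \<in> S")
    case True then show ?thesis using S zR unfolding closed_under_def by blast
  next
    case False
    then obtain m \<beta> where be: "\<beta> \<in> Delta m (Suc n)" and z: "z = (m, pull B m (Suc n) \<beta> b)"
      using zS by (auto simp: generated_def)
    have cov: "{..Suc n} - {i} \<subseteq> \<beta> ` {..m}"
      using horn_attach(1)[OF B _ b i(2) faces miss be] False z S unfolding closed_under_def by blast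
    \<comment> \<open>A new simplex is given by an operator hitting every vertex except possibly
      \<open>i\<close>. It is surjective onto \<open>b\<close> if \<open>i\<close> is hit, and onto
      the missing face otherwise.\<close>
    obtain W w \<alpha> where w: "(W, w) = (Suc n, b) \<or> (W, w) = (n, pull B n (Suc n) (face n i) b)"
      and a: "\<alpha> \<in> Delta m W" "{..W} \<subseteq> \<alpha> ` {..m}" and zw: "z = (m, pull B m W \<alpha> w)"
    proof (cases "i \<in> \<beta> ` {..m}")
      case True
      then have "{..Suc n} \<subseteq> \<beta> ` {..m}" using cov by blast
      then show ?thesis using that[of "Suc n" b \<beta>] be z by simp
    next
      case False
      obtain \<gamma> where g: "\<gamma> \<in> Delta m n" "\<beta> = compose {..m} (face n i) \<gamma>"
        using Delta_factor_face[OF be i(2) False] .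
      have "j \<in> \<gamma> ` {..m}" if "j \<le> n" for j
      proof -
        have "face n i j \<in> \<beta> ` {..m}" using cov that by (auto simp: face_def split: if_splits)
        then obtain s where s: "s \<le> m" "face n i (\<gamma> s) = face n i j" using g by (auto simp: compose_def)
        then have "\<gamma> s = j" using Delta_le[OF g(1) s(1)] that by (auto simp: face_def split: if_splits)
        then show ?thesis using s by auto
      qed
      then have "{..n} \<subseteq> \<gamma> ` {..m}" by blast
      then show ?thesis
        using that[of n "pull B n (Suc n) (face n i) b" \<gamma>] g z sset_pull_comp[OF B g(1) face_in b] by simp
    qed
    have wB: "w \<in> simps B W" using w b sset_pull_in[OF B face_in b] by auto
    obtain t q where q: "insertable t m (pull B m W \<alpha> w) q" and z': "z' = (Suc m, Ins t m (pull B m W \<alpha> w) q)"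
      using zR zw unfolding R_def by auto
    let ?x = "pull B m W \<alpha> w"
    have x: "?x \<in> simps B m" "0 < p m ?x" "q \<le> m" and t: "t = 1 \<or> t = 2"
      using q by (auto simp: insertable_def)
    have "p m ?x - 1 \<le> m" using p_le[OF x(1)] by auto
    then have pw: "0 < p W w" using p_pull[OF wB a(1), of "p m ?x - 1"] x(2) by auto
    have kr: "keeps_ref m W \<alpha> w" by (rule keeps_ref_surj[OF wB pw a])
    let ?u = "\<alpha> q"
    have u: "?u \<le> W" using Delta_le[OF a(1) x(3)] .
    \<comment> \<open>The preimage of an initial segment under a monotone map is an initial segment;
      this transports the threshold in \<open>fixed\<close>.\<close>
    have cutp: "\<exists>c'. \<forall>j\<le>m. \<alpha> j < c \<longleftrightarrow> j < c'" for c
    proof (cases "\<exists>j\<le>m. c \<le> \<alpha> j")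
      case True
      define c' where "c' = (LEAST j. j \<le> m \<and> c \<le> \<alpha> j)"
      have c': "c' \<le> m" "c \<le> \<alpha> c'" using LeastI_ex[OF True] by (auto simp: c'_def)
      have "\<alpha> j < c \<longleftrightarrow> j < c'" if "j \<le> m" for j
        using Delta_mono[OF a(1), of c' j] not_less_Least[of j "\<lambda>j. j \<le> m \<and> c \<le> \<alpha> j"] c' that
        unfolding c'_def[symmetric] by (metis le_trans not_less)
      then show ?thesis by blast
    qed (auto intro!: exI[of _ "Suc m"])
    have "insertable t W w ?u"
    proof (cases "t = 1")
      case True
      then have f: "fixed 1 q m ?x" "p m ?x \<le> q" using q by (auto simp: insertable_def)
      obtain c' where c': "\<And>j. j \<le> m \<Longrightarrow> \<alpha> j < ?u \<longleftrightarrow> j < c'" using cutp by blast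
      have "c' \<le> q" using c'[OF x(3)] by simp
      then have "fixed 1 c' m ?x" using fixed_mono(1)[OF x(1,2) f(1)] by simp
      then have "fixed 1 ?u W w" using fixed_pullD[OF wB pw a _ c'] by blast
      moreover have "p W w \<le> ?u" using p_pull[OF wB a(1) x(3)] f(2) by auto
      ultimately show ?thesis using wB pw u True by (simp add: insertable_def)
    next
      case False
      then have f: "t = 2" "fixed 2 (Suc q) m ?x" "p m ?x \<le> Suc q" using q by (auto simp: insertable_def)
      obtain c' where c': "\<And>j. j \<le> m \<Longrightarrow> \<alpha> j < Suc ?u \<longleftrightarrow> j < c'" using cutp by blast
      have "Suc q \<le> c'" using c'[OF x(3)] by simp
      then have "fixed 2 c' m ?x" using fixed_mono(2)[OF x(1,2) f(2)] by simp
      then have "fixed 2 (Suc ?u) W w" using fixed_pullD[OF wB pw a _ c'] by blast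
      moreover have "\<alpha> (p m ?x - 1) \<le> ?u" by (rule Delta_mono[OF a(1)]) (use f(3) x(3) in auto)
      then have "p W w \<le> Suc ?u" using kr unfolding keeps_ref_def by auto
      ultimately show ?thesis using wB pw u f(1) by (simp add: insertable_def)
    qed
    then have 1: "(Suc W, Ins t W w ?u) \<in> ?G" by (rule Ins[OF w])
    \<comment> \<open>The lift of \<alpha> that doubles the argument \<open>q\<close>, in the form
      required by \<open>Ins_pull\<close>.\<close>
    let ?l = "\<lambda>j\<in>{..Suc m}. if j \<le> q then \<alpha> j else Suc (\<alpha> (j - 1))"
    have l: "?l \<in> Delta (Suc m) (Suc W)"
    proof (rule DeltaI)
      fix s assume "s \<le> Suc m"
      then show "?l s \<le> Suc W"
        using Delta_le[OF a(1), of s] Delta_le[OF a(1), of "s - 1"] x(3) by auto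
    next
      fix s r assume "s \<le> r" "r \<le> Suc m"
      then show "?l s \<le> ?l r"
        using Delta_mono[OF a(1), of s r] le_SucI[OF Delta_mono[OF a(1), of s "r - 1"]]
          Delta_mono[OF a(1), of "s - 1" "r - 1"] x(3) by auto
    qed simp
    have "Ins t m ?x q = pull B (Suc m) (Suc W) ?l (Ins t W w ?u)"
      by (rule Ins_pull[OF wB kr t x(3) refl l]) simp
    then show ?thesis using Gpull[OF 1 l] z' by simp
  qed
  show ?thesis
    unfolding closed_under_def
  proof (intro conjI)
    show "\<forall>(n', x)\<in>S \<union> ?G. x \<in> simps B n'"
      using S sset_pull_in[OF B _ b] unfolding closed_under_def generated_def by auto
    show "\<forall>m n' x. \<forall>\<alpha>\<in>Delta m n'. (n', x) \<in> S \<union> ?G \<longrightarrow> (m, pull B m n' \<alpha> x) \<in> S \<union> ?G"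
      using S Gpull unfolding closed_under_def by blast
    show "\<forall>z z'. (z, z') \<in> R \<longrightarrow> z \<in> S \<union> ?G \<longrightarrow> z' \<in> S \<union> ?G" using R by blast
  qed
qed


lemma generated_self: "b \<in> simps B n \<Longrightarrow> (n, b) \<in> generated B n b"
  unfolding generated_def
  by (rule CollectI, rule exI[of _ n], rule exI[of _ "Delta_id n"]) (simp add: sset_pull_id[OF B] Delta_id_in)

text \<open>An insertion has the reference vertex of \<open>k\<close>, so by \<open>Op_Op\<close>
  every operator on it can be computed on \<open>k\<close>. The face in the last claim removes the
  inserted vertex, and \<open>k\<close> comes back because it is fixed.\<close>

lemma fixed_Ins_iff:
  assumes i: "insertable t N k q"
  shows "fixed t (Suc q) (Suc N) (Ins t N k q)"
    and "\<beta> \<in> Delta L (Suc N) \<Longrightarrow> Op (Suc N) (Ins t N k q) L \<beta> (cut t c) =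
      Op N k L (compose {..L} (dgn N q) \<beta>) (\<lambda>j. mode_comp (cut t c j) (cut t (Suc q) (\<beta> j)))"
    and "pull B N (Suc N) (face N (if t = 1 then q else Suc q)) (Ins t N k q) = k"
proof -
  have k: "k \<in> simps B N" "0 < p N k" and q: "q \<le> N" and t: "t = 1 \<or> t = 2" "p N k \<le> Suc q"
    and f: "fixed t (if t = 1 then q else Suc q) N k"
    using i by (auto simp: insertable_def)
  have P: "p (Suc N) (Ins t N k q) = p N k" by (rule p_Ins[OF i])
  have r: "dgn N q (p N k - 1) = p N k - 1" using t(2) q p_le[OF k(1)] by (auto simp: dgn_apply)
  show *: "Op (Suc N) (Ins t N k q) L \<beta> (cut t c) =
      Op N k L (compose {..L} (dgn N q) \<beta>) (\<lambda>j. mode_comp (cut t c j) (cut t (Suc q) (\<beta> j)))"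
    if "\<beta> \<in> Delta L (Suc N)" for L \<beta> c
    unfolding Ins_def using Op_Op[OF k dgn_in[OF q] t(1) _ _ that t(1), of "Suc q" c] P r k(2)
    by (simp add: Ins_def)
  show "fixed t (Suc q) (Suc N) (Ins t N k q)"
    unfolding fixed_def *[OF Delta_id_in] compose_Delta_id_right[OF Delta_ext[OF dgn_in[OF q]]]
    unfolding Ins_def by (rule Op_cong) (auto simp: mode_comp_def cut_def Delta_id_def)
  have "(if t = 1 then q else Suc q) = q \<or> (if t = 1 then q else Suc q) = Suc q" by simp
  then have "compose {..N} (dgn N q) (face N (if t = 1 then q else Suc q)) = Delta_id N"
    using Delta_dgn_face[OF q] by metis
  then have "pull B N (Suc N) (face N (if t = 1 then q else Suc q)) (Ins t N k q) =
      Op N k N (Delta_id N) (\<lambda>j. cut t (Suc q) (face N (if t = 1 then q else Suc q) j))"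
    using pull_Op[OF k dgn_in[OF q] t(1) face_in[of N "if t = 1 then q else Suc q"], of "Suc q"]
    unfolding Ins_def by (simp only:)
  also have "\<dots> = Op N k N (Delta_id N) (cut t (if t = 1 then q else Suc q))"
    by (rule Op_cong) (auto simp: cut_def face_apply)
  finally show "pull B N (Suc N) (face N (if t = 1 then q else Suc q)) (Ins t N k q) = k"
    using f by (simp add: fixed_def)
qed

text \<open>The second insertion adds the vertex that the first one has added, next to it.\<close>

lemma Ins_Ins:
  assumes i: "insertable t N k q"
  shows "Ins t (Suc N) (Ins t N k q) (if t = 1 then Suc q else q) =
    pull B (Suc (Suc N)) (Suc N) (dgn (Suc N) (if t = 1 then q else Suc q)) (Ins t N k q)"
proof -
  let ?a = "if t = 1 then Suc q else q" and ?c = "if t = 1 then q else Suc q"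
  have k: "k \<in> simps B N" "0 < p N k" and q: "q \<le> N" and t: "t = 1 \<or> t = 2"
    using i by (auto simp: insertable_def)
  have d: "dgn (Suc N) ?a \<in> Delta (Suc (Suc N)) (Suc N)" "dgn (Suc N) ?c \<in> Delta (Suc (Suc N)) (Suc N)"
    using q by (auto intro!: dgn_in)
  have e: "compose {..Suc (Suc N)} (dgn N q) (dgn (Suc N) ?a) = compose {..Suc (Suc N)} (dgn N q) (dgn (Suc N) ?c)"
    by (rule Delta_eqI[OF Delta_compose[OF d(1) dgn_in[OF q]] Delta_compose[OF d(2) dgn_in[OF q]]])
      (use q in \<open>auto simp: compose_def dgn_def\<close>)
  have "Ins t (Suc N) (Ins t N k q) ?a = Op N k (Suc (Suc N)) (compose {..Suc (Suc N)} (dgn N q) (dgn (Suc N) ?a))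
      (\<lambda>j. mode_comp (cut t (Suc ?a) j) (cut t (Suc q) (dgn (Suc N) ?a j)))"
    unfolding Ins_def[of t "Suc N"] by (rule fixed_Ins_iff(2)[OF i d(1)])
  also have "\<dots> = Op N k (Suc (Suc N)) (compose {..Suc (Suc N)} (dgn N q) (dgn (Suc N) ?c))
      (\<lambda>j. cut t (Suc q) (dgn (Suc N) ?c j))"
    unfolding e by (rule Op_cong) (use t q in \<open>auto simp: mode_comp_def cut_def dgn_def\<close>)
  also have "\<dots> = pull B (Suc (Suc N)) (Suc N) (dgn (Suc N) ?c) (Ins t N k q)"
    unfolding Ins_def by (rule pull_Op[OF k dgn_in[OF q] t d(2), symmetric])
  finally show ?thesis .
qed

text \<open>The simplex \<open>b\<close> is the partner of \<open>k\<close>, and \<open>k\<close> is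
  its missing face. Of the two faces next to the insertion, \<open>other\<close> provides the one
  different from \<open>k\<close>; \<open>closure\<close> says that \<open>q\<close> is the extreme
  admissible position, so that all insertions into \<open>k\<close> and \<open>b\<close> other than
  \<open>b\<close> itself are degenerate.\<close>

lemma pairing_step:
  assumes S: "closed_under B R S" and i: "insertable t N k q"
    and kS: "(N, k) \<notin> S"
    and min: "\<And>N' k'. k' \<in> simps B N' \<Longrightarrow> p N' k' < p N k \<or> p N' k' = p N k \<and> N' < N \<Longrightarrow> (N', k') \<in> S"
    and other: "p N k \<le> (if t = 1 then Suc q else q) \<Longrightarrow>
      (N, pull B N (Suc N) (face N (if t = 1 then Suc q else q)) (Ins t N k q)) \<in> S"
    and closure: "\<And>u. t = 1 \<Longrightarrow> fixed 1 u N k \<Longrightarrow> u \<le> q" "\<And>u. t = 2 \<Longrightarrow> fixed 2 u N k \<Longrightarrow> q < u"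
  shows "\<exists>n i b. b \<in> simps B (Suc n) \<and> 0 < i \<and> i \<le> Suc n \<and> (n, pull B n (Suc n) (face n i) b) \<notin> S \<and>
        (\<forall>j\<le>Suc n. j \<noteq> i \<longrightarrow> (n, pull B n (Suc n) (face n j) b) \<in> S) \<and>
        closed_under B R (S \<union> generated B (Suc n) b)"
proof -
  let ?b = "Ins t N k q" and ?i = "if t = 1 then q else Suc q"
  have k: "k \<in> simps B N" "0 < p N k" and q: "q \<le> N" and t: "t = 1 \<or> t = 2" "p N k \<le> Suc q"
    and f: "fixed t ?i N k" and pi: "p N k \<le> ?i"
    using i by (auto simp: insertable_def)
  have b: "?b \<in> simps B (Suc N)" by (rule Ins_in[OF i])
  have pb: "p (Suc N) ?b = p N k" by (rule p_Ins[OF i])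
  have miss: "pull B N (Suc N) (face N ?i) ?b = k" by (rule fixed_Ins_iff(3)[OF i])
  have faces: "(N, pull B N (Suc N) (face N l) ?b) \<in> S" if l: "l \<le> Suc N" "l \<noteq> ?i" for l
  proof -
    have fB: "pull B N (Suc N) (face N l) ?b \<in> simps B N" by (rule sset_pull_in[OF B face_in b])
    \<comment> \<open>Three kinds of faces: a vertex in \<C> is lost and \<open>p\<close> drops; the
      face is an insertion into a smaller simplex; or it is the second face beside the
      insertion.\<close>
    consider "l < p N k" | "p N k \<le> l" "l < q \<or> Suc q < l" | "p N k \<le> l" "l = (if t = 1 then Suc q else q)"
      using l(2) by (cases "t = 1") (auto, linarith+)
    then show ?thesis
    proof cases
      case 1
      have "\<not> p N k - 1 < p N (pull B N (Suc N) (face N l) ?b)"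
        using p_pull[OF b face_in[of N l], of "p N k - 1"] pb 1 p_le[OF k(1)] by (auto simp: face_apply)
      then show ?thesis using min[OF fB] k(2) by auto
    next
      case 2
      then obtain N' q' k' where *: "N = Suc N'" "k' \<in> simps B N'" "p N' k' = p N k" "insertable t N' k' q'"
        "pull B N (Suc N) (face N l) ?b = Ins t N' k' q'"
        using Ins_face[OF i 2(1) l(1) 2(2)] by blast
      have "(N', k') \<in> S" using min[OF *(2)] *(1,3) by simp
      moreover have "((N', k'), (N, Ins t N' k' q')) \<in> R" using *(1,4) unfolding R_def by blast
      ultimately show ?thesis using S *(5) unfolding closed_under_def by auto
    next
      case 3 then show ?thesis using other by simp
    qed
  qed
  have gb: "(Suc N, ?b) \<in> generated B (Suc N) ?b" by (rule generated_self[OF b])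
  have gd: "(Suc W, pull B (Suc W) W (dgn W u) w) \<in> generated B (Suc N) ?b"
    if w: "(W, w) \<in> generated B (Suc N) ?b" "u \<le> W" for W w u
  proof -
    obtain \<beta> where be: "\<beta> \<in> Delta W (Suc N)" "w = pull B W (Suc N) \<beta> ?b"
      using w(1) unfolding generated_def by blast
    then show ?thesis
      using sset_pull_comp[OF B dgn_in[OF w(2)] be(1) b] Delta_compose[OF dgn_in[OF w(2)] be(1)]
      unfolding generated_def by auto
  qed
  have gk: "(N, k) \<in> generated B (Suc N) ?b"
    unfolding generated_def using miss face_in by (auto intro!: exI[of _ "face N ?i"])
  have kf: "keeps_ref N (Suc N) (face N ?i) ?b"
  proof (rule keeps_ref_face(1)[OF b])
    show "0 < p (Suc N) ?b" "p (Suc N) ?b \<le> ?i" using pb pi k(2) by auto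
    show "p (Suc N) ?b \<le> Suc N" using pb t(2) q by simp
  qed
  \<comment> \<open>Since \<open>k\<close> is a face of \<open>b\<close> with the same reference
    vertex, whatever fixes \<open>b\<close> fixes \<open>k\<close> after adjusting the threshold.
    Too large a fixed part of \<open>b\<close> thus contradicts the choice of
    \<open>q\<close>.\<close>
  have fk: "fixed t' c' N k" if "fixed t' c (Suc N) ?b" "t' = 1 \<or> t' = 2"
    "\<And>j. j \<le> N \<Longrightarrow> face N ?i j < c \<longleftrightarrow> j < c'" for t' c c'
    using fixed_pullI[OF b kf that(2,3,1)] miss by simp
  have pos: "0 < p (Suc N) ?b" using pb k(2) by simp
  have Ins: "(Suc W, Ins t' W w u) \<in> generated B (Suc N) ?b"
    if W: "(W, w) = (Suc N, ?b) \<or> (W, w) = (N, pull B N (Suc N) (face N ?i) ?b)" and u: "insertable t' W w u"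
    for t' W w u
  proof -
    have w: "w \<in> simps B W" "0 < p W w" "u \<le> W" and t': "t' = 1 \<or> t' = 2" using u by (auto simp: insertable_def)
    have gw: "(W, w) \<in> generated B (Suc N) ?b" using W gb gk miss by auto
    have deg: "?thesis" if "Ins t' W w u = pull B (Suc W) W (dgn W u) w" using gd[OF gw w(3)] that by simp
    show ?thesis
    proof (cases "t = 1")
      case t1: True
      \<comment> \<open>Being fixed in mode 2 would make every vertex of the form \<open>T\<close>,
        beyond the maximal \<open>q\<close>.\<close>
      have no2: "\<not> fixed 2 c W w" for c
      proof
        assume "fixed 2 c W w"
        then have *: "fixed 1 (Suc (Suc q)) W w" by (rule fixed_mono(3)[OF w(1,2)])
        have "fixed 1 (Suc q) N k"
          using W
        proof
          assume W: "(W, w) = (Suc N, ?b)"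
          show ?thesis by (rule fk[of 1 "Suc (Suc q)"]) (use * W t1 in \<open>auto simp: face_apply\<close>)
        next
          assume "(W, w) = (N, pull B N (Suc N) (face N ?i) ?b)"
          then show ?thesis using fixed_mono(1)[OF k, of "Suc (Suc q)" "Suc q"] * miss by auto
        qed
        then show False using closure(1)[OF t1, of "Suc q"] by simp
      qed
      then have u1: "t' = 1" "fixed 1 u W w" using u t' by (auto simp: insertable_def)
      show ?thesis
        using W
      proof
        assume W: "(W, w) = (N, pull B N (Suc N) (face N ?i) ?b)"
        then have wk: "W = N" "w = k" using miss by auto
        then have "u \<le> q" using closure(1)[OF t1] u1 by simp
        show ?thesis
        proof (cases "u = q")
          case True then show ?thesis using gb wk u1 t1 by simp
        next
          case False
          then have "fixed 1 (Suc u) N k" using fixed_mono(1)[OF k, of q "Suc u"] f t1 \<open>u \<le> q\<close> by simp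
          then show ?thesis using deg Ins_degenerate(1)[OF k] wk u1 w(3) by simp
        qed
      next
        assume W: "(W, w) = (Suc N, ?b)"
        have fb: "fixed 1 (Suc q) (Suc N) ?b" using fixed_Ins_iff(1)[OF i] t1 by simp
        have "\<not> Suc (Suc q) \<le> u"
        proof
          assume "Suc (Suc q) \<le> u"
          then have *: "fixed 1 (Suc (Suc q)) (Suc N) ?b" using fixed_mono(1)[OF b pos] u1 W by simp
          have "fixed 1 (Suc q) N k" by (rule fk[OF *]) (use t1 in \<open>auto simp: face_apply\<close>)
          then show False using closure(1)[OF t1, of "Suc q"] by simp
        qed
        then consider "u \<le> q" | "u = Suc q" by linarith
        then show ?thesis
        proof cases
          case 1
          then have "fixed 1 (Suc u) (Suc N) ?b" using fixed_mono(1)[OF b pos fb] by simp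
          then show ?thesis using deg Ins_degenerate(1)[OF b pos] W u1 w(3) by simp
        next
          case 2
          have "Ins 1 (Suc N) ?b (Suc q) = pull B (Suc (Suc N)) (Suc N) (dgn (Suc N) q) ?b"
            using Ins_Ins[OF i] t1 by simp
          then show ?thesis using gd[OF gb, of q] q 2 u1 W by simp
        qed
      qed
    next
      case False
      then have t2: "t = 2" using t by simp
      have fb: "fixed 2 (Suc q) (Suc N) ?b" using fixed_Ins_iff(1)[OF i] t2 by simp
      have fw: "fixed 2 (Suc q) W w" using W fb f miss t2 by auto
      show ?thesis
      proof (cases "t' = 1")
        case True
        then show ?thesis using deg Ins_degenerate(1)[OF w] fixed_mono(3)[OF w(1,2) fw] by simp
      next
        case False
        then have u2: "t' = 2" "fixed 2 (Suc u) W w" using u by (auto simp: insertable_def)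
        \<comment> \<open>An earlier insertion would require \<open>({x}, c)\<close> already from
          position \<open>q\<close> on, against the minimality of the threshold for
          \<open>k\<close>.\<close>
        have "q \<le> u"
        proof (rule ccontr)
          assume "\<not> q \<le> u"
          then have *: "fixed 2 q W w" using fixed_mono(2)[OF w(1,2) u2(2), of q] by simp
          have "fixed 2 q N k"
            using W
          proof
            assume W: "(W, w) = (Suc N, ?b)"
            show ?thesis by (rule fk[of 2 q]) (use * W t2 in \<open>auto simp: face_apply\<close>)
          qed (use * miss in auto)
          then show False using closure(2)[OF t2, of q] by simp
        qed
        show ?thesis
        proof (cases "u = q")
          case True
          have "Ins 2 (Suc N) ?b q = pull B (Suc (Suc N)) (Suc N) (dgn (Suc N) (Suc q)) ?b"
            using Ins_Ins[OF i] t2 by simp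
          then show ?thesis using W gd[OF gb, of "Suc q"] gb q u2 t2 True miss by auto
        next
          case False
          then have "fixed 2 u W w" using fixed_mono(2)[OF w(1,2) fw, of u] \<open>q \<le> u\<close> by simp
          then show ?thesis using deg Ins_degenerate(2)[OF w] u2 by simp
        qed
      qed
    qed
  qed
  have i0: "0 < ?i" "?i \<le> Suc N" using pi k(2) q by auto
  have kS': "(N, pull B N (Suc N) (face N ?i) ?b) \<notin> S" using kS miss by simp
  show ?thesis
    using R_generated[OF S b i0 kS' faces Ins] b i0 kS' faces by blast
qed

text \<open>Among the missing simplices of least \<open>p\<close> and then least dimension, take one
  with an extreme threshold: the least one for mode 2 if all vertices of some such simplex have the
  form \<open>T\<close>, otherwise the greatest one for mode 1. The second face beside the insertion
  has the same size and a more extreme threshold, hence it cannot be missing.\<close>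

lemma exists_pairing_step:
  assumes S: "closed_under B R S" and A: "A0 \<subseteq> S" and x: "x \<in> simps B n" "(n, x) \<notin> S"
  shows "\<exists>n i b. b \<in> simps B (Suc n) \<and> 0 < i \<and> i \<le> Suc n \<and> (n, pull B n (Suc n) (face n i) b) \<notin> S \<and>
        (\<forall>j\<le>Suc n. j \<noteq> i \<longrightarrow> (n, pull B n (Suc n) (face n j) b) \<in> S) \<and>
        closed_under B R (S \<union> generated B (Suc n) b)"
proof -
  define bad where "bad P N k \<longleftrightarrow> k \<in> simps B N \<and> (N, k) \<notin> S \<and> p N k = P" for P N k
  define P where "P = (LEAST P. \<exists>N k. bad P N k)"
  have "\<exists>P N k. bad P N k" using x by (auto simp: bad_def)
  then have P: "\<exists>N k. bad P N k" unfolding P_def by (rule LeastI_ex)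
  define N where "N = (LEAST N. \<exists>k. bad P N k)"
  have N: "\<exists>k. bad P N k" using LeastI_ex[OF P] unfolding N_def .
  have minP: "P \<le> p N' k'" if "k' \<in> simps B N'" "(N', k') \<notin> S" for N' k'
  proof -
    have "bad (p N' k') N' k'" using that by (simp add: bad_def)
    then show ?thesis unfolding P_def by (intro Least_le) blast
  qed
  have minN: "N \<le> N'" if "bad P N' k'" for N' k'
    unfolding N_def by (rule Least_le) (use that in auto)
  have min: "(N', k') \<in> S" if "k' \<in> simps B N'" "p N' k' < P \<or> p N' k' = P \<and> N' < N" for N' k'
    by (rule ccontr) (use minP[OF that(1)] minN[of N' k'] that in \<open>auto simp: bad_def\<close>)
  have badD: "k \<in> simps B N" "(N, k) \<notin> S" "p N k = P" "0 < p N k" if "bad P N k" for k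
    using that A by (auto simp: bad_def A0_def)
  show ?thesis
  proof (cases "\<exists>k. bad P N k \<and> fixed 1 (Suc N) N k")
    case True
    define e where "e = (LEAST e. \<exists>k. bad P N k \<and> fixed 2 e N k)"
    have "\<exists>e k. bad P N k \<and> fixed 2 e N k" using True fixed_all by blast
    then have "\<exists>k. bad P N k \<and> fixed 2 e N k" unfolding e_def by (rule LeastI_ex)
    then obtain k where k: "bad P N k" "fixed 2 e N k" by blast
    have mine: "e \<le> u" if "bad P N k" "fixed 2 u N k" for k u
      unfolding e_def by (rule Least_le) (use that in auto)
    have eN: "e \<le> Suc N" using True fixed_all mine by blast
    note kk = badD[OF k(1)]
    \<comment> \<open>From position \<open>e\<close> on the vertices equal \<open>({x}, c)\<close>,
      which is a chain and not a vertex in \<C>.\<close>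
    have pe: "p N k \<le> e"
    proof (rule ccontr)
      assume "\<not> p N k \<le> e"
      then show False
        using p_Op[OF kk(1,4) Delta_id_in, of 2 e e] k(2) p_le[OF kk(1)] by (auto simp: fixed_def)
    qed
    define q where "q = e - 1"
    have q: "e = Suc q" "q \<le> N" using pe kk(4) eN by (auto simp: q_def)
    have i: "insertable 2 N k q" using kk pe k(2) q by (simp add: insertable_def)
    show ?thesis
    proof (rule pairing_step[OF S i kk(2)])
      show "(N', k') \<in> S" if "k' \<in> simps B N'" "p N' k' < p N k \<or> p N' k' = p N k \<and> N' < N" for N' k'
        using min that kk(3) by simp
      show "(N, pull B N (Suc N) (face N (if 2 = (1::nat) then Suc q else q)) (Ins 2 N k q)) \<in> S"
        if pq: "p N k \<le> (if 2 = (1::nat) then Suc q else q)"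
      proof (rule ccontr)
        \<comment> \<open>The face at \<open>q\<close> of the insertion is \<open>k\<close> with its
          vertices from \<open>q\<close> on replaced by \<open>({x}, c)\<close>. Its threshold is at
          most \<open>q\<close>, one less than the minimal \<open>e\<close>.\<close>
        let ?k = "Op N k N (Delta_id N) (cut 2 q)"
        have e1: "pull B N (Suc N) (face N q) (Ins 2 N k q) = Op N k N (Delta_id N) (\<lambda>j. cut 2 (Suc q) (face N q j))"
          unfolding Ins_def using pull_Op[OF kk(1,4) dgn_in[OF q(2)] _ face_in, of 2 q "Suc q"] Delta_dgn_face[OF q(2)] by simp
        have e2: "Op N k N (Delta_id N) (\<lambda>j. cut 2 (Suc q) (face N q j)) = ?k"
          by (rule Op_cong) (auto simp: cut_def face_apply)
        have "j < p N ?k \<longleftrightarrow> j < p N k" if "j \<le> N" for j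
          using p_Op[OF kk(1,4) Delta_id_in, of 2 j q] that pq by (auto simp: Delta_id_apply)
        moreover have kB: "?k \<in> simps B N" by (rule Op_in[OF kk(1,4) Delta_id_in]) simp
        ultimately have pk: "p N ?k = p N k"
          using p_le[OF kB] p_le[OF kk(1)] by (metis le_antisym less_Suc_eq_le not_less order_less_irrefl leI)
        have "p N k - 1 \<le> N" using p_le[OF kk(1)] by auto
        then have "Op N ?k N (Delta_id N) (cut 2 q) =
            Op N k N (compose {..N} (Delta_id N) (Delta_id N)) (\<lambda>j. mode_comp (cut 2 q j) (cut 2 q (Delta_id N j)))"
          using Op_Op[OF kk(1,4) Delta_id_in, of 2 q "Delta_id N" N 2 q] pk kk(4) Delta_id_in
          by (simp add: Delta_id_apply)
        also have "\<dots> = ?k"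
          unfolding compose_Delta_id_left[OF Delta_id_in]
          by (rule Op_cong) (auto simp: mode_comp_def cut_def Delta_id_apply)
        finally have "fixed 2 q N ?k" by (simp add: fixed_def)
        moreover assume "\<not> ?thesis"
        then have "bad P N ?k" using e1 e2 kB pk kk(3) by (simp add: bad_def)
        ultimately show False using mine[of ?k q] q(1) by simp
      qed
      show "q < u" if "2 = (2::nat)" "fixed 2 u N k" for u using mine[OF k(1) that(2)] q(1) by simp
    qed simp_all
  next
    case False
    define Qs where "Qs = {q. \<exists>k. bad P N k \<and> q \<le> Suc N \<and> fixed 1 q N k}"
    have fin: "finite Qs" by (rule finite_subset[of _ "{..Suc N}"]) (auto simp: Qs_def)
    obtain k0 where k0: "bad P N k0" using N by blast
    \<comment> \<open>Mode 0 does not alter vertices in \<C>, so \<open>P\<close> is always an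
      admissible threshold. In particular the maximum lies behind all vertices in \<C>.\<close>
    have PQ: "P \<in> Qs"
      using k0 Op_keep[of k0 N P] badD[OF k0] p_le[of k0 N] by (auto simp: Qs_def fixed_def)
    define q where "q = Max Qs"
    have "q \<in> Qs" unfolding q_def by (rule Max_in) (use fin PQ in auto)
    then obtain k where k: "bad P N k" "q \<le> Suc N" "fixed 1 q N k" by (auto simp: Qs_def)
    have maxq: "u \<le> q" if "bad P N k" "fixed 1 u N k" "u \<le> Suc N" for k u
      unfolding q_def by (rule Max_ge) (use fin that in \<open>auto simp: Qs_def\<close>)
    note kk = badD[OF k(1)]
    have qN: "q \<le> N" using k False by (metis le_Suc_eq)
    have Pq: "P \<le> q" unfolding q_def by (rule Max_ge[OF fin PQ])
    have i: "insertable 1 N k q" using kk Pq k(3) qN by (simp add: insertable_def)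
    show ?thesis
    proof (rule pairing_step[OF S i kk(2)])
      show "(N', k') \<in> S" if "k' \<in> simps B N'" "p N' k' < p N k \<or> p N' k' = p N k \<and> N' < N" for N' k'
        using min that kk(3) by simp
      show "(N, pull B N (Suc N) (face N (if 1 = (1::nat) then Suc q else q)) (Ins 1 N k q)) \<in> S"
      proof (rule ccontr)
        \<comment> \<open>The face at \<open>Suc q\<close> of the insertion is \<open>k\<close> with
          its vertex at \<open>q\<close> replaced by its \<open>T\<close>. It is fixed up to
          \<open>Suc q\<close>, beyond the maximal \<open>q\<close>.\<close>
        let ?k = "Op N k N (Delta_id N) (cut 1 (Suc q))"
        have e1: "pull B N (Suc N) (face N (Suc q)) (Ins 1 N k q) = Op N k N (Delta_id N) (\<lambda>j. cut 1 (Suc q) (face N (Suc q) j))"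
          unfolding Ins_def using pull_Op[OF kk(1,4) dgn_in[OF qN] _ face_in, of 1 "Suc q" "Suc q"] Delta_dgn_face[OF qN] by simp
        have e2: "Op N k N (Delta_id N) (\<lambda>j. cut 1 (Suc q) (face N (Suc q) j)) = ?k"
          by (rule Op_cong) (auto simp: cut_def face_apply)
        have "j < p N ?k \<longleftrightarrow> j < p N k" if "j \<le> N" for j
          using p_Op[OF kk(1,4) Delta_id_in, of 1 j "Suc q"] that by (auto simp: Delta_id_apply)
        moreover have kB: "?k \<in> simps B N" by (rule Op_in[OF kk(1,4) Delta_id_in]) simp
        ultimately have pk: "p N ?k = p N k"
          using p_le[OF kB] p_le[OF kk(1)] by (metis le_antisym less_Suc_eq_le not_less order_less_irrefl leI)
        have "p N k - 1 \<le> N" using p_le[OF kk(1)] by auto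
        then have "Op N ?k N (Delta_id N) (cut 1 (Suc q)) =
            Op N k N (compose {..N} (Delta_id N) (Delta_id N)) (\<lambda>j. mode_comp (cut 1 (Suc q) j) (cut 1 (Suc q) (Delta_id N j)))"
          using Op_Op[OF kk(1,4) Delta_id_in, of 1 "Suc q" "Delta_id N" N 1 "Suc q"] pk kk(4) Delta_id_in
          by (simp add: Delta_id_apply)
        also have "\<dots> = ?k"
          unfolding compose_Delta_id_left[OF Delta_id_in]
          by (rule Op_cong) (auto simp: mode_comp_def cut_def Delta_id_apply)
        finally have "fixed 1 (Suc q) N ?k" by (simp add: fixed_def)
        moreover assume "\<not> ?thesis"
        then have "bad P N ?k" using e1 e2 kB pk kk(3) by (simp add: bad_def)
        ultimately show False using maxq[of ?k "Suc q"] qN by simp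
      qed
      \<comment> \<open>The maximum only ranges over thresholds up to \<open>Suc N\<close>. A larger
        one would also fix \<open>k\<close> at \<open>Suc N\<close>, which this case
        excludes.\<close>
      show "u \<le> q" if "1 = (1::nat)" "fixed 1 u N k" for u
        using maxq[OF k(1) that(2)] fixed_mono(1)[OF kk(1,4) that(2), of "Suc N"] False k(1) by (metis le_SucI nat_le_linear)
    qed simp_all
  qed
qed

lemma A0_closed: "closed_under B R A0"
proof -
  have "(Suc N, Ins t N k q) \<in> A0" if "insertable t N k q" "(N, k) \<in> A0" for t N k q
    using that Q_Op[OF _ _ dgn_in] unfolding insertable_def A0_def Ins_def by auto
  moreover have "p L (pull B L N \<alpha> k) = 0" if "k \<in> simps B N" "p N k = 0" "\<alpha> \<in> Delta L N" for L N \<alpha> k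
    using p_pull[OF that(1,3), of 0] that by auto
  ultimately show ?thesis
    using Q_sub Q_pull sset_pull_in[OF B] unfolding closed_under_def R_def A0_def by auto
qed

lemma extend:
  assumes rf: "right_fibration X T f" and v: "v \<in> sset_hom B T"
    and u: "\<And>n x. (n, x) \<in> A0 \<Longrightarrow> u n x \<in> simps X n" "\<And>n x. (n, x) \<in> A0 \<Longrightarrow> f n (u n x) = v n x"
      "\<And>m n x \<alpha>. (n, x) \<in> A0 \<Longrightarrow> \<alpha> \<in> Delta m n \<Longrightarrow> u m (pull B m n \<alpha> x) = pull X m n \<alpha> (u n x)"
  obtains w where "w \<in> sset_hom B X" "\<And>n x. (n, x) \<in> A0 \<Longrightarrow> w n x = u n x"
    "\<And>n x. x \<in> simps B n \<Longrightarrow> f n (w n x) = v n x"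
  by (rule right_fibration_extend[OF rf B v A0_closed u exists_pairing_step], assumption+) (rule that)

end

section \<open>The simplicial set of chains and its cylinder over \<open>\<C>\<close>\<close>

lemma simps_nerve: "\<kappa> \<in> simps (nerve A s) l \<longleftrightarrow>
    \<kappa> \<in> extensional {..l} \<and> (\<forall>i\<le>l. \<kappa> i \<in> A) \<and> (\<forall>i j. i \<le> j \<and> j \<le> l \<longrightarrow> (\<kappa> i, \<kappa> j) \<in> s)"
  by (auto simp: nerve_def PiE_def Pi_def)

lemma pull_nerve [simp]: "pull (nerve A s) k m \<alpha> \<sigma> = compose {..k} \<sigma> \<alpha>"
  by (simp add: nerve_def)

lemma nerve_pull_in: "\<alpha> \<in> Delta k l \<Longrightarrow> \<kappa> \<in> simps (nerve A s) l \<Longrightarrow> compose {..k} \<kappa> \<alpha> \<in> simps (nerve A s) k"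
  unfolding simps_nerve by (auto simp: compose_def Delta_le Delta_mono)

lemma compose_Delta_assoc:
  "\<alpha> \<in> Delta k l \<Longrightarrow> compose {..k} (compose {..l} f \<beta>) \<alpha> = compose {..k} f (compose {..k} \<beta> \<alpha>)"
  using Delta_le by (fastforce simp: compose_def restrict_def fun_eq_iff)

text \<open>For monotone \<open>lam\<close> the zeros form an initial segment, so the count is also
  the position of the first vertex outside \<C>.\<close>

definition cnt :: "nat \<Rightarrow> (nat \<Rightarrow> nat) \<Rightarrow> nat" where
  "cnt N lam = card {j. j \<le> N \<and> lam j = 0}"

lemma less_cnt:
  assumes l: "lam \<in> Delta N 1" and j: "j \<le> N"
  shows "j < cnt N lam \<longleftrightarrow> lam j = 0"
proof
  let ?A = "{j. j \<le> N \<and> lam j = 0}"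
  show "j < cnt N lam" if l0: "lam j = 0"
  proof -
    have "{..j} \<subseteq> ?A"
    proof
      fix i assume "i \<in> {..j}"
      then show "i \<in> ?A" using Delta_mono[OF l, of i j] l0 j by auto
    qed
    then have "card {..j} \<le> card ?A" by (intro card_mono) auto
    then show ?thesis by (simp add: cnt_def)
  qed
  show "lam j = 0" if "j < cnt N lam"
  proof (rule ccontr)
    assume l0: "lam j \<noteq> 0"
    have "?A \<subseteq> {..<j}"
    proof
      fix i assume "i \<in> ?A"
      then show "i \<in> {..<j}" using Delta_mono[OF l, of j i] l0 by (cases "j \<le> i") auto
    qed
    then have "card ?A \<le> card {..<j}" by (intro card_mono) auto
    then show False using that by (simp add: cnt_def)
  qed
qed

lemma cnt_le: "cnt N lam \<le> Suc N"
proof -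
  have "card {j. j \<le> N \<and> lam j = 0} \<le> card {..N}" by (rule card_mono) auto
  then show ?thesis by (simp add: cnt_def)
qed

text \<open>The new entry goes to the front because it will be a lower bound of the chain; with
  \<open>x\<close> the reference vertex the result is again increasing.\<close>

definition ins :: "'p \<Rightarrow> 'p list \<Rightarrow> 'p list" where
  "ins x xs = (if x \<in> set xs then xs else x # xs)"

lemma set_ins [simp]: "set (ins x xs) = insert x (set xs)"
  by (auto simp: ins_def)

lemma ins_ins [simp]: "ins x (ins x xs) = ins x xs"
  by (simp add: ins_def)

lemma ins_single [simp]: "ins x [x] = [x]"
  by (simp add: ins_def)

locale chains =
  fixes C :: "'c sset" and P :: "'p set" and r :: "'p rel" and F :: "nat \<Rightarrow> 'c \<Rightarrow> (nat \<Rightarrow> 'p)"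
  assumes C: "simplicial_set C" and po: "partial_order_on P r" and F: "F \<in> sset_hom C (nerve P r)"
begin

lemma r_refl: "x \<in> P \<Longrightarrow> (x, x) \<in> r" and r_trans: "(x, y) \<in> r \<Longrightarrow> (y, z) \<in> r \<Longrightarrow> (x, z) \<in> r"
  and r_antisym: "(x, y) \<in> r \<Longrightarrow> (y, x) \<in> r \<Longrightarrow> x = y"
  using partial_order_onD[OF po] by (auto simp: refl_on_def dest: transD antisymD)

section \<open>Restriction of maps along poset maps over \<open>P\<close>\<close>

abbreviation NV :: "nat \<Rightarrow> (nat \<Rightarrow> 'p list) \<Rightarrow> (nat \<Rightarrow> nat \<times> 'p) sset" where
  "NV m \<xi> \<equiv> nerve (V_poset m \<xi>) (V_le r)"

definition over :: "nat \<Rightarrow> (nat \<Rightarrow> 'p list) \<Rightarrow> (nat \<Rightarrow> (nat \<Rightarrow> nat \<times> 'p) \<Rightarrow> 'c) \<Rightarrow> bool" where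
  "over m \<xi> \<Theta> \<longleftrightarrow> \<Theta> \<in> sset_hom (NV m \<xi>) C \<and>
     (\<forall>l. \<forall>\<kappa>\<in>simps (NV m \<xi>) l. F l (\<Theta> l \<kappa>) = compose {..l} snd \<kappa>)"

lemma over_iff:
  "over m \<xi> \<Theta> \<longleftrightarrow> \<Theta> \<in> sset_hom (NV m \<xi>) C \<and>
     sset_comp (NV m \<xi>) F \<Theta> = nerve_map (V_poset m \<xi>) (V_le r) snd"
proof -
  have "sset_comp (NV m \<xi>) F \<Theta> = nerve_map (V_poset m \<xi>) (V_le r) snd \<longleftrightarrow>
      (\<forall>l. \<forall>\<kappa>\<in>simps (NV m \<xi>) l. F l (\<Theta> l \<kappa>) = compose {..l} snd \<kappa>)"
    unfolding fun_eq_iff[of "sset_comp (NV m \<xi>) F \<Theta>"] sset_comp_def nerve_map_def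
    by (auto simp: compose_def restrict_def fun_eq_iff)
  then show ?thesis by (simp add: over_def)
qed

definition res :: "nat \<Rightarrow> (nat \<Rightarrow> 'p list) \<Rightarrow> (nat \<times> 'p \<Rightarrow> nat \<times> 'p) \<Rightarrow>
    (nat \<Rightarrow> (nat \<Rightarrow> nat \<times> 'p) \<Rightarrow> 'c) \<Rightarrow> nat \<Rightarrow> (nat \<Rightarrow> nat \<times> 'p) \<Rightarrow> 'c" where
  "res m \<xi> \<phi> \<Theta> = sset_comp (NV m \<xi>) \<Theta> (nerve_map (V_poset m \<xi>) (V_le r) \<phi>)"

definition V_map :: "nat \<Rightarrow> (nat \<Rightarrow> 'p list) \<Rightarrow> nat \<Rightarrow> (nat \<Rightarrow> 'p list) \<Rightarrow> (nat \<times> 'p \<Rightarrow> nat \<times> 'p) \<Rightarrow> bool" where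
  "V_map m' \<xi>' m \<xi> \<phi> \<longleftrightarrow> (\<forall>v\<in>V_poset m' \<xi>'. \<phi> v \<in> V_poset m \<xi> \<and> snd (\<phi> v) = snd v) \<and>
     (\<forall>v\<in>V_poset m' \<xi>'. \<forall>w\<in>V_poset m' \<xi>'. (v, w) \<in> V_le r \<longrightarrow> (\<phi> v, \<phi> w) \<in> V_le r)"

lemma V_map_chain:
  "V_map m' \<xi>' m \<xi> \<phi> \<Longrightarrow> \<kappa> \<in> simps (NV m' \<xi>') l \<Longrightarrow> compose {..l} \<phi> \<kappa> \<in> simps (NV m \<xi>) l"
  unfolding simps_nerve V_map_def by (auto simp: compose_def)

lemma res_apply: "\<kappa> \<in> simps (NV m \<xi>) l \<Longrightarrow> res m \<xi> \<phi> \<Theta> l \<kappa> = \<Theta> l (compose {..l} \<phi> \<kappa>)"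
  by (simp add: res_def sset_comp_def nerve_map_def compose_def)

lemma res_ext: "res m \<xi> \<phi> \<Theta> l \<in> extensional (simps (NV m \<xi>) l)"
  by (simp add: res_def sset_comp_def)

lemma res_eqI:
  assumes "\<And>l \<kappa>. \<kappa> \<in> simps (NV m \<xi>) l \<Longrightarrow> \<Theta> l (compose {..l} \<phi> \<kappa>) = \<Theta>' l (compose {..l} \<phi>' \<kappa>)"
  shows "res m \<xi> \<phi> \<Theta> = res m \<xi> \<phi>' \<Theta>'"
proof
  show "res m \<xi> \<phi> \<Theta> l = res m \<xi> \<phi>' \<Theta>' l" for l
    by (rule extensionalityI[OF res_ext res_ext]) (simp add: res_apply assms)
qed

lemma compose_cong_V:
  assumes "\<kappa> \<in> simps (NV m \<xi>) l" "\<And>v. v \<in> V_poset m \<xi> \<Longrightarrow> \<phi> v = \<phi>' v"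
  shows "compose {..l} \<phi> \<kappa> = compose {..l} \<phi>' \<kappa>"
  using assms unfolding simps_nerve by (auto simp: compose_def restrict_def fun_eq_iff)

lemma res_cong: "(\<And>v. v \<in> V_poset m \<xi> \<Longrightarrow> \<phi> v = \<phi>' v) \<Longrightarrow> res m \<xi> \<phi> \<Theta> = res m \<xi> \<phi>' \<Theta>"
  by (rule res_eqI) (metis compose_cong_V)

lemma res_res:
  assumes "V_map m' \<xi>' m \<xi> \<psi>"
  shows "res m' \<xi>' \<psi> (res m \<xi> \<phi> \<Theta>) = res m' \<xi>' (\<phi> \<circ> \<psi>) \<Theta>"
proof (rule res_eqI)
  fix l \<kappa> assume k: "\<kappa> \<in> simps (NV m' \<xi>') l"
  have "compose {..l} \<phi> (compose {..l} \<psi> \<kappa>) = compose {..l} (\<phi> \<circ> \<psi>) \<kappa>"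
    by (auto simp: compose_def restrict_def fun_eq_iff)
  then show "res m \<xi> \<phi> \<Theta> l (compose {..l} \<psi> \<kappa>) = \<Theta> l (compose {..l} (\<phi> \<circ> \<psi>) \<kappa>)"
    using res_apply[OF V_map_chain[OF assms k]] by simp
qed

lemma over_res:
  assumes o: "over m \<xi> \<Theta>" and v: "V_map m' \<xi>' m \<xi> \<phi>"
  shows "over m' \<xi>' (res m' \<xi>' \<phi> \<Theta>)"
proof -
  have Th: "\<Theta> \<in> sset_hom (NV m \<xi>) C" using o by (simp add: over_def)
  have "res m' \<xi>' \<phi> \<Theta> \<in> sset_hom (NV m' \<xi>') C"
  proof (rule sset_homI)
    fix k l \<alpha> \<kappa> assume a: "\<alpha> \<in> Delta k l" and ka: "\<kappa> \<in> simps (NV m' \<xi>') l"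
    have "compose {..k} \<phi> (compose {..k} \<kappa> \<alpha>) = compose {..k} (compose {..l} \<phi> \<kappa>) \<alpha>"
      using Delta_le[OF a] by (auto simp: compose_def restrict_def fun_eq_iff)
    then show "res m' \<xi>' \<phi> \<Theta> k (pull (NV m' \<xi>') k l \<alpha> \<kappa>) = pull C k l \<alpha> (res m' \<xi>' \<phi> \<Theta> l \<kappa>)"
      using sset_hom_pull[OF Th a V_map_chain[OF v ka]] nerve_pull_in[OF a ka] ka by (simp add: res_apply)
  qed (use sset_hom_in[OF Th] V_map_chain[OF v] in \<open>auto simp: res_apply res_ext\<close>)
  moreover have "F l (res m' \<xi>' \<phi> \<Theta> l \<kappa>) = compose {..l} snd \<kappa>" if k: "\<kappa> \<in> simps (NV m' \<xi>') l" for l \<kappa>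
  proof -
    have "compose {..l} snd (compose {..l} \<phi> \<kappa>) = compose {..l} snd \<kappa>"
      using v k unfolding simps_nerve V_map_def by (auto simp: compose_def restrict_def fun_eq_iff)
    then show ?thesis using o V_map_chain[OF v k] k by (simp add: over_def res_apply)
  qed
  ultimately show ?thesis by (simp add: over_def)
qed

lemma res_id:
  assumes o: "over m \<xi> \<Theta>" and id: "\<And>v. v \<in> V_poset m \<xi> \<Longrightarrow> \<phi> v = v"
  shows "res m \<xi> \<phi> \<Theta> = \<Theta>"
proof
  fix l
  show "res m \<xi> \<phi> \<Theta> l = \<Theta> l"
  proof (rule extensionalityI[OF res_ext])
    show "\<Theta> l \<in> extensional (simps (NV m \<xi>) l)" using o sset_hom_ext by (auto simp: over_def)
    show "res m \<xi> \<phi> \<Theta> l \<kappa> = \<Theta> l \<kappa>" if k: "\<kappa> \<in> simps (NV m \<xi>) l" for \<kappa>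
    proof -
      have "compose {..l} \<phi> \<kappa> = \<kappa>"
        using k id unfolding simps_nerve by (auto simp: compose_def restrict_def fun_eq_iff extensional_def)
      then show ?thesis by (simp add: res_apply[OF k])
    qed
  qed
qed

lemma simps_CF: "(\<sigma>, \<Theta>) \<in> simps (CF C P r F) m \<longleftrightarrow> \<sigma> \<in> simps (nerve_sd_op P r) m \<and> over m \<sigma> \<Theta>"
  by (simp add: CF_def over_iff)

lemma pull_CF: "pull (CF C P r F) k m \<alpha> (\<sigma>, \<Theta>) =
    (compose {..k} \<sigma> \<alpha>, res k (compose {..k} \<sigma> \<alpha>) (\<lambda>(i, x). (\<alpha> i, x)) \<Theta>)"
  by (simp add: CF_def Let_def res_def)

lemma V_map_pull:
  "\<alpha> \<in> Delta k m \<Longrightarrow> V_map k (compose {..k} \<xi> \<alpha>) m \<xi> (\<lambda>(i, x). (\<alpha> i, x))"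
  unfolding V_map_def V_poset_def V_le_def by (auto simp: compose_def Delta_le Delta_mono)

text \<open>An \<open>m\<close>-simplex \<open>(lam, \<xi>, \<Theta>)\<close> of the cylinder is a join \<open>\<Delta>\<^sup>p\<^sup>-\<^sup>1 \<star> N V\<^sub>\<sigma> \<rightarrow> \<C>\<close>, where \<open>lam : [m] \<rightarrow> [1]\<close>
  has fibre \<open>[p - 1]\<close> over \<open>0\<close>: the vertices of \<open>\<Delta>\<^sup>p\<^sup>-\<^sup>1\<close> are recorded as one-element chains, so that the
  join is the nerve of \<open>V\<^sub>\<xi>\<close>.\<close>

definition shape :: "nat \<Rightarrow> (nat \<Rightarrow> nat) \<Rightarrow> (nat \<Rightarrow> 'p list) \<Rightarrow> bool" where
  "shape m lam \<xi> \<longleftrightarrow> lam \<in> Delta m 1 \<and> \<xi> \<in> extensional {..m} \<and> (\<forall>i\<le>m. \<xi> i \<in> sd P r) \<and>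
     (\<forall>i\<le>m. lam i = 0 \<longrightarrow> \<xi> i = [hd (\<xi> i)]) \<and>
     (\<forall>i j. i \<le> j \<longrightarrow> j \<le> m \<longrightarrow> lam i = 0 \<longrightarrow> (\<forall>z\<in>set (\<xi> j). (hd (\<xi> i), z) \<in> r)) \<and>
     (\<forall>i j. i \<le> j \<longrightarrow> j \<le> m \<longrightarrow> lam i \<noteq> 0 \<longrightarrow> set (\<xi> j) \<subseteq> set (\<xi> i))"

lemma shapeD:
  assumes "shape m lam \<xi>"
  shows "lam \<in> Delta m 1" "\<xi> \<in> extensional {..m}" "i \<le> m \<Longrightarrow> \<xi> i \<in> sd P r"
    "i \<le> m \<Longrightarrow> lam i = 0 \<Longrightarrow> \<xi> i = [hd (\<xi> i)]"
    "i \<le> j \<Longrightarrow> j \<le> m \<Longrightarrow> lam i = 0 \<Longrightarrow> z \<in> set (\<xi> j) \<Longrightarrow> (hd (\<xi> i), z) \<in> r"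
    "i \<le> j \<Longrightarrow> j \<le> m \<Longrightarrow> lam i \<noteq> 0 \<Longrightarrow> z \<in> set (\<xi> j) \<Longrightarrow> z \<in> set (\<xi> i)"
  using assms unfolding shape_def by blast+

lemma shapeI:
  assumes "lam \<in> Delta m 1" "\<xi> \<in> extensional {..m}" "\<And>i. i \<le> m \<Longrightarrow> \<xi> i \<in> sd P r"
    "\<And>i. i \<le> m \<Longrightarrow> lam i = 0 \<Longrightarrow> \<xi> i = [hd (\<xi> i)]"
    "\<And>i j z. i \<le> j \<Longrightarrow> j \<le> m \<Longrightarrow> lam i = 0 \<Longrightarrow> z \<in> set (\<xi> j) \<Longrightarrow> (hd (\<xi> i), z) \<in> r"
    "\<And>i j z. i \<le> j \<Longrightarrow> j \<le> m \<Longrightarrow> lam i \<noteq> 0 \<Longrightarrow> z \<in> set (\<xi> j) \<Longrightarrow> z \<in> set (\<xi> i)"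
  shows "shape m lam \<xi>"
  using assms unfolding shape_def by blast

definition cyl :: "((nat \<Rightarrow> nat) \<times> (nat \<Rightarrow> 'p list) \<times> (nat \<Rightarrow> (nat \<Rightarrow> nat \<times> 'p) \<Rightarrow> 'c)) sset" where
  "cyl = \<lparr> simps = (\<lambda>m. {(lam, \<xi>, \<Theta>). shape m lam \<xi> \<and> over m \<xi> \<Theta>}),
     pull = (\<lambda>k m \<alpha> (lam, z). (compose {..k} lam \<alpha>, pull (CF C P r F) k m \<alpha> z)) \<rparr>"

lemma simps_cyl: "(lam, \<xi>, \<Theta>) \<in> simps cyl m \<longleftrightarrow> shape m lam \<xi> \<and> over m \<xi> \<Theta>"
  by (simp add: cyl_def)

lemma pull_cyl: "pull cyl k m \<alpha> (lam, \<xi>, \<Theta>) =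
    (compose {..k} lam \<alpha>, compose {..k} \<xi> \<alpha>, res k (compose {..k} \<xi> \<alpha>) (\<lambda>(i, x). (\<alpha> i, x)) \<Theta>)"
  by (simp add: cyl_def pull_CF)

lemma sd_hd: "xs \<in> sd P r \<Longrightarrow> z \<in> set xs \<Longrightarrow> (hd xs, z) \<in> r"
  by (cases xs) (auto simp: sd_def intro: r_refl)

lemma sd_hd_in: "xs \<in> sd P r \<Longrightarrow> hd xs \<in> set xs"
  by (simp add: sd_def)

lemma sd_P: "xs \<in> sd P r \<Longrightarrow> z \<in> set xs \<Longrightarrow> z \<in> P"
  by (auto simp: sd_def)

lemma sd_single: "x \<in> P \<Longrightarrow> [x] \<in> sd P r"
  by (simp add: sd_def)

lemma sd_ins: "xs \<in> sd P r \<Longrightarrow> x \<in> P \<Longrightarrow> (\<And>z. z \<in> set xs \<Longrightarrow> (x, z) \<in> r) \<Longrightarrow> ins x xs \<in> sd P r"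
  by (auto simp: sd_def ins_def)

lemma shape_pull:
  assumes s: "shape m lam \<xi>" and a: "\<alpha> \<in> Delta k m"
  shows "shape k (compose {..k} lam \<alpha>) (compose {..k} \<xi> \<alpha>)"
proof (rule shapeI)
  show "compose {..k} lam \<alpha> \<in> Delta k 1" by (rule Delta_compose[OF a shapeD(1)[OF s]])
  have *: "i \<le> k \<Longrightarrow> \<alpha> i \<le> m" "i \<le> j \<Longrightarrow> j \<le> k \<Longrightarrow> \<alpha> i \<le> \<alpha> j" for i j
    using Delta_le[OF a] Delta_mono[OF a] by auto
  fix i j z
  show "compose {..k} \<xi> \<alpha> i \<in> sd P r" if "i \<le> k"
    using that *(1)[of i] shapeD(3)[OF s, of "\<alpha> i"] by (simp add: compose_def)
  show "compose {..k} \<xi> \<alpha> i = [hd (compose {..k} \<xi> \<alpha> i)]" if "i \<le> k" "compose {..k} lam \<alpha> i = 0"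
    using that *(1)[of i] shapeD(4)[OF s, of "\<alpha> i"] by (simp add: compose_def)
  show "(hd (compose {..k} \<xi> \<alpha> i), z) \<in> r"
    if "i \<le> j" "j \<le> k" "compose {..k} lam \<alpha> i = 0" "z \<in> set (compose {..k} \<xi> \<alpha> j)"
    using that *(1)[of j] *(2)[of i j] shapeD(5)[OF s, of "\<alpha> i" "\<alpha> j" z] by (simp add: compose_def)
  show "z \<in> set (compose {..k} \<xi> \<alpha> i)"
    if "i \<le> j" "j \<le> k" "compose {..k} lam \<alpha> i \<noteq> 0" "z \<in> set (compose {..k} \<xi> \<alpha> j)"
    using that *(1)[of j] *(2)[of i j] shapeD(6)[OF s, of "\<alpha> i" "\<alpha> j" z] by (simp add: compose_def)
qed simp

lemma cyl_sset: "simplicial_set cyl"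
proof (rule simplicial_setI)
  fix k m \<alpha> x assume a: "\<alpha> \<in> Delta k m" and x: "x \<in> simps cyl m"
  obtain lam \<xi> \<Theta> where [simp]: "x = (lam, \<xi>, \<Theta>)" by (cases x)
  show "pull cyl k m \<alpha> x \<in> simps cyl k"
    using x a by (auto simp: simps_cyl pull_cyl intro: shape_pull over_res V_map_pull)
next
  fix m x assume x: "x \<in> simps cyl m"
  obtain lam \<xi> \<Theta> where [simp]: "x = (lam, \<xi>, \<Theta>)" by (cases x)
  have s: "shape m lam \<xi>" "over m \<xi> \<Theta>" using x by (auto simp: simps_cyl)
  then have "compose {..m} lam (Delta_id m) = lam" "compose {..m} \<xi> (Delta_id m) = \<xi>"
    by (auto simp: shape_def compose_Delta_id_right Delta_ext)
  then show "pull cyl m m (Delta_id m) x = x"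
    using res_id[OF s(2), of "\<lambda>(i, x). (Delta_id m i, x)"]
    by (auto simp: pull_cyl V_poset_def Delta_id_def)
next
  fix k l m \<alpha> \<beta> x assume a: "\<alpha> \<in> Delta k l" and b: "\<beta> \<in> Delta l m" and x: "x \<in> simps cyl m"
  obtain lam \<xi> \<Theta> where [simp]: "x = (lam, \<xi>, \<Theta>)" by (cases x)
  note c = compose_Delta_assoc[OF a]
  have "res k (compose {..k} \<xi> (compose {..k} \<beta> \<alpha>)) (\<lambda>(i, x). (\<alpha> i, x))
      (res l (compose {..l} \<xi> \<beta>) (\<lambda>(i, x). (\<beta> i, x)) \<Theta>) =
    res k (compose {..k} \<xi> (compose {..k} \<beta> \<alpha>)) ((\<lambda>(i, x). (\<beta> i, x)) \<circ> (\<lambda>(i, x). (\<alpha> i, x))) \<Theta>"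
    using res_res[OF V_map_pull[OF a, of "compose {..l} \<xi> \<beta>"]] unfolding c by blast
  also have "\<dots> = res k (compose {..k} \<xi> (compose {..k} \<beta> \<alpha>)) (\<lambda>(i, x). (compose {..k} \<beta> \<alpha> i, x)) \<Theta>"
    by (rule res_cong) (auto simp: V_poset_def compose_def)
  finally show "pull cyl k m (compose {..k} \<beta> \<alpha>) x = pull cyl k l \<alpha> (pull cyl l m \<beta> x)"
    by (simp add: pull_cyl c)
qed

lemma CF_cyl: "(\<sigma>, \<Theta>) \<in> simps (CF C P r F) m \<longleftrightarrow> ((\<lambda>i\<in>{..m}. 1), \<sigma>, \<Theta>) \<in> simps cyl m"
  unfolding simps_CF simps_cyl simps_nerve shape_def
  by (auto simp: sd_le_def intro!: DeltaI)


text \<open>The operators of the pairing. Write \<open>x\<close> and \<open>c\<close> for the last vertex of \<open>\<Delta>\<^sup>p\<^sup>-\<^sup>1\<close> in \<open>P\<close> and in \<open>\<C>\<close>.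
  In mode \<open>0\<close> a chain \<open>\<xi>\<^sub>j\<close> is replaced by \<open>{x} \<union> \<xi>\<^sub>j\<close>, with \<open>c\<close> over \<open>x\<close>; in mode \<open>1\<close> it is kept;
  in mode \<open>2\<close> it is replaced by \<open>({x}, c)\<close>. These modes are the two natural transformations that contract
  the simplicial set of chains under \<open>c\<close>.\<close>

definition last_ix :: "nat \<Rightarrow> (nat \<Rightarrow> nat) \<Rightarrow> nat" where
  "last_ix N lam = cnt N lam - 1"

definition op_lam :: "nat \<Rightarrow> (nat \<Rightarrow> nat) \<Rightarrow> nat \<Rightarrow> (nat \<Rightarrow> nat) \<Rightarrow> (nat \<Rightarrow> nat) \<Rightarrow> nat \<Rightarrow> nat" where
  "op_lam N lam L \<alpha> \<mu> = (\<lambda>j\<in>{..L}. if \<mu> j = 2 then 1 else lam (\<alpha> j))"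

definition op_chain :: "nat \<Rightarrow> (nat \<Rightarrow> nat) \<Rightarrow> (nat \<Rightarrow> 'p list) \<Rightarrow> nat \<Rightarrow> (nat \<Rightarrow> nat) \<Rightarrow> (nat \<Rightarrow> nat) \<Rightarrow> nat \<Rightarrow> 'p list" where
  "op_chain N lam \<xi> L \<alpha> \<mu> = (\<lambda>j\<in>{..L}. let x = hd (\<xi> (last_ix N lam)) in
     if \<mu> j = 2 then [x] else if \<mu> j = 0 \<and> lam (\<alpha> j) = 1 then ins x (\<xi> (\<alpha> j)) else \<xi> (\<alpha> j))"

text \<open>The point over \<open>x\<close> goes to the reference vertex even if the chain already
  contains \<open>x\<close>. A later chain may lack \<open>x\<close>, and its new entry is
  \<open>c\<close>; keeping the old entry would ask for a map from it to \<open>c\<close>, whereas a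
  chain under \<open>c\<close> supplies only maps out of \<open>c\<close>.\<close>

definition op_map :: "nat \<Rightarrow> (nat \<Rightarrow> nat) \<Rightarrow> (nat \<Rightarrow> 'p list) \<Rightarrow> (nat \<Rightarrow> nat) \<Rightarrow> (nat \<Rightarrow> nat) \<Rightarrow> nat \<times> 'p \<Rightarrow> nat \<times> 'p" where
  "op_map N lam \<xi> \<alpha> \<mu> = (\<lambda>(j, z). if z = hd (\<xi> (last_ix N lam)) \<and> (\<mu> j = 2 \<or> \<mu> j = 0 \<and> lam (\<alpha> j) = 1)
     then (last_ix N lam, z) else (\<alpha> j, z))"

definition cyl_op where
  "cyl_op N k L \<alpha> \<mu> = (case k of (lam, \<xi>, \<Theta>) \<Rightarrow>
     (op_lam N lam L \<alpha> \<mu>, op_chain N lam \<xi> L \<alpha> \<mu>, res L (op_chain N lam \<xi> L \<alpha> \<mu>) (op_map N lam \<xi> \<alpha> \<mu>) \<Theta>))"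

lemma lam_cases: "shape N lam \<xi> \<Longrightarrow> j \<le> N \<Longrightarrow> lam j = 0 \<or> lam j = 1"
  using Delta_le[OF shapeD(1)] by fastforce

lemma last_ix:
  assumes s: "shape N lam \<xi>" and p: "0 < cnt N lam"
  shows "last_ix N lam \<le> N" "lam (last_ix N lam) = 0"
    "j \<le> N \<Longrightarrow> lam j = 0 \<Longrightarrow> j \<le> last_ix N lam" "j \<le> N \<Longrightarrow> lam j \<noteq> 0 \<Longrightarrow> last_ix N lam < j"
    "\<xi> (last_ix N lam) = [hd (\<xi> (last_ix N lam))]" "hd (\<xi> (last_ix N lam)) \<in> P"
    "j \<le> N \<Longrightarrow> lam j \<noteq> 0 \<Longrightarrow> z \<in> set (\<xi> j) \<Longrightarrow> (hd (\<xi> (last_ix N lam)), z) \<in> r"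
    "j \<le> N \<Longrightarrow> lam j = 0 \<Longrightarrow> z \<in> set (\<xi> j) \<Longrightarrow> (z, hd (\<xi> (last_ix N lam))) \<in> r"
proof -
  let ?a = "last_ix N lam"
  note l = less_cnt[OF shapeD(1)[OF s]]
  show a: "?a \<le> N" using cnt_le[of N lam] p by (auto simp: last_ix_def)
  then show a0: "lam ?a = 0" using l[of ?a] p by (auto simp: last_ix_def)
  show 3: "j \<le> ?a" if "j \<le> N" "lam j = 0" for j using l[of j] that by (auto simp: last_ix_def)
  show 4: "?a < j" if "j \<le> N" "lam j \<noteq> 0" for j using l[of j] that p by (auto simp: last_ix_def)
  show 5: "\<xi> ?a = [hd (\<xi> ?a)]" by (rule shapeD(4)[OF s a a0])
  show "hd (\<xi> ?a) \<in> P" using sd_P[OF shapeD(3)[OF s a] sd_hd_in[OF shapeD(3)[OF s a]]] .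
  show "(hd (\<xi> ?a), z) \<in> r" if "j \<le> N" "lam j \<noteq> 0" "z \<in> set (\<xi> j)"
    using shapeD(5)[OF s _ that(1) a0 that(3)] 4[OF that(1,2)] by simp
  show "(z, hd (\<xi> ?a)) \<in> r" if j: "j \<le> N" "lam j = 0" "z \<in> set (\<xi> j)"
  proof -
    have "\<xi> j = [hd (\<xi> j)]" by (rule shapeD(4)[OF s j(1,2)])
    then have "z = hd (\<xi> j)" using j(3) by (metis empty_iff empty_set insert_iff list.simps(15))
    moreover have "hd (\<xi> ?a) \<in> set (\<xi> ?a)" using sd_hd_in[OF shapeD(3)[OF s a]] .
    ultimately show ?thesis using shapeD(5)[OF s 3[OF j(1,2)] a j(2)] by simp
  qed
qed

text \<open>The chain \<open>[x]\<close> may follow a chain to which \<open>x\<close> has been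
  added, because chains shrink, and it may follow vertices in \<C>, because \<open>x\<close> is the
  greatest of those. This is why mode 2 is used only behind mode 0.\<close>

lemma op_shape:
  assumes s: "shape N lam \<xi>" and p: "0 < cnt N lam" and a: "\<alpha> \<in> Delta L N" and t: "t = 1 \<or> t = 2"
  shows "shape L (op_lam N lam L \<alpha> (cut t c)) (op_chain N lam \<xi> L \<alpha> (cut t c))"
proof -
  let ?x = "hd (\<xi> (last_ix N lam))"
  note x = last_ix[OF s p]
  have aN: "\<alpha> j \<le> N" if "j \<le> L" for j using Delta_le[OF a that] .
  have am: "\<alpha> i \<le> \<alpha> j" if "i \<le> j" "j \<le> L" for i j using Delta_mono[OF a that] .
  have lm: "lam (\<alpha> i) \<le> lam (\<alpha> j)" if "i \<le> j" "j \<le> L" for i j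
    using Delta_mono[OF shapeD(1)[OF s] am[OF that] aN[OF that(2)]] .
  have l01: "lam (\<alpha> j) = 0 \<or> lam (\<alpha> j) = 1" if "j \<le> L" for j using lam_cases[OF s aN[OF that]] .
  have ol: "op_lam N lam L \<alpha> (cut t c) j = (if t = 2 \<and> c \<le> j then 1 else lam (\<alpha> j))" if "j \<le> L" for j
    using that t by (auto simp: op_lam_def cut_def)
  have oc: "op_chain N lam \<xi> L \<alpha> (cut t c) j = (if t = 2 \<and> c \<le> j then [?x]
      else if j < c \<and> lam (\<alpha> j) = 1 then ins ?x (\<xi> (\<alpha> j)) else \<xi> (\<alpha> j))" if "j \<le> L" for j
    using that t by (auto simp: op_chain_def cut_def Let_def)
  show ?thesis
  proof (rule shapeI)
    show "op_lam N lam L \<alpha> (cut t c) \<in> Delta L 1"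
    proof (rule DeltaI)
      fix i j assume "i \<le> j" "j \<le> L"
      then show "op_lam N lam L \<alpha> (cut t c) i \<le> op_lam N lam L \<alpha> (cut t c) j"
        using lm[of i j] l01[of i] by (auto simp: ol)
    next
      fix j assume "j \<le> L"
      then show "op_lam N lam L \<alpha> (cut t c) j \<le> 1" using l01[of j] by (auto simp: ol)
    qed (simp add: op_lam_def)
    show "op_chain N lam \<xi> L \<alpha> (cut t c) \<in> extensional {..L}" by (simp add: op_chain_def)
  next
    fix j assume j: "j \<le> L"
    have "ins ?x (\<xi> (\<alpha> j)) \<in> sd P r" if "lam (\<alpha> j) = 1"
      by (rule sd_ins[OF shapeD(3)[OF s aN[OF j]] x(6)]) (use x(7)[OF aN[OF j]] that in auto)
    then show "op_chain N lam \<xi> L \<alpha> (cut t c) j \<in> sd P r"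
      using shapeD(3)[OF s aN[OF j]] sd_single[OF x(6)] j by (auto simp: oc)
    show "op_chain N lam \<xi> L \<alpha> (cut t c) j = [hd (op_chain N lam \<xi> L \<alpha> (cut t c) j)]"
      if "op_lam N lam L \<alpha> (cut t c) j = 0"
      using that j shapeD(4)[OF s aN[OF j]] by (auto simp: oc ol split: if_splits)
  next
    fix i j z assume ij: "i \<le> j" "j \<le> L" and z: "z \<in> set (op_chain N lam \<xi> L \<alpha> (cut t c) j)"
    then have iL: "i \<le> L" by simp
    show "(hd (op_chain N lam \<xi> L \<alpha> (cut t c) i), z) \<in> r" if l0: "op_lam N lam L \<alpha> (cut t c) i = 0"
    proof -
      have i: "op_chain N lam \<xi> L \<alpha> (cut t c) i = \<xi> (\<alpha> i)" "lam (\<alpha> i) = 0"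
        using l0 iL by (auto simp: ol oc split: if_splits)
      have "(hd (\<xi> (\<alpha> i)), ?x) \<in> r"
        using x(8)[OF aN[OF iL] i(2) sd_hd_in[OF shapeD(3)[OF s aN[OF iL]]]] .
      moreover have "z = ?x \<or> z \<in> set (\<xi> (\<alpha> j))" using z ij(2) by (auto simp: oc split: if_splits)
      ultimately show ?thesis using i shapeD(5)[OF s am[OF ij] aN[OF ij(2)] i(2)] by auto
    qed
    show "z \<in> set (op_chain N lam \<xi> L \<alpha> (cut t c) i)" if "op_lam N lam L \<alpha> (cut t c) i \<noteq> 0"
    proof (cases "t = 2 \<and> c \<le> i")
      case True then show ?thesis using z oc[OF iL] oc[OF ij(2)] ij(1) by simp
    next
      case False
      then have li: "lam (\<alpha> i) = 1" using that l01[OF iL] iL by (auto simp: ol)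
      then have lj: "lam (\<alpha> j) = 1" using lm[OF ij] l01[OF ij(2)] by auto
      have sub: "w \<in> set (\<xi> (\<alpha> i))" if "w \<in> set (\<xi> (\<alpha> j))" for w
        using shapeD(6)[OF s am[OF ij] aN[OF ij(2)] _ that] li by simp
      show ?thesis using z False ij iL li lj sub by (auto simp: oc split: if_splits)
    qed
  qed
qed

text \<open>Monotonicity is at stake only when exactly one of two comparable points is redirected to
  the reference vertex.\<close>

lemma op_V_map:
  assumes s: "shape N lam \<xi>" and p: "0 < cnt N lam" and a: "\<alpha> \<in> Delta L N" and t: "t = 1 \<or> t = 2"
  shows "V_map L (op_chain N lam \<xi> L \<alpha> (cut t c)) N \<xi> (op_map N lam \<xi> \<alpha> (cut t c))"
proof -
  let ?x = "hd (\<xi> (last_ix N lam))" and ?a = "last_ix N lam"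
  note x = last_ix[OF s p]
  have aN: "\<alpha> j \<le> N" if "j \<le> L" for j using Delta_le[OF a that] .
  have am: "\<alpha> i \<le> \<alpha> j" if "i \<le> j" "j \<le> L" for i j using Delta_mono[OF a that] .
  have lm: "lam (\<alpha> i) \<le> lam (\<alpha> j)" if "i \<le> j" "j \<le> L" for i j
    using Delta_mono[OF shapeD(1)[OF s] am[OF that] aN[OF that(2)]] .
  have l01: "lam (\<alpha> j) = 0 \<or> lam (\<alpha> j) = 1" if "j \<le> L" for j using lam_cases[OF s aN[OF that]] .
  have om: "op_map N lam \<xi> \<alpha> (cut t c) (j, z) =
      (if z = ?x \<and> (t = 2 \<and> c \<le> j \<or> j < c \<and> lam (\<alpha> j) = 1) then (?a, z) else (\<alpha> j, z))" for j z
    using t by (auto simp: op_map_def cut_def)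
  have oc: "op_chain N lam \<xi> L \<alpha> (cut t c) j = (if t = 2 \<and> c \<le> j then [?x]
      else if j < c \<and> lam (\<alpha> j) = 1 then ins ?x (\<xi> (\<alpha> j)) else \<xi> (\<alpha> j))" if "j \<le> L" for j
    using that t by (auto simp: op_chain_def cut_def Let_def)
  have xa: "?x \<in> set (\<xi> ?a)" using sd_hd_in[OF shapeD(3)[OF s x(1)]] .
  show ?thesis
    unfolding V_map_def
  proof (intro conjI ballI impI)
    fix v assume "v \<in> V_poset L (op_chain N lam \<xi> L \<alpha> (cut t c))"
    then obtain j z where v: "v = (j, z)" "j \<le> L" "z \<in> set (op_chain N lam \<xi> L \<alpha> (cut t c) j)"
      by (auto simp: V_poset_def)
    show "op_map N lam \<xi> \<alpha> (cut t c) v \<in> V_poset N \<xi>"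
      using v(2,3) x(1) xa aN[OF v(2)] unfolding v(1) om by (auto simp: V_poset_def oc split: if_splits)
    show "snd (op_map N lam \<xi> \<alpha> (cut t c) v) = snd v" unfolding v(1) om by simp
  next
    fix v w assume vw: "v \<in> V_poset L (op_chain N lam \<xi> L \<alpha> (cut t c))"
      "w \<in> V_poset L (op_chain N lam \<xi> L \<alpha> (cut t c))" "(v, w) \<in> V_le r"
    obtain j z where v: "v = (j, z)" "j \<le> L" "z \<in> set (op_chain N lam \<xi> L \<alpha> (cut t c) j)"
      using vw(1) by (auto simp: V_poset_def)
    obtain j' z' where w: "w = (j', z')" "j' \<le> L" "z' \<in> set (op_chain N lam \<xi> L \<alpha> (cut t c) j')"
      using vw(2) by (auto simp: V_poset_def)
    have jj: "j \<le> j'" "(z, z') \<in> r" using vw(3) v(1) w(1) by (auto simp: V_le_def)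
    let ?col = "\<lambda>j z. z = ?x \<and> (t = 2 \<and> c \<le> j \<or> j < c \<and> lam (\<alpha> j) = 1)"
    have "fst (op_map N lam \<xi> \<alpha> (cut t c) (j, z)) \<le> fst (op_map N lam \<xi> \<alpha> (cut t c) (j', z'))"
    proof (cases "?col j z"; cases "?col j' z'")
      \<comment> \<open>The smaller point is redirected: the larger one lies over a chain, and all
        chains come after the reference vertex.\<close>
      assume c: "?col j z" "\<not> ?col j' z'"
      have "\<not> (t = 2 \<and> c \<le> j')" using c(2) w by (auto simp: oc)
      then have "lam (\<alpha> j) = 1" using c(1) jj(1) by auto
      then have "?a < \<alpha> j" using x(4)[OF aN[OF v(2)]] by simp
      then show ?thesis using c am[OF jj(1) w(2)] unfolding om by simp
    next
      \<comment> \<open>The larger point is redirected, so it lies over \<open>x\<close>. A smaller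
        point of a chain in mode 0 would be both above \<open>x\<close> and below it, hence over
        \<open>x\<close> and redirected itself; in mode 1 the larger point would not be
        redirected.\<close>
      assume c: "\<not> ?col j z" "?col j' z'"
      show ?thesis
      proof (cases "lam (\<alpha> j) = 0")
        case True then show ?thesis using c x(3)[OF aN[OF v(2)]] unfolding om by simp
      next
        case l1: False
        then have l1': "lam (\<alpha> j) = 1" using l01[OF v(2)] by simp
        have nj: "\<not> (t = 2 \<and> c \<le> j)" using c(1) v by (auto simp: oc)
        show ?thesis
        proof (cases "j < c")
          case True
          then have "z \<in> set (\<xi> (\<alpha> j))" "z \<noteq> ?x" using v(2,3) nj c(1) l1' by (auto simp: oc)
          then have "(?x, z) \<in> r" using x(7)[OF aN[OF v(2)] l1] by simp
          then show ?thesis using r_antisym[of ?x z] jj(2) c(2) \<open>z \<noteq> ?x\<close> by simp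
        next
          case False then show ?thesis using c(2) nj jj(1) by auto
        qed
      qed
    qed (use am[OF jj(1) w(2)] in \<open>auto simp: om\<close>)
    then show "(op_map N lam \<xi> \<alpha> (cut t c) v, op_map N lam \<xi> \<alpha> (cut t c) w) \<in> V_le r"
      using jj(2) unfolding v(1) w(1) om V_le_def by auto
  qed
qed

section \<open>The laws of the operators on the cylinder\<close>

lemma cyl_op_in:
  assumes "(lam, \<xi>, \<Theta>) \<in> simps cyl N" "0 < cnt N lam" "\<alpha> \<in> Delta L N" "t = 1 \<or> t = 2"
  shows "cyl_op N (lam, \<xi>, \<Theta>) L \<alpha> (cut t c) \<in> simps cyl L"
  using assms op_shape[OF _ assms(2-4)] over_res[OF _ op_V_map[OF _ assms(2-4)]]
  by (auto simp: cyl_op_def simps_cyl)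

lemma cyl_op_cong:
  assumes "\<And>j. j \<le> L \<Longrightarrow> \<mu> j = \<mu>' j"
  shows "cyl_op N k L \<alpha> \<mu> = cyl_op N k L \<alpha> \<mu>'"
proof -
  obtain lam \<xi> \<Theta> where k: "k = (lam, \<xi>, \<Theta>)" by (cases k)
  have "op_lam N lam L \<alpha> \<mu> = op_lam N lam L \<alpha> \<mu>'" "op_chain N lam \<xi> L \<alpha> \<mu> = op_chain N lam \<xi> L \<alpha> \<mu>'"
    using assms by (auto simp: op_lam_def op_chain_def restrict_def fun_eq_iff Let_def)
  moreover have "res L (op_chain N lam \<xi> L \<alpha> \<mu>') (op_map N lam \<xi> \<alpha> \<mu>) \<Theta> =
      res L (op_chain N lam \<xi> L \<alpha> \<mu>') (op_map N lam \<xi> \<alpha> \<mu>') \<Theta>"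
    by (rule res_cong) (use assms in \<open>auto simp: op_map_def V_poset_def\<close>)
  ultimately show ?thesis by (simp add: k cyl_op_def)
qed

lemma pull_cyl_op:
  assumes k: "(lam, \<xi>, \<Theta>) \<in> simps cyl N" and p: "0 < cnt N lam" and a: "\<alpha> \<in> Delta M N" and t: "t = 1 \<or> t = 2"
    and d: "\<delta> \<in> Delta L M"
  shows "pull cyl L M \<delta> (cyl_op N (lam, \<xi>, \<Theta>) M \<alpha> (cut t c)) =
    cyl_op N (lam, \<xi>, \<Theta>) L (compose {..L} \<alpha> \<delta>) (\<lambda>j. cut t c (\<delta> j))"
proof -
  have s: "shape N lam \<xi>" using k by (simp add: simps_cyl)
  let ?\<mu> = "\<lambda>j. cut t c (\<delta> j)"
  have 1: "compose {..L} (op_lam N lam M \<alpha> (cut t c)) \<delta> = op_lam N lam L (compose {..L} \<alpha> \<delta>) ?\<mu>"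
    using Delta_le[OF d] by (auto simp: op_lam_def compose_def restrict_def fun_eq_iff)
  have 2: "compose {..L} (op_chain N lam \<xi> M \<alpha> (cut t c)) \<delta> = op_chain N lam \<xi> L (compose {..L} \<alpha> \<delta>) ?\<mu>"
    using Delta_le[OF d] by (auto simp: op_chain_def compose_def restrict_def fun_eq_iff Let_def)
  have "V_map L (op_chain N lam \<xi> L (compose {..L} \<alpha> \<delta>) ?\<mu>) M (op_chain N lam \<xi> M \<alpha> (cut t c)) (\<lambda>(i, x). (\<delta> i, x))"
    using V_map_pull[OF d, of "op_chain N lam \<xi> M \<alpha> (cut t c)"] unfolding 2 .
  note rr = res_res[OF this]
  have "res L (op_chain N lam \<xi> L (compose {..L} \<alpha> \<delta>) ?\<mu>) (op_map N lam \<xi> \<alpha> (cut t c) \<circ> (\<lambda>(i, x). (\<delta> i, x))) \<Theta> =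
      res L (op_chain N lam \<xi> L (compose {..L} \<alpha> \<delta>) ?\<mu>) (op_map N lam \<xi> (compose {..L} \<alpha> \<delta>) ?\<mu>) \<Theta>"
    by (rule res_cong) (auto simp: op_map_def V_poset_def compose_def)
  then show ?thesis by (simp add: cyl_op_def pull_cyl 1 2 rr)
qed

lemma cyl_op_pull:
  assumes k: "(lam, \<xi>, \<Theta>) \<in> simps cyl N" and ka: "\<kappa> \<in> Delta M N" and p: "0 < cnt M (compose {..M} lam \<kappa>)"
    and ref: "\<kappa> (last_ix M (compose {..M} lam \<kappa>)) = last_ix N lam" and a: "\<alpha> \<in> Delta L M" and t: "t = 1 \<or> t = 2"
  shows "cyl_op M (pull cyl M N \<kappa> (lam, \<xi>, \<Theta>)) L \<alpha> (cut t c) =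
    cyl_op N (lam, \<xi>, \<Theta>) L (compose {..L} \<kappa> \<alpha>) (cut t c)"
proof -
  have s: "shape N lam \<xi>" using k by (simp add: simps_cyl)
  let ?lam = "compose {..M} lam \<kappa>" and ?\<xi> = "compose {..M} \<xi> \<kappa>" and ?\<mu> = "cut t c"
  note s' = shape_pull[OF s ka]
  have x: "hd (?\<xi> (last_ix M ?lam)) = hd (\<xi> (last_ix N lam))"
    using last_ix(1)[OF s' p] ref by (simp add: compose_def)
  have 1: "op_lam M ?lam L \<alpha> ?\<mu> = op_lam N lam L (compose {..L} \<kappa> \<alpha>) ?\<mu>"
    using Delta_le[OF a] by (auto simp: op_lam_def compose_def restrict_def fun_eq_iff)
  have 2: "op_chain M ?lam ?\<xi> L \<alpha> ?\<mu> = op_chain N lam \<xi> L (compose {..L} \<kappa> \<alpha>) ?\<mu>"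
    unfolding op_chain_def x using Delta_le[OF a] by (auto simp: compose_def restrict_def fun_eq_iff Let_def)
  note rr = res_res[OF op_V_map[OF s' p a t, of c, unfolded 2]]
  have "res L (op_chain N lam \<xi> L (compose {..L} \<kappa> \<alpha>) ?\<mu>) ((\<lambda>(i, x). (\<kappa> i, x)) \<circ> op_map M ?lam ?\<xi> \<alpha> ?\<mu>) \<Theta> =
      res L (op_chain N lam \<xi> L (compose {..L} \<kappa> \<alpha>) ?\<mu>) (op_map N lam \<xi> (compose {..L} \<kappa> \<alpha>) ?\<mu>) \<Theta>"
    by (rule res_cong) (use x ref Delta_le[OF a] in \<open>auto simp: op_map_def V_poset_def compose_def\<close>)
  then show ?thesis by (simp add: cyl_op_def pull_cyl 1 2 rr)
qed

lemma cyl_op_op: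
  assumes k: "(lam, \<xi>, \<Theta>) \<in> simps cyl N" and p: "0 < cnt N lam" and a: "\<alpha> \<in> Delta M N" and t: "t = 1 \<or> t = 2"
    and p': "0 < cnt M (op_lam N lam M \<alpha> (cut t c))"
    and ref: "\<alpha> (last_ix M (op_lam N lam M \<alpha> (cut t c))) = last_ix N lam"
    and b: "\<beta> \<in> Delta L M" and t': "t' = 1 \<or> t' = 2"
  shows "cyl_op M (cyl_op N (lam, \<xi>, \<Theta>) M \<alpha> (cut t c)) L \<beta> (cut t' c') =
    cyl_op N (lam, \<xi>, \<Theta>) L (compose {..L} \<alpha> \<beta>) (\<lambda>j. mode_comp (cut t' c' j) (cut t c (\<beta> j)))"
proof -
  have s: "shape N lam \<xi>" using k by (simp add: simps_cyl)
  let ?lam = "op_lam N lam M \<alpha> (cut t c)" and ?\<xi> = "op_chain N lam \<xi> M \<alpha> (cut t c)"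
  let ?a = "last_ix M ?lam" and ?\<mu> = "\<lambda>j. mode_comp (cut t' c' j) (cut t c (\<beta> j))"
  note s' = op_shape[OF s p a t, of c]
  note a' = last_ix(1,2)[OF s' p']
  \<comment> \<open>The inner operator leaves its reference position alone: a vertex that still
    counts as lying in \<C> has not been put in mode 2. So both operators use the same
    \<open>x\<close> and \<open>c\<close>.\<close>
  have am: "cut t c ?a \<noteq> 2" "lam (\<alpha> ?a) = 0" using a' by (auto simp: op_lam_def split: if_splits)
  have "?\<xi> ?a = \<xi> (last_ix N lam)" using a'(1) am ref by (simp add: op_chain_def)
  then have x: "hd (?\<xi> ?a) = hd (\<xi> (last_ix N lam))" by simp
  have bM: "\<beta> j \<le> M" if "j \<le> L" for j using Delta_le[OF b that] .
  have l01: "lam (\<alpha> (\<beta> j)) = 0 \<or> lam (\<alpha> (\<beta> j)) = 1" if "j \<le> L" for j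
    using lam_cases[OF s Delta_le[OF a bM[OF that]]] .
  have c': "cut t' c' j = 0 \<or> cut t' c' j = 1 \<or> cut t' c' j = 2" for j using t' by (auto simp: cut_def)
  have 1: "op_lam M ?lam L \<beta> (cut t' c') = op_lam N lam L (compose {..L} \<alpha> \<beta>) ?\<mu>"
    unfolding op_lam_def
  proof (rule restrict_ext)
    fix j assume "j \<in> {..L}"
    then show "(if cut t' c' j = 2 then 1 else (\<lambda>j\<in>{..M}. if cut t c j = 2 then 1 else lam (\<alpha> j)) (\<beta> j)) =
        (if ?\<mu> j = 2 then 1 else lam (compose {..L} \<alpha> \<beta> j))"
      using bM[of j] c'[of j] by (auto simp: compose_def mode_comp_def)
  qed
  have 2: "op_chain M ?lam ?\<xi> L \<beta> (cut t' c') = op_chain N lam \<xi> L (compose {..L} \<alpha> \<beta>) ?\<mu>"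
    unfolding op_chain_def[of M] op_chain_def[of N _ _ L] x Let_def
  proof (rule restrict_ext)
    fix j assume "j \<in> {..L}"
    then show "(if cut t' c' j = 2 then [hd (\<xi> (last_ix N lam))]
        else if cut t' c' j = 0 \<and> ?lam (\<beta> j) = 1 then ins (hd (\<xi> (last_ix N lam))) (?\<xi> (\<beta> j)) else ?\<xi> (\<beta> j)) =
      (if ?\<mu> j = 2 then [hd (\<xi> (last_ix N lam))]
        else if ?\<mu> j = 0 \<and> lam (compose {..L} \<alpha> \<beta> j) = 1 then ins (hd (\<xi> (last_ix N lam))) (\<xi> (compose {..L} \<alpha> \<beta> j))
        else \<xi> (compose {..L} \<alpha> \<beta> j))"
      using bM[of j] c'[of j] l01[of j] by (auto simp: compose_def mode_comp_def op_lam_def op_chain_def Let_def)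
  qed
  note rr = res_res[OF op_V_map[OF s' p' b t', of c', unfolded 2]]
  have "res L (op_chain N lam \<xi> L (compose {..L} \<alpha> \<beta>) ?\<mu>) (op_map N lam \<xi> \<alpha> (cut t c) \<circ> op_map M ?lam ?\<xi> \<beta> (cut t' c')) \<Theta> =
      res L (op_chain N lam \<xi> L (compose {..L} \<alpha> \<beta>) ?\<mu>) (op_map N lam \<xi> (compose {..L} \<alpha> \<beta>) ?\<mu>) \<Theta>"
  proof (rule res_cong)
    fix v assume "v \<in> V_poset L (op_chain N lam \<xi> L (compose {..L} \<alpha> \<beta>) ?\<mu>)"
    then obtain j z where v: "v = (j, z)" "j \<le> L" by (auto simp: V_poset_def)
    then show "(op_map N lam \<xi> \<alpha> (cut t c) \<circ> op_map M ?lam ?\<xi> \<beta> (cut t' c')) v = op_map N lam \<xi> (compose {..L} \<alpha> \<beta>) ?\<mu> v"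
      using bM[of j] c'[of j] l01[of j] am ref
      unfolding op_map_def x by (auto simp: compose_def mode_comp_def op_lam_def)
  qed
  then show ?thesis by (simp add: cyl_op_def 1 2 rr)
qed

lemma cyl_op_keep:
  assumes k: "(lam, \<xi>, \<Theta>) \<in> simps cyl N" and c: "c \<le> cnt N lam"
  shows "cyl_op N (lam, \<xi>, \<Theta>) N (Delta_id N) (cut 1 c) = (lam, \<xi>, \<Theta>)"
proof -
  have s: "shape N lam \<xi>" "over N \<xi> \<Theta>" using k by (auto simp: simps_cyl)
  have l0: "lam j = 0" if "j < c" "j \<le> N" for j
    using less_cnt[OF shapeD(1)[OF s(1)] that(2)] that c by simp
  have 1: "op_lam N lam N (Delta_id N) (cut 1 c) = lam"
    by (rule extensionalityI[of _ "{..N}"])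
      (use Delta_ext[OF shapeD(1)[OF s(1)]] in \<open>auto simp: op_lam_def cut_def Delta_id_def\<close>)
  have 2: "op_chain N lam \<xi> N (Delta_id N) (cut 1 c) = \<xi>"
    by (rule extensionalityI[of _ "{..N}"])
      (use shapeD(2)[OF s(1)] l0 in \<open>auto simp: op_chain_def cut_def Delta_id_def Let_def\<close>)
  have "res N \<xi> (op_map N lam \<xi> (Delta_id N) (cut 1 c)) \<Theta> = \<Theta>"
    by (rule res_id[OF s(2)]) (use l0 in \<open>auto simp: op_map_def V_poset_def cut_def Delta_id_def\<close>)
  then show ?thesis unfolding cyl_op_def prod.case 1 2 by simp
qed

end

section \<open>Products with parameters and the extension of sections over the cylinder\<close>

lemma simps_prod [simp]: "simps (sset_prod X Y) m = simps X m \<times> simps Y m"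
  and pull_prod [simp]: "pull (sset_prod X Y) k m \<alpha> (x, y) = (pull X k m \<alpha> x, pull Y k m \<alpha> y)"
  by (simp_all add: sset_prod_def)

lemma sset_prod_sset:
  assumes "simplicial_set X" "simplicial_set Y"
  shows "simplicial_set (sset_prod X Y)"
  by (rule simplicial_setI)
    (use assms in \<open>auto simp: sset_pull_in sset_pull_id sset_pull_comp\<close>)

lemma simplex_sset: "simplicial_set (simplex n)"
  by (rule simplicial_setI)
    (auto simp: Delta_compose compose_Delta_assoc intro: compose_Delta_id_right Delta_ext)

context chains
begin

text \<open>The structure map of the cylinder over \<C>. It agrees with \<open>pF\<close> on the
  chains and is a retraction onto \<C>.\<close>

definition proj where
  "proj m = (\<lambda>k\<in>simps cyl m. case k of (lam, \<xi>, \<Theta>) \<Rightarrow> \<Theta> m (\<lambda>i\<in>{..m}. (i, hd (\<xi> i))))"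

lemma proj_apply: "(lam, \<xi>, \<Theta>) \<in> simps cyl m \<Longrightarrow> proj m (lam, \<xi>, \<Theta>) = \<Theta> m (\<lambda>i\<in>{..m}. (i, hd (\<xi> i)))"
  by (simp add: proj_def)

lemma hd_chain:
  assumes s: "shape m lam \<xi>"
  shows "(\<lambda>i\<in>{..m}. (i, hd (\<xi> i))) \<in> simps (NV m \<xi>) m"
proof -
  have "(hd (\<xi> i), hd (\<xi> j)) \<in> r" if "i \<le> j" "j \<le> m" for i j
    using shapeD(5)[OF s that] shapeD(6)[OF s that] sd_hd[OF shapeD(3)[OF s, of i]]
      sd_hd_in[OF shapeD(3)[OF s, of j]] that by (cases "lam i = 0") auto
  then show ?thesis
    using sd_hd_in[OF shapeD(3)[OF s]] by (auto simp: simps_nerve V_poset_def V_le_def)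
qed

lemma proj_hom: "proj \<in> sset_hom cyl C"
proof (rule sset_homI)
  show "proj m \<in> extensional (simps cyl m)" for m by (simp add: proj_def)
next
  fix m k assume k: "k \<in> simps cyl m"
  obtain lam \<xi> \<Theta> where [simp]: "k = (lam, \<xi>, \<Theta>)" by (cases k)
  have s: "shape m lam \<xi>" "over m \<xi> \<Theta>" using k by (auto simp: simps_cyl)
  show "proj m k \<in> simps C m"
    using k s(2) sset_hom_in[OF _ hd_chain[OF s(1)]] by (auto simp: proj_apply over_def)
next
  fix l m \<alpha> k assume a: "\<alpha> \<in> Delta l m" and k: "k \<in> simps cyl m"
  obtain lam \<xi> \<Theta> where kk [simp]: "k = (lam, \<xi>, \<Theta>)" by (cases k)
  have s: "shape m lam \<xi>" "over m \<xi> \<Theta>" using k by (auto simp: simps_cyl)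
  have Th: "\<Theta> \<in> sset_hom (NV m \<xi>) C" using s(2) by (simp add: over_def)
  let ?h = "\<lambda>i\<in>{..m}. (i, hd (\<xi> i))"
  have k': "pull cyl l m \<alpha> k \<in> simps cyl l" by (rule sset_pull_in[OF cyl_sset a k])
  have "compose {..l} (\<lambda>(i, x). (\<alpha> i, x)) (\<lambda>i\<in>{..l}. (i, hd (compose {..l} \<xi> \<alpha> i))) = compose {..l} ?h \<alpha>"
    using Delta_le[OF a] by (auto simp: compose_def restrict_def fun_eq_iff)
  then show "proj l (pull cyl l m \<alpha> k) = pull C l m \<alpha> (proj m k)"
    using k k' res_apply[OF hd_chain[OF shape_pull[OF s(1) a]], of "\<lambda>(i, x). (\<alpha> i, x)" \<Theta>]
      sset_hom_pull[OF Th a hd_chain[OF s(1)]]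
    by (simp add: pull_cyl proj_apply)
qed

text \<open>The operators act on the parameter only through \<alpha>, so each law splits into a law
  of the cylinder and functoriality of \<open>Y\<close>.\<close>

lemma cyl_cut_operators:
  assumes Y: "simplicial_set Y" and Y0: "\<And>n y. (n, y) \<in> Y0 \<Longrightarrow> y \<in> simps Y n"
    "\<And>m n y \<alpha>. (n, y) \<in> Y0 \<Longrightarrow> \<alpha> \<in> Delta m n \<Longrightarrow> (m, pull Y m n \<alpha> y) \<in> Y0"
  shows "cut_operators (sset_prod cyl Y) (\<lambda>N b. cnt N (fst (fst b)))
    (\<lambda>N b L \<alpha> \<mu>. (cyl_op N (fst b) L \<alpha> \<mu>, pull Y L N \<alpha> (snd b)))
    {(N, b). b \<in> simps (sset_prod cyl Y) N \<and> (N, snd b) \<in> Y0}"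
proof (unfold_locales, goal_cases)
  case 1 show ?case by (rule sset_prod_sset[OF cyl_sset Y])
next
  case 2 show ?case by (rule cnt_le)
next
  case (3 k N \<alpha> L j)
  obtain lam \<xi> \<Theta> y where [simp]: "k = ((lam, \<xi>, \<Theta>), y)" by (metis prod.exhaust)
  have l: "lam \<in> Delta N 1" using 3 by (auto simp: simps_cyl shape_def)
  show ?case
    using less_cnt[OF l Delta_le[OF 3(2,3)]] less_cnt[OF Delta_compose[OF 3(2) l] 3(3)] 3(3)
    by (simp add: pull_cyl compose_def)
next
  case (4 k N \<alpha> L t c)
  obtain lam \<xi> \<Theta> y where [simp]: "k = ((lam, \<xi>, \<Theta>), y)" by (metis prod.exhaust)
  show ?case using 4 cyl_op_in[of lam \<xi> \<Theta> N \<alpha> L t c] sset_pull_in[OF Y 4(3), of y] by auto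
next
  case (5 k N \<alpha> L t j c)
  obtain lam \<xi> \<Theta> y where [simp]: "k = ((lam, \<xi>, \<Theta>), y)" by (metis prod.exhaust)
  have s: "shape N lam \<xi>" using 5 by (auto simp: simps_cyl)
  have "shape L (op_lam N lam L \<alpha> (cut t c)) (op_chain N lam \<xi> L \<alpha> (cut t c))"
    by (rule op_shape[OF s _ 5(3,4)]) (use 5 in simp)
  note l = less_cnt[OF shapeD(1)[OF this] 5(5)]
  show ?case
    using l less_cnt[OF shapeD(1)[OF s] Delta_le[OF 5(3,5)]] 5(4,5)
    by (auto simp: cyl_op_def op_lam_def cut_def)
next
  case (6 L \<mu> \<mu>' N k \<alpha>)
  then show ?case using cyl_op_cong[of L \<mu> \<mu>'] by simp
next
  case (7 k N \<alpha> M t \<delta> L c)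
  obtain lam \<xi> \<Theta> y where [simp]: "k = ((lam, \<xi>, \<Theta>), y)" by (metis prod.exhaust)
  show ?case
    using pull_cyl_op[of lam \<xi> \<Theta> N \<alpha> M t \<delta> L c] sset_pull_comp[OF Y 7(5,3), of y] 7 by auto
next
  case (8 k N \<kappa> M \<alpha> L t c)
  obtain lam \<xi> \<Theta> y where [simp]: "k = ((lam, \<xi>, \<Theta>), y)" by (metis prod.exhaust)
  show ?case
    using cyl_op_pull[of lam \<xi> \<Theta> N \<kappa> M \<alpha> L t c] sset_pull_comp[OF Y 8(5,2), of y] 8
    by (auto simp: pull_cyl last_ix_def)
next
  case (9 k N \<alpha> M t c \<beta> L t' c')
  obtain lam \<xi> \<Theta> y where [simp]: "k = ((lam, \<xi>, \<Theta>), y)" by (metis prod.exhaust)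
  show ?case
    using cyl_op_op[of lam \<xi> \<Theta> N \<alpha> M t c \<beta> L t' c'] sset_pull_comp[OF Y 9(7,3), of y] 9
    by (auto simp: cyl_op_def last_ix_def)
next
  case (10 k N c)
  obtain lam \<xi> \<Theta> y where [simp]: "k = ((lam, \<xi>, \<Theta>), y)" by (metis prod.exhaust)
  show ?case using cyl_op_keep[of lam \<xi> \<Theta> N c] sset_pull_id[OF Y, of y N] 10 by auto
next
  case 11 then show ?case by auto
next
  case (12 N k \<alpha> L)
  then show ?case using sset_pull_in[OF cyl_sset 12(2)] sset_pull_in[OF Y 12(2)] Y0 by (cases k) auto
next
  case (13 N k \<alpha> L t c)
  obtain lam \<xi> \<Theta> y where [simp]: "k = ((lam, \<xi>, \<Theta>), y)" by (metis prod.exhaust)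
  show ?case using 13 cyl_op_in[of lam \<xi> \<Theta> N \<alpha> L t c] sset_pull_in[OF Y 13(3), of y] Y0 by auto
qed

text \<open>The section is prescribed over the chains for all parameters and over the whole cylinder
  for parameters in \<open>Y0\<close>. The condition \<open>fst k 0 = 1\<close> singles out the
  simplices without vertices in \<C>, since \<open>lam\<close> is monotone.\<close>

lemma cyl_extend:
  assumes rf: "right_fibration X C f"
    and Y: "simplicial_set Y" and Y0: "\<And>n y. (n, y) \<in> Y0 \<Longrightarrow> y \<in> simps Y n"
    "\<And>m n y \<alpha>. (n, y) \<in> Y0 \<Longrightarrow> \<alpha> \<in> Delta m n \<Longrightarrow> (m, pull Y m n \<alpha> y) \<in> Y0"
    and u: "\<And>n k y. k \<in> simps cyl n \<Longrightarrow> y \<in> simps Y n \<Longrightarrow> fst k 0 = 1 \<or> (n, y) \<in> Y0 \<Longrightarrow> u n (k, y) \<in> simps X n"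
    "\<And>n k y. k \<in> simps cyl n \<Longrightarrow> y \<in> simps Y n \<Longrightarrow> fst k 0 = 1 \<or> (n, y) \<in> Y0 \<Longrightarrow> f n (u n (k, y)) = proj n k"
    "\<And>m n k y \<alpha>. k \<in> simps cyl n \<Longrightarrow> y \<in> simps Y n \<Longrightarrow> fst k 0 = 1 \<or> (n, y) \<in> Y0 \<Longrightarrow> \<alpha> \<in> Delta m n \<Longrightarrow>
      u m (pull cyl m n \<alpha> k, pull Y m n \<alpha> y) = pull X m n \<alpha> (u n (k, y))"
  obtains w where "w \<in> sset_hom (sset_prod cyl Y) X"
    "\<And>n k y. k \<in> simps cyl n \<Longrightarrow> y \<in> simps Y n \<Longrightarrow> fst k 0 = 1 \<or> (n, y) \<in> Y0 \<Longrightarrow> w n (k, y) = u n (k, y)"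
    "\<And>n k y. k \<in> simps cyl n \<Longrightarrow> y \<in> simps Y n \<Longrightarrow> f n (w n (k, y)) = proj n k"
proof -
  interpret cut_operators "sset_prod cyl Y" "\<lambda>N b. cnt N (fst (fst b))"
    "\<lambda>N b L \<alpha> \<mu>. (cyl_op N (fst b) L \<alpha> \<mu>, pull Y L N \<alpha> (snd b))"
    "{(N, b). b \<in> simps (sset_prod cyl Y) N \<and> (N, snd b) \<in> Y0}"
    by (rule cyl_cut_operators[OF Y Y0])
  have A0: "(n, (k, y)) \<in> A0 \<longleftrightarrow> k \<in> simps cyl n \<and> y \<in> simps Y n \<and> (fst k 0 = 1 \<or> (n, y) \<in> Y0)" for n k y
  proof -
    obtain lam \<xi> \<Theta> where k: "k = (lam, \<xi>, \<Theta>)" by (cases k)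
    have "cnt n lam = 0 \<longleftrightarrow> lam 0 = 1" if "k \<in> simps cyl n"
    proof -
      have s: "shape n lam \<xi>" using that by (simp add: k simps_cyl)
      show ?thesis using less_cnt[OF shapeD(1)[OF s], of 0] lam_cases[OF s, of 0] by auto
    qed
    then show ?thesis unfolding A0_def k by auto
  qed
  define v where "v n = (\<lambda>b\<in>simps (sset_prod cyl Y) n. proj n (fst b))" for n
  have v: "v \<in> sset_hom (sset_prod cyl Y) C"
  proof (rule sset_homI)
    fix k m \<alpha> b assume a: "\<alpha> \<in> Delta k m" and "b \<in> simps (sset_prod cyl Y) m"
    then obtain x y where "b = (x, y)" "x \<in> simps cyl m" "y \<in> simps Y m" by auto
    then show "v k (pull (sset_prod cyl Y) k m \<alpha> b) = pull C k m \<alpha> (v m b)"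
      using sset_hom_pull[OF proj_hom a] sset_pull_in[OF cyl_sset a] sset_pull_in[OF Y a] by (simp add: v_def)
  next
    show "v m b \<in> simps C m" if "b \<in> simps (sset_prod cyl Y) m" for m b
      using sset_hom_in[OF proj_hom, of "fst b" m] that by (auto simp: v_def)
  qed (simp add: v_def)
  obtain w where w: "w \<in> sset_hom (sset_prod cyl Y) X" "\<And>n b. (n, b) \<in> A0 \<Longrightarrow> w n b = u n b"
    "\<And>n b. b \<in> simps (sset_prod cyl Y) n \<Longrightarrow> f n (w n b) = v n b"
  proof (rule extend[OF rf v])
    fix n b assume b: "(n, b) \<in> A0"
    obtain k y where [simp]: "b = (k, y)" by (cases b)
    note b' = b[simplified A0 \<open>b = (k, y)\<close>]
    show "u n b \<in> simps X n" using u(1) b' by simp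
    show "f n (u n b) = v n b" using u(2) b' by (simp add: v_def)
    show "u m (pull (sset_prod cyl Y) m n \<alpha> b) = pull X m n \<alpha> (u n b)" if "\<alpha> \<in> Delta m n" for m \<alpha>
      using u(3) b' that by simp
  qed (rule that)
  show thesis
  proof
    show "w \<in> sset_hom (sset_prod cyl Y) X" by (rule w(1))
    show "w n (k, y) = u n (k, y)"
      if "k \<in> simps cyl n" "y \<in> simps Y n" "fst k 0 = 1 \<or> (n, y) \<in> Y0" for n k y
      using w(2) A0 that by blast
    show "f n (w n (k, y)) = proj n k" if "k \<in> simps cyl n" "y \<in> simps Y n" for n k y
      using w(3)[of "(k, y)" n] that by (simp add: v_def)
  qed
qed

end

section \<open>Simplicial sets of maps over a base\<close>

lemma simps_map_over: "h \<in> simps (map_over S p X f) n \<longleftrightarrow> h \<in> sset_hom (sset_prod S (simplex n)) X \<and>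
    (\<forall>m. \<forall>s\<in>simps S m. \<forall>\<beta>\<in>Delta m n. f m (h m (s, \<beta>)) = p m s)"
  by (simp add: map_over_def)

lemma pull_map_over: "s \<in> simps S m \<Longrightarrow> \<beta> \<in> Delta m k \<Longrightarrow>
    pull (map_over S p X f) k n \<alpha> h m (s, \<beta>) = h m (s, compose {..m} \<alpha> \<beta>)"
  by (simp add: map_over_def)

lemma map_over_eqI:
  assumes "h \<in> simps (map_over S p X f) n" "h' \<in> simps (map_over S p X f) n"
    "\<And>m s \<beta>. s \<in> simps S m \<Longrightarrow> \<beta> \<in> Delta m n \<Longrightarrow> h m (s, \<beta>) = h' m (s, \<beta>)"
  shows "h = h'"
  by (rule sset_hom_eqI[of h "sset_prod S (simplex n)" X h' X]) (use assms in \<open>auto simp: simps_map_over\<close>)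

lemma map_over_sset:
  assumes S: "simplicial_set S"
  shows "simplicial_set (map_over S p X f)"
proof (rule simplicial_setI)
  let ?M = "map_over S p X f"
  show in': "pull ?M k n \<alpha> h \<in> simps ?M k" if a: "\<alpha> \<in> Delta k n" and h: "h \<in> simps ?M n" for k n \<alpha> h
  proof -
    have hh: "h \<in> sset_hom (sset_prod S (simplex n)) X"
      "\<And>m s \<beta>. s \<in> simps S m \<Longrightarrow> \<beta> \<in> Delta m n \<Longrightarrow> f m (h m (s, \<beta>)) = p m s"
      using h by (auto simp: simps_map_over)
    have c: "compose {..m} \<alpha> \<beta> \<in> Delta m n" if "\<beta> \<in> Delta m k" for m \<beta> using Delta_compose[OF that a] .
    have "pull ?M k n \<alpha> h \<in> sset_hom (sset_prod S (simplex k)) X"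
    proof (rule sset_homI)
      show "pull ?M k n \<alpha> h m \<in> extensional (simps (sset_prod S (simplex k)) m)" for m
        by (simp add: map_over_def)
    next
      fix m x assume "x \<in> simps (sset_prod S (simplex k)) m"
      then obtain s \<beta> where x: "x = (s, \<beta>)" "s \<in> simps S m" "\<beta> \<in> Delta m k" by auto
      then show "pull ?M k n \<alpha> h m x \<in> simps X m"
        using sset_hom_in[OF hh(1), of "(s, compose {..m} \<alpha> \<beta>)" m] c by (simp add: pull_map_over)
    next
      fix l m \<delta> x assume d: "\<delta> \<in> Delta l m" and "x \<in> simps (sset_prod S (simplex k)) m"
      then obtain s \<beta> where x: "x = (s, \<beta>)" "s \<in> simps S m" "\<beta> \<in> Delta m k" by auto
      then show "pull ?M k n \<alpha> h l (pull (sset_prod S (simplex k)) l m \<delta> x) = pull X l m \<delta> (pull ?M k n \<alpha> h m x)"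
        using sset_hom_pull[OF hh(1) d, of "(s, compose {..m} \<alpha> \<beta>)"] c sset_pull_in[OF S d] Delta_compose[OF d]
          compose_Delta_assoc[OF d, of \<alpha> \<beta>]
        by (simp add: pull_map_over)
    qed
    then show ?thesis using hh(2) c by (simp add: simps_map_over pull_map_over)
  qed
  show "pull ?M n n (Delta_id n) h = h" if h: "h \<in> simps ?M n" for n h
    by (rule map_over_eqI[OF in'[OF Delta_id_in h] h]) (simp add: pull_map_over compose_Delta_id_left)
  show "pull ?M k m (compose {..k} \<beta> \<alpha>) h = pull ?M k l \<alpha> (pull ?M l m \<beta> h)"
    if a: "\<alpha> \<in> Delta k l" and b: "\<beta> \<in> Delta l m" and h: "h \<in> simps ?M m" for k l m \<alpha> \<beta> h
    by (rule map_over_eqI[OF in'[OF Delta_compose[OF a b] h] in'[OF a in'[OF b h]]])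
      (simp add: pull_map_over Delta_compose[OF _ a] compose_Delta_assoc)
qed

text \<open>The universal family parametrized by the mapping space itself. Evaluation at the
  identity of the simplex suffices, because other values arise from pulling \<open>h\<close> back
  first.\<close>

definition map_eval :: "nat \<Rightarrow> 's \<times> (nat \<Rightarrow> 's \<times> (nat \<Rightarrow> nat) \<Rightarrow> 'x) \<Rightarrow> 'x" where
  "map_eval m = (\<lambda>(s, h). h m (s, Delta_id m))"

definition map_transpose ::
    "'s sset \<Rightarrow> 'y sset \<Rightarrow> (nat \<Rightarrow> 's \<times> 'y \<Rightarrow> 'x) \<Rightarrow> nat \<Rightarrow> 'y \<Rightarrow> nat \<Rightarrow> 's \<times> (nat \<Rightarrow> nat) \<Rightarrow> 'x" where
  "map_transpose S Y W n = (\<lambda>y\<in>simps Y n. \<lambda>m. \<lambda>(s, \<beta>)\<in>simps S m \<times> Delta m n. W m (s, pull Y m n \<beta> y))"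

lemma map_transpose_apply: "y \<in> simps Y n \<Longrightarrow> s \<in> simps S m \<Longrightarrow> \<beta> \<in> Delta m n \<Longrightarrow>
    map_transpose S Y W n y m (s, \<beta>) = W m (s, pull Y m n \<beta> y)"
  by (simp add: map_transpose_def)

text \<open>A simplicial map from the product to \<open>X\<close> over the base, with no condition
  on its values outside the simplices, so that a family may be given by a plain lambda term.\<close>

definition family_over ::
    "'s sset \<Rightarrow> (nat \<Rightarrow> 's \<Rightarrow> 't) \<Rightarrow> 'x sset \<Rightarrow> (nat \<Rightarrow> 'x \<Rightarrow> 't) \<Rightarrow> 'y sset \<Rightarrow> (nat \<Rightarrow> 's \<times> 'y \<Rightarrow> 'x) \<Rightarrow> bool" where
  "family_over S p X f Y W \<longleftrightarrow> (\<forall>m. \<forall>s\<in>simps S m. \<forall>y\<in>simps Y m. W m (s, y) \<in> simps X m \<and> f m (W m (s, y)) = p m s \<and>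
     (\<forall>k. \<forall>\<alpha>\<in>Delta k m. W k (pull S k m \<alpha> s, pull Y k m \<alpha> y) = pull X k m \<alpha> (W m (s, y))))"

lemma family_overI:
  assumes "\<And>m s y. s \<in> simps S m \<Longrightarrow> y \<in> simps Y m \<Longrightarrow> W m (s, y) \<in> simps X m"
    "\<And>m s y. s \<in> simps S m \<Longrightarrow> y \<in> simps Y m \<Longrightarrow> f m (W m (s, y)) = p m s"
    "\<And>k m s y \<alpha>. \<alpha> \<in> Delta k m \<Longrightarrow> s \<in> simps S m \<Longrightarrow> y \<in> simps Y m \<Longrightarrow>
      W k (pull S k m \<alpha> s, pull Y k m \<alpha> y) = pull X k m \<alpha> (W m (s, y))"
  shows "family_over S p X f Y W"
  using assms unfolding family_over_def by blast

text \<open>Half of the exponential law: maps into the mapping space are built from families, which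
  spares a separate verification of simpliciality each time.\<close>

lemma map_transpose_hom:
  assumes S: "simplicial_set S" and Y: "simplicial_set Y" and W: "family_over S p X f Y W"
  shows "map_transpose S Y W \<in> sset_hom Y (map_over S p X f)"
proof (rule sset_homI)
  show "map_transpose S Y W m \<in> extensional (simps Y m)" for m by (simp add: map_transpose_def)
next
  show in': "map_transpose S Y W n y \<in> simps (map_over S p X f) n" if y: "y \<in> simps Y n" for n y
  proof -
    have W': "W m (s, pull Y m n \<beta> y) \<in> simps X m" "f m (W m (s, pull Y m n \<beta> y)) = p m s"
      "\<And>k \<alpha>. \<alpha> \<in> Delta k m \<Longrightarrow> W k (pull S k m \<alpha> s, pull Y k m \<alpha> (pull Y m n \<beta> y)) = pull X k m \<alpha> (W m (s, pull Y m n \<beta> y))"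
      if "s \<in> simps S m" "\<beta> \<in> Delta m n" for m s \<beta>
      using W that sset_pull_in[OF Y that(2) y] unfolding family_over_def by blast+
    have "map_transpose S Y W n y \<in> sset_hom (sset_prod S (simplex n)) X"
    proof (rule sset_homI)
      show "map_transpose S Y W n y m \<in> extensional (simps (sset_prod S (simplex n)) m)" for m
        using y by (simp add: map_transpose_def)
      show "map_transpose S Y W n y m x \<in> simps X m" if "x \<in> simps (sset_prod S (simplex n)) m" for m x
        using that y W' by (auto simp: map_transpose_def)
      fix k m \<alpha> x assume a: "\<alpha> \<in> Delta k m" and "x \<in> simps (sset_prod S (simplex n)) m"
      then obtain s \<beta> where x: "x = (s, \<beta>)" "s \<in> simps S m" "\<beta> \<in> Delta m n" by auto
      then show "map_transpose S Y W n y k (pull (sset_prod S (simplex n)) k m \<alpha> x) =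
          pull X k m \<alpha> (map_transpose S Y W n y m x)"
        using W'(3)[OF x(2,3) a] sset_pull_in[OF S a] Delta_compose[OF a] sset_pull_comp[OF Y a x(3) y] y
        by (simp add: map_transpose_apply)
    qed
    then show ?thesis using W' y by (simp add: simps_map_over map_transpose_apply)
  qed
  fix k n \<alpha> y assume a: "\<alpha> \<in> Delta k n" and y: "y \<in> simps Y n"
  show "map_transpose S Y W k (pull Y k n \<alpha> y) = pull (map_over S p X f) k n \<alpha> (map_transpose S Y W n y)"
  proof (rule map_over_eqI[OF in'[OF sset_pull_in[OF Y a y]] sset_pull_in[OF map_over_sset[OF S] a in'[OF y]]])
    fix m s \<beta> assume "s \<in> simps S m" "\<beta> \<in> Delta m k"
    then show "map_transpose S Y W k (pull Y k n \<alpha> y) m (s, \<beta>) =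
        pull (map_over S p X f) k n \<alpha> (map_transpose S Y W n y) m (s, \<beta>)"
      using y sset_pull_in[OF Y a y] Delta_compose[OF _ a] sset_pull_comp[OF Y _ a y]
      by (simp add: map_transpose_apply pull_map_over)
  qed
qed

lemma map_eval_pull:
  assumes "s \<in> simps S m" "\<beta> \<in> Delta m n"
  shows "map_eval m (s, pull (map_over S p X f) m n \<beta> h) = h m (s, \<beta>)"
  using assms by (simp add: map_eval_def pull_map_over Delta_id_in compose_Delta_id_right Delta_ext)

lemma map_eval_family:
  assumes S: "simplicial_set S"
  shows "family_over S p X f (map_over S p X f) map_eval"
proof (rule family_overI)
  fix m s h assume s: "s \<in> simps S m" and h: "h \<in> simps (map_over S p X f) m"
  have hh: "h \<in> sset_hom (sset_prod S (simplex m)) X"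
    "\<And>l s \<beta>. s \<in> simps S l \<Longrightarrow> \<beta> \<in> Delta l m \<Longrightarrow> f l (h l (s, \<beta>)) = p l s"
    using h by (auto simp: simps_map_over)
  have sp: "(s, Delta_id m) \<in> simps (sset_prod S (simplex m)) m" using s Delta_id_in by simp
  show "map_eval m (s, h) \<in> simps X m" using sset_hom_in[OF hh(1) sp] by (simp add: map_eval_def)
  show "f m (map_eval m (s, h)) = p m s" using hh(2)[OF s Delta_id_in] by (simp add: map_eval_def)
  show "map_eval k (pull S k m \<alpha> s, pull (map_over S p X f) k m \<alpha> h) = pull X k m \<alpha> (map_eval m (s, h))"
    if a: "\<alpha> \<in> Delta k m" for k \<alpha>
    using sset_hom_pull[OF hh(1) a sp] map_eval_pull[OF sset_pull_in[OF S a s] a, of p X f h]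
    by (simp add: map_eval_def compose_Delta_id_left[OF a])
qed

lemma const_in_Delta: "c \<le> n \<Longrightarrow> (\<lambda>i\<in>{..m}. c) \<in> Delta m n"
  by (rule DeltaI) auto

lemma compose_const: "\<alpha> \<in> Delta k m \<Longrightarrow> compose {..k} (\<lambda>i\<in>{..m}. c) \<alpha> = (\<lambda>i\<in>{..k}. c)"
  using Delta_le by (fastforce simp: compose_def restrict_def fun_eq_iff)

section \<open>Chains, the cylinder, and \<open>\<C>\<close>\<close>

context chains
begin

definition incl where "incl m z = (\<lambda>i\<in>{..m}. 1::nat, z)"

lemma incl_in: "incl m z \<in> simps cyl m \<longleftrightarrow> z \<in> simps (CF C P r F) m"
  by (cases z) (simp add: incl_def CF_cyl)

lemma incl_pull: "\<alpha> \<in> Delta k m \<Longrightarrow> pull cyl k m \<alpha> (incl m z) = incl k (pull (CF C P r F) k m \<alpha> z)"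
  by (simp add: incl_def cyl_def compose_const)

lemma incl_inj: "incl m z = incl m z' \<Longrightarrow> z = z'"
  by (simp add: incl_def)

text \<open>The laws are inherited from the cylinder along the injective
  \<open>incl\<close>.\<close>

lemma CF_sset: "simplicial_set (CF C P r F)"
proof (rule simplicial_setI)
  fix k m \<alpha> z assume a: "\<alpha> \<in> Delta k m" and z: "z \<in> simps (CF C P r F) m"
  show "pull (CF C P r F) k m \<alpha> z \<in> simps (CF C P r F) k"
    using sset_pull_in[OF cyl_sset a] z incl_pull[OF a] incl_in by metis
next
  fix m z assume z: "z \<in> simps (CF C P r F) m"
  show "pull (CF C P r F) m m (Delta_id m) z = z"
    by (rule incl_inj[of m]) (use z sset_pull_id[OF cyl_sset] incl_pull[OF Delta_id_in] incl_in in metis)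
next
  fix k l m \<alpha> \<beta> z assume a: "\<alpha> \<in> Delta k l" and b: "\<beta> \<in> Delta l m" and z: "z \<in> simps (CF C P r F) m"
  show "pull (CF C P r F) k m (compose {..k} \<beta> \<alpha>) z = pull (CF C P r F) k l \<alpha> (pull (CF C P r F) l m \<beta> z)"
    by (rule incl_inj[of k])
      (use z sset_pull_comp[OF cyl_sset a b] incl_pull[OF Delta_compose[OF a b]] incl_pull[OF a] incl_pull[OF b]
        incl_in in metis)
qed

lemma incl_cases:
  assumes "k \<in> simps cyl m" "fst k 0 = 1"
  obtains z where "k = incl m z" "z \<in> simps (CF C P r F) m"
proof -
  obtain lam \<xi> \<Theta> where k: "k = (lam, \<xi>, \<Theta>)" by (cases k)
  have l: "lam \<in> Delta m 1" using assms by (simp add: k simps_cyl shape_def)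
  have "lam = (\<lambda>i\<in>{..m}. 1)"
  proof (rule Delta_eqI[OF l const_in_Delta[of 1 1 m]])
    fix i assume "i \<le> m"
    then show "lam i = (\<lambda>i\<in>{..m}. 1) i"
      using Delta_le[OF l, of i] Delta_mono[OF l, of 0 i] assms by (simp add: k)
  qed simp
  then have "k = incl m (\<xi>, \<Theta>)" by (simp add: k incl_def)
  then show thesis using that assms incl_in by metis
qed

lemma pF_proj: "z \<in> simps (CF C P r F) m \<Longrightarrow> pF C P r F m z = proj m (incl m z)"
  using incl_in[of m z] by (cases z) (simp add: pF_def incl_def proj_apply)

lemma pF_hom: "pF C P r F \<in> sset_hom (CF C P r F) C"
proof (rule sset_homI)
  show "pF C P r F m \<in> extensional (simps (CF C P r F) m)" for m by (simp add: pF_def)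
  show "pF C P r F m z \<in> simps C m" if "z \<in> simps (CF C P r F) m" for m z
    using that sset_hom_in[OF proj_hom] by (simp add: pF_proj incl_in)
  show "pF C P r F k (pull (CF C P r F) k m \<alpha> z) = pull C k m \<alpha> (pF C P r F m z)"
    if a: "\<alpha> \<in> Delta k m" and z: "z \<in> simps (CF C P r F) m" for k m \<alpha> z
    using z sset_hom_pull[OF proj_hom a, of "incl m z"] sset_pull_in[OF CF_sset a z]
    by (simp add: pF_proj incl_in incl_pull[OF a])
qed

text \<open>The embedding of \<C>. For one-element chains \<open>fst\<close> identifies the poset
  with \<open>[m]\<close>, so maps from its nerve correspond to \<open>m\<close>-simplices.\<close>

definition jmap where
  "jmap m c = (\<lambda>i\<in>{..m}. 0 :: nat, \<lambda>i\<in>{..m}. [F m c i],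
     \<lambda>l. \<lambda>\<kappa>\<in>simps (NV m (\<lambda>i\<in>{..m}. [F m c i])) l. pull C l m (compose {..l} fst \<kappa>) c)"

lemma V_fst_in: "\<kappa> \<in> simps (NV m \<xi>) l \<Longrightarrow> compose {..l} fst \<kappa> \<in> Delta l m"
  unfolding simps_nerve by (rule DeltaI) (fastforce simp: compose_def V_poset_def V_le_def)+

lemma F_simps:
  assumes "c \<in> simps C m"
  shows "i \<le> m \<Longrightarrow> F m c i \<in> P" "i \<le> j \<Longrightarrow> j \<le> m \<Longrightarrow> (F m c i, F m c j) \<in> r"
  using sset_hom_in[OF F assms] by (auto simp: simps_nerve)

lemma jmap_in:
  assumes c: "c \<in> simps C m"
  shows "jmap m c \<in> simps cyl m"
proof -
  let ?\<xi> = "\<lambda>i\<in>{..m}. [F m c i]"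
  let ?\<Theta> = "\<lambda>l. \<lambda>\<kappa>\<in>simps (NV m ?\<xi>) l. pull C l m (compose {..l} fst \<kappa>) c"
  have "shape m (\<lambda>i\<in>{..m}. 0) ?\<xi>"
    by (rule shapeI) (use F_simps[OF c] in \<open>auto simp: sd_single intro: const_in_Delta\<close>)
  moreover have "?\<Theta> \<in> sset_hom (NV m ?\<xi>) C"
  proof (rule sset_homI)
    fix k l \<alpha> \<kappa> assume a: "\<alpha> \<in> Delta k l" and k: "\<kappa> \<in> simps (NV m ?\<xi>) l"
    show "?\<Theta> k (pull (NV m ?\<xi>) k l \<alpha> \<kappa>) = pull C k l \<alpha> (?\<Theta> l \<kappa>)"
      using sset_pull_comp[OF C a V_fst_in[OF k] c] nerve_pull_in[OF a k] k compose_Delta_assoc[OF a, of fst \<kappa>]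
      by simp
  qed (use sset_pull_in[OF C V_fst_in c] in auto)
  moreover have "F l (?\<Theta> l \<kappa>) = compose {..l} snd \<kappa>" if k: "\<kappa> \<in> simps (NV m ?\<xi>) l" for l \<kappa>
  proof -
    have "F l (?\<Theta> l \<kappa>) = compose {..l} (F m c) (compose {..l} fst \<kappa>)"
      using sset_hom_pull[OF F V_fst_in[OF k] c] k by simp
    also have "\<dots> = compose {..l} snd \<kappa>"
      using k unfolding simps_nerve by (fastforce simp: compose_def restrict_def fun_eq_iff V_poset_def)
    finally show ?thesis .
  qed
  ultimately show ?thesis by (simp add: jmap_def simps_cyl over_def)
qed

lemma jmap_proj:
  assumes c: "c \<in> simps C m"
  shows "proj m (jmap m c) = c"
proof -
  let ?\<xi> = "\<lambda>i\<in>{..m}. [F m c i]"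
  have s: "shape m (\<lambda>i\<in>{..m}. 0) ?\<xi>" using jmap_in[OF c] by (simp add: jmap_def simps_cyl)
  have "compose {..m} fst (\<lambda>i\<in>{..m}. (i, hd (?\<xi> i))) = Delta_id m"
    by (auto simp: compose_def Delta_id_def restrict_def fun_eq_iff)
  then show ?thesis
    using hd_chain[OF s] jmap_in[OF c] sset_pull_id[OF C c] by (simp add: jmap_def proj_apply)
qed

lemma jmap_pull:
  assumes a: "\<alpha> \<in> Delta k m" and c: "c \<in> simps C m"
  shows "pull cyl k m \<alpha> (jmap m c) = jmap k (pull C k m \<alpha> c)"
proof -
  let ?\<xi> = "\<lambda>i\<in>{..m}. [F m c i]"
  have 1: "compose {..k} ?\<xi> \<alpha> = (\<lambda>i\<in>{..k}. [F k (pull C k m \<alpha> c) i])"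
    using sset_hom_pull[OF F a c] Delta_le[OF a] by (auto simp: compose_def restrict_def fun_eq_iff)
  let ?\<xi>' = "\<lambda>i\<in>{..k}. [F k (pull C k m \<alpha> c) i]"
  let ?\<Theta> = "\<lambda>l. \<lambda>\<kappa>\<in>simps (NV m ?\<xi>) l. pull C l m (compose {..l} fst \<kappa>) c"
  let ?\<Theta>' = "\<lambda>l. \<lambda>\<kappa>\<in>simps (NV k ?\<xi>') l. pull C l k (compose {..l} fst \<kappa>) (pull C k m \<alpha> c)"
  have "res k ?\<xi>' (\<lambda>(i, x). (\<alpha> i, x)) ?\<Theta> l = ?\<Theta>' l" for l
  proof (rule extensionalityI[OF res_ext])
    show "?\<Theta>' l \<in> extensional (simps (NV k ?\<xi>') l)" by simp
    fix \<kappa> assume k: "\<kappa> \<in> simps (NV k ?\<xi>') l"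
    have v: "compose {..l} (\<lambda>(i, x). (\<alpha> i, x)) \<kappa> \<in> simps (NV m ?\<xi>) l"
      using V_map_chain[OF V_map_pull[OF a, of ?\<xi>]] k by (simp add: 1)
    have "compose {..l} fst (compose {..l} (\<lambda>(i, x). (\<alpha> i, x)) \<kappa>) = compose {..l} \<alpha> (compose {..l} fst \<kappa>)"
      by (auto simp: compose_def restrict_def fun_eq_iff split: prod.splits)
    then show "res k ?\<xi>' (\<lambda>(i, x). (\<alpha> i, x)) ?\<Theta> l \<kappa> = ?\<Theta>' l \<kappa>"
      using res_apply[OF k, of "\<lambda>(i, x). (\<alpha> i, x)" ?\<Theta>] v k sset_pull_comp[OF C V_fst_in[OF k] a c] by simp
  qed
  then show ?thesis by (simp add: jmap_def pull_cyl 1 compose_const[OF a] fun_eq_iff)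
qed

section \<open>The transformation from the projection to the inclusion of the chains\<close>

definition flow_chain :: "nat \<Rightarrow> (nat \<Rightarrow> nat) \<Rightarrow> (nat \<Rightarrow> 'p list) \<Rightarrow> nat \<Rightarrow> 'p list" where
  "flow_chain m \<gamma> \<sigma> = (\<lambda>i\<in>{..m}. if \<gamma> i = 0 then [hd (\<sigma> i)] else \<sigma> i)"

text \<open>Where \<gamma> is 0 a chain is cut down to its head. The smaller poset lies inside the
  old one, so the map on it is merely restricted; at the two ends one gets \<open>jmap\<close> after
  \<open>pF\<close> and \<open>incl\<close>.\<close>

definition flow where
  "flow m = (\<lambda>((\<sigma>, \<Theta>), \<gamma>). (\<gamma>, flow_chain m \<gamma> \<sigma>, res m (flow_chain m \<gamma> \<sigma>) (\<lambda>v. v) \<Theta>))"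

lemma flow_facts:
  assumes z: "(\<sigma>, \<Theta>) \<in> simps (CF C P r F) m" and g: "\<gamma> \<in> Delta m 1"
  shows "V_map m (flow_chain m \<gamma> \<sigma>) m \<sigma> (\<lambda>v. v)" "shape m \<gamma> (flow_chain m \<gamma> \<sigma>)" "over m \<sigma> \<Theta>"
    "shape m (\<lambda>i\<in>{..m}. 1) \<sigma>"
proof -
  show s: "shape m (\<lambda>i\<in>{..m}. 1) \<sigma>" and "over m \<sigma> \<Theta>" using z by (auto simp: CF_cyl simps_cyl)
  have sd: "\<sigma> i \<in> sd P r" if "i \<le> m" for i using shapeD(3)[OF s that] .
  have sub: "x \<in> set (\<sigma> i)" if "i \<le> j" "j \<le> m" "x \<in> set (\<sigma> j)" for i j x
    using shapeD(6)[OF s that(1,2) _ that(3)] that by simp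
  have fsub: "x \<in> set (\<sigma> i)" if "i \<le> m" "x \<in> set (flow_chain m \<gamma> \<sigma> i)" for i x
    using that sd_hd_in[OF sd[OF that(1)]] by (auto simp: flow_chain_def split: if_splits)
  show "V_map m (flow_chain m \<gamma> \<sigma>) m \<sigma> (\<lambda>v. v)"
    using fsub by (auto simp: V_map_def V_poset_def)
  show "shape m \<gamma> (flow_chain m \<gamma> \<sigma>)"
  proof (rule shapeI[OF g])
    show "flow_chain m \<gamma> \<sigma> \<in> extensional {..m}" by (simp add: flow_chain_def)
    show "flow_chain m \<gamma> \<sigma> i \<in> sd P r" if "i \<le> m" for i
      using that sd[OF that] sd_single[OF sd_P[OF sd[OF that] sd_hd_in[OF sd[OF that]]]] by (simp add: flow_chain_def)
    show "flow_chain m \<gamma> \<sigma> i = [hd (flow_chain m \<gamma> \<sigma> i)]" if "i \<le> m" "\<gamma> i = 0" for i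
      using that by (simp add: flow_chain_def)
    show "(hd (flow_chain m \<gamma> \<sigma> i), x) \<in> r" if ij: "i \<le> j" "j \<le> m" "\<gamma> i = 0" "x \<in> set (flow_chain m \<gamma> \<sigma> j)" for i j x
      using sd_hd[OF sd, of i x] sub[OF ij(1,2) fsub[OF ij(2,4)]] ij by (simp add: flow_chain_def)
    show "x \<in> set (flow_chain m \<gamma> \<sigma> i)" if ij: "i \<le> j" "j \<le> m" "\<gamma> i \<noteq> 0" "x \<in> set (flow_chain m \<gamma> \<sigma> j)" for i j x
      using sub[OF ij(1,2) fsub[OF ij(2,4)]] ij by (simp add: flow_chain_def)
  qed
qed

lemma flow_in:
  assumes z: "z \<in> simps (CF C P r F) m" and g: "\<gamma> \<in> Delta m 1"
  shows "flow m (z, \<gamma>) \<in> simps cyl m"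
proof -
  obtain \<sigma> \<Theta> where zz: "z = (\<sigma>, \<Theta>)" by (cases z)
  note f = flow_facts[OF z[unfolded zz] g]
  show ?thesis using f(2) over_res[OF f(3,1)] by (simp add: zz flow_def simps_cyl)
qed

lemma flow_pull:
  assumes z: "z \<in> simps (CF C P r F) m" and g: "\<gamma> \<in> Delta m 1" and a: "\<alpha> \<in> Delta k m"
  shows "pull cyl k m \<alpha> (flow m (z, \<gamma>)) = flow k (pull (CF C P r F) k m \<alpha> z, compose {..k} \<gamma> \<alpha>)"
proof -
  obtain \<sigma> \<Theta> where zz: "z = (\<sigma>, \<Theta>)" by (cases z)
  have 1: "compose {..k} (flow_chain m \<gamma> \<sigma>) \<alpha> = flow_chain k (compose {..k} \<gamma> \<alpha>) (compose {..k} \<sigma> \<alpha>)"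
    using Delta_le[OF a] by (auto simp: flow_chain_def compose_def restrict_def fun_eq_iff)
  let ?\<xi> = "flow_chain k (compose {..k} \<gamma> \<alpha>) (compose {..k} \<sigma> \<alpha>)"
  have z': "(compose {..k} \<sigma> \<alpha>, res k (compose {..k} \<sigma> \<alpha>) (\<lambda>(i, x). (\<alpha> i, x)) \<Theta>) \<in> simps (CF C P r F) k"
    using sset_pull_in[OF CF_sset a z] by (simp add: zz pull_CF)
  have "res k ?\<xi> (\<lambda>(i, x). (\<alpha> i, x)) (res m (flow_chain m \<gamma> \<sigma>) (\<lambda>v. v) \<Theta>) =
      res k ?\<xi> ((\<lambda>v. v) \<circ> (\<lambda>(i, x). (\<alpha> i, x))) \<Theta>"
    using res_res[OF V_map_pull[OF a, of "flow_chain m \<gamma> \<sigma>"]] unfolding 1 by blast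
  also have "\<dots> = res k ?\<xi> ((\<lambda>(i, x). (\<alpha> i, x)) \<circ> (\<lambda>v. v)) \<Theta>"
    by (rule res_cong) simp
  also have "\<dots> = res k ?\<xi> (\<lambda>v. v) (res k (compose {..k} \<sigma> \<alpha>) (\<lambda>(i, x). (\<alpha> i, x)) \<Theta>)"
    by (rule res_res[OF flow_facts(1)[OF z' Delta_compose[OF a g]], symmetric])
  finally show ?thesis by (simp add: flow_def zz pull_cyl pull_CF 1)
qed

lemma proj_flow:
  assumes z: "z \<in> simps (CF C P r F) m" and g: "\<gamma> \<in> Delta m 1"
  shows "proj m (flow m (z, \<gamma>)) = pF C P r F m z"
proof -
  obtain \<sigma> \<Theta> where zz: "z = (\<sigma>, \<Theta>)" by (cases z)
  note f = flow_facts[OF z[unfolded zz] g]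
  have "compose {..m} (\<lambda>v. v) (\<lambda>i\<in>{..m}. (i, hd (flow_chain m \<gamma> \<sigma> i))) = (\<lambda>i\<in>{..m}. (i, hd (\<sigma> i)))"
    by (auto simp: compose_def flow_chain_def restrict_def fun_eq_iff)
  then show ?thesis
    using flow_in[OF z g] z res_apply[OF hd_chain[OF f(2)], of "\<lambda>v. v" \<Theta>]
    by (simp add: zz flow_def proj_apply pF_def)
qed

lemma flow_1:
  assumes z: "z \<in> simps (CF C P r F) m"
  shows "flow m (z, \<lambda>i\<in>{..m}. 1) = incl m z"
proof -
  obtain \<sigma> \<Theta> where zz: "z = (\<sigma>, \<Theta>)" by (cases z)
  note f = flow_facts[OF z[unfolded zz] const_in_Delta[of 1 1]]
  have "flow_chain m (\<lambda>i\<in>{..m}. 1) \<sigma> = \<sigma>"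
    by (rule extensionalityI[of _ "{..m}"]) (use shapeD(2)[OF f(4)] in \<open>auto simp: flow_chain_def\<close>)
  then show ?thesis using res_id[OF f(3)] by (simp add: flow_def zz incl_def)
qed

lemma flow_0:
  assumes z: "z \<in> simps (CF C P r F) m"
  shows "flow m (z, \<lambda>i\<in>{..m}. 0) = jmap m (pF C P r F m z)"
proof -
  obtain \<sigma> \<Theta> where zz: "z = (\<sigma>, \<Theta>)" by (cases z)
  note f = flow_facts[OF z[unfolded zz] const_in_Delta[of 0 1]]
  let ?h = "\<lambda>i\<in>{..m}. (i, hd (\<sigma> i))" and ?c = "pF C P r F m z"
  let ?\<xi> = "\<lambda>i\<in>{..m}. [F m ?c i]"
  have hd: "?h \<in> simps (NV m \<sigma>) m" by (rule hd_chain[OF f(4)]) simp_all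
  have Th: "\<Theta> \<in> sset_hom (NV m \<sigma>) C" using f(3) by (simp add: over_def)
  have c: "?c = \<Theta> m ?h" using z by (simp add: zz pF_def)
  have Fc: "F m ?c i = hd (\<sigma> i)" if "i \<le> m" for i
    using f(3) hd that unfolding c over_def by (simp add: compose_def)
  have 1: "flow_chain m (\<lambda>i\<in>{..m}. 0) \<sigma> = ?\<xi>" using Fc by (auto simp: flow_chain_def restrict_def fun_eq_iff)
  have 2: "res m ?\<xi> (\<lambda>v. v) \<Theta> l = (\<lambda>\<kappa>\<in>simps (NV m ?\<xi>) l. pull C l m (compose {..l} fst \<kappa>) ?c)" for l
  proof (rule extensionalityI[OF res_ext])
    fix \<kappa> assume k: "\<kappa> \<in> simps (NV m ?\<xi>) l"
    \<comment> \<open>Over one-element chains a point is determined by its first coordinate. Hence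
      \<kappa> factors through the chain of heads, whose image under \<Theta> is
      \<open>?c\<close>.\<close>
    have "snd (\<kappa> i) = hd (\<sigma> (fst (\<kappa> i))) \<and> fst (\<kappa> i) \<le> m" if "i \<le> l" for i
    proof -
      have "\<kappa> i \<in> V_poset m ?\<xi>" using k that by (simp add: simps_nerve)
      then obtain j where "j \<le> m" "\<kappa> i = (j, F m ?c j)" by (auto simp: V_poset_def)
      then show ?thesis using Fc by simp
    qed
    then have "compose {..l} (\<lambda>v. v) \<kappa> = compose {..l} ?h (compose {..l} fst \<kappa>)"
      by (auto simp: compose_def restrict_def fun_eq_iff prod_eq_iff)
    then show "res m ?\<xi> (\<lambda>v. v) \<Theta> l \<kappa> = (\<lambda>\<kappa>\<in>simps (NV m ?\<xi>) l. pull C l m (compose {..l} fst \<kappa>) ?c) \<kappa>"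
      using res_apply[OF k, of "\<lambda>v. v" \<Theta>] sset_hom_pull[OF Th V_fst_in[OF k] hd] k c by simp
  qed simp
  show ?thesis by (simp add: flow_def zz jmap_def 1[unfolded zz] 2[unfolded zz] fun_eq_iff)
qed

end

context chains
begin

text \<open>Two applications of \<open>cyl_extend\<close>: the first constructs the inverse and the
  homotopy on sections over the chains, the second the homotopy on sections over \<C>.\<close>

lemma precomp_homotopy_equivalence:
  assumes rf: "right_fibration X C f"
  shows "homotopy_equivalence (map_over C (sset_id C) X f) (map_over (CF C P r F) (pF C P r F) X f)
    (map_over_precomp (CF C P r F) C (pF C P r F) X f)"
proof -
  let ?CF = "CF C P r F" and ?p = "pF C P r F"
  let ?Z = "map_over C (sset_id C) X f" and ?Y = "map_over ?CF ?p X f"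
  let ?R = "map_over_precomp ?CF C ?p X f"
  let ?c = "\<lambda>(c :: nat) (m :: nat). \<lambda>i\<in>{..m}. c"
  have Z: "simplicial_set ?Z" and Y: "simplicial_set ?Y"
    using map_over_sset C CF_sset by auto
  have id: "sset_id C m c = c" if "c \<in> simps C m" for m c using that by (simp add: sset_id_def)
  have pin: "?p m z \<in> simps C m" if "z \<in> simps ?CF m" for m z using sset_hom_in[OF pF_hom that] .
  have evZ: "map_eval m (c, h) \<in> simps X m" "f m (map_eval m (c, h)) = c"
    "\<alpha> \<in> Delta k m \<Longrightarrow> map_eval k (pull C k m \<alpha> c, pull ?Z k m \<alpha> h) = pull X k m \<alpha> (map_eval m (c, h))"
    if "c \<in> simps C m" "h \<in> simps ?Z m" for m c h k \<alpha>
    using map_eval_family[OF C, of "sset_id C" X f] that id unfolding family_over_def by auto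
  have evY: "map_eval m (z, h) \<in> simps X m" "f m (map_eval m (z, h)) = ?p m z"
    "\<alpha> \<in> Delta k m \<Longrightarrow> map_eval k (pull ?CF k m \<alpha> z, pull ?Y k m \<alpha> h) = pull X k m \<alpha> (map_eval m (z, h))"
    if "z \<in> simps ?CF m" "h \<in> simps ?Y m" for m z h k \<alpha>
    using map_eval_family[OF CF_sset, of ?p X f] that unfolding family_over_def by auto
  \<comment> \<open>Restriction along \<open>pF\<close> is rewritten as the transpose of a family,
    to obtain its simpliciality from \<open>map_transpose_hom\<close>.\<close>
  have R_eq: "?R = map_transpose ?CF ?Z (\<lambda>m (z, h). map_eval m (?p m z, h))"
  proof (rule ext)
    fix n
    show "?R n = map_transpose ?CF ?Z (\<lambda>m (z, h). map_eval m (?p m z, h)) n"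
      unfolding map_over_precomp_def map_transpose_def
    proof (rule restrict_ext, rule ext, rule restrict_ext)
      fix h m x assume "x \<in> simps ?CF m \<times> Delta m n"
      then obtain z \<beta> where "x = (z, \<beta>)" "z \<in> simps ?CF m" "\<beta> \<in> Delta m n" by auto
      then show "(case x of (s, \<beta>) \<Rightarrow> h m (?p m s, \<beta>)) =
          (case x of (s, \<beta>) \<Rightarrow> (case (s, pull ?Z m n \<beta> h) of (z, h) \<Rightarrow> map_eval m (?p m z, h)))"
        using map_eval_pull[OF pin, of z m \<beta> n "sset_id C" X f h] by simp
    qed
  qed
  have R: "?R \<in> sset_hom ?Z ?Y"
    unfolding R_eq
  proof (rule map_transpose_hom[OF CF_sset Z], rule family_overI)
    fix k m z h \<alpha> assume a: "\<alpha> \<in> Delta k m" and z: "z \<in> simps ?CF m" and h: "h \<in> simps ?Z m"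
    show "(case (pull ?CF k m \<alpha> z, pull ?Z k m \<alpha> h) of (z, h) \<Rightarrow> map_eval k (?p k z, h)) =
        pull X k m \<alpha> (case (z, h) of (z, h) \<Rightarrow> map_eval m (?p m z, h))"
      using evZ(3)[OF pin[OF z] h a] sset_hom_pull[OF pF_hom a z] by simp
  qed (use evZ pin in auto)
  have Rin: "?R n h \<in> simps ?Y n" if "h \<in> simps ?Z n" for n h using sset_hom_in[OF R that] .
  have R_apply: "?R n h m (z, \<beta>) = h m (?p m z, \<beta>)"
    if "h \<in> simps ?Z n" "z \<in> simps ?CF m" "\<beta> \<in> Delta m n" for n h m z \<beta>
    using that by (simp add: map_over_precomp_def)

  \<comment> \<open>The parameters are all sections over the chains and the prescribed section is
    evaluation, so \<open>E\<close> extends every section at once and compatibly with the simplicial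
    structure.\<close>
  obtain E where E: "E \<in> sset_hom (sset_prod cyl ?Y) X"
    and E1: "\<And>n k h. k \<in> simps cyl n \<Longrightarrow> h \<in> simps ?Y n \<Longrightarrow> fst k 0 = 1 \<or> (n, h) \<in> {} \<Longrightarrow>
      E n (k, h) = (case (k, h) of (k, h) \<Rightarrow> map_eval n (snd k, h))"
    and E2: "\<And>n k h. k \<in> simps cyl n \<Longrightarrow> h \<in> simps ?Y n \<Longrightarrow> f n (E n (k, h)) = proj n k"
  proof (rule cyl_extend[OF rf Y, of "{}" "\<lambda>n (k, h). map_eval n (snd k, h)"])
    fix n k h assume k: "k \<in> simps cyl n" and h: "h \<in> simps ?Y n" and "fst k 0 = 1 \<or> (n, h) \<in> {}"
    then obtain z where z: "k = incl n z" "z \<in> simps ?CF n" using incl_cases[OF k] by blast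
    have sn: "snd (incl n z) = z" for n z by (simp add: incl_def)
    show "(case (k, h) of (k, h) \<Rightarrow> map_eval n (snd k, h)) \<in> simps X n"
      using evY(1)[OF z(2) h] by (simp add: z sn)
    show "f n (case (k, h) of (k, h) \<Rightarrow> map_eval n (snd k, h)) = proj n k"
      using evY(2)[OF z(2) h] pF_proj[OF z(2)] by (simp add: z sn)
    show "(case (pull cyl m n \<alpha> k, pull ?Y m n \<alpha> h) of (k, h) \<Rightarrow> map_eval m (snd k, h)) =
        pull X m n \<alpha> (case (k, h) of (k, h) \<Rightarrow> map_eval n (snd k, h))" if "\<alpha> \<in> Delta m n" for m \<alpha>
      using evY(3)[OF z(2) h that] by (simp add: z sn incl_pull[OF that])
  qed (simp | rule that)+
  have Ein: "E n (k, h) \<in> simps X n" if "k \<in> simps cyl n" "h \<in> simps ?Y n" for n k h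
    using sset_hom_in[OF E, of "(k, h)" n] that by simp
  have Epull: "E m (pull cyl m n \<alpha> k, pull ?Y m n \<alpha> h) = pull X m n \<alpha> (E n (k, h))"
    if "k \<in> simps cyl n" "h \<in> simps ?Y n" "\<alpha> \<in> Delta m n" for m n \<alpha> k h
    using sset_hom_pull[OF E that(3), of "(k, h)"] that by simp
  have Eincl: "E n (incl n z, h) = map_eval n (z, h)" if "z \<in> simps ?CF n" "h \<in> simps ?Y n" for n z h
    using E1[of "incl n z" n h] that incl_in[of n z] by (simp add: incl_def)

  define g where "g = map_transpose C ?Y (\<lambda>m (c, h). E m (jmap m c, h))"
  have g: "g \<in> sset_hom ?Y ?Z"
    unfolding g_def
  proof (rule map_transpose_hom[OF C Y], rule family_overI)
    fix k m c h \<alpha> assume a: "\<alpha> \<in> Delta k m" and c: "c \<in> simps C m" and h: "h \<in> simps ?Y m"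
    show "(case (pull C k m \<alpha> c, pull ?Y k m \<alpha> h) of (c, h) \<Rightarrow> E k (jmap k c, h)) =
        pull X k m \<alpha> (case (c, h) of (c, h) \<Rightarrow> E m (jmap m c, h))"
      using Epull[OF jmap_in[OF c] h a] jmap_pull[OF a c] by simp
  qed (use Ein jmap_in E2 jmap_proj id in auto)
  have gin: "g n h \<in> simps ?Z n" if "h \<in> simps ?Y n" for n h using sset_hom_in[OF g that] .
  have g_apply: "g n h m (c, \<beta>) = E m (jmap m c, pull ?Y m n \<beta> h)"
    if "h \<in> simps ?Y n" "c \<in> simps C m" "\<beta> \<in> Delta m n" for n h m c \<beta>
    using that by (simp add: g_def map_transpose_apply)

  have homY: "homotopic ?Y ?Y (sset_comp ?Y ?R g) (sset_id ?Y)"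
  proof -
    \<comment> \<open>Along \<open>flow\<close> the extension \<open>E\<close> runs from its
      restriction to \<C> pulled back by \<open>pF\<close>, which is \<open>?R\<close> after
      \<open>g\<close>, to its restriction to the chains, which is evaluation and gives the
      identity.\<close>
    let ?W = "\<lambda>m (z, (h, \<gamma>)). E m (flow m (z, \<gamma>), h)"
    define H where "H = map_transpose ?CF (sset_prod ?Y (simplex 1)) ?W"
    have H: "H \<in> sset_hom (sset_prod ?Y (simplex 1)) ?Y"
      unfolding H_def
    proof (rule map_transpose_hom[OF CF_sset sset_prod_sset[OF Y simplex_sset]], rule family_overI)
      fix m z y assume z: "z \<in> simps ?CF m" and "y \<in> simps (sset_prod ?Y (simplex 1)) m"
      then obtain h \<gamma> where y: "y = (h, \<gamma>)" "h \<in> simps ?Y m" "\<gamma> \<in> Delta m 1" by auto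
      show "?W m (z, y) \<in> simps X m" using Ein[OF flow_in[OF z y(3)] y(2)] by (simp add: y)
      show "f m (?W m (z, y)) = ?p m z" using E2[OF flow_in[OF z y(3)] y(2)] proj_flow[OF z y(3)] by (simp add: y)
      show "?W k (pull ?CF k m \<alpha> z, pull (sset_prod ?Y (simplex 1)) k m \<alpha> y) = pull X k m \<alpha> (?W m (z, y))"
        if a: "\<alpha> \<in> Delta k m" for k \<alpha>
        using Epull[OF flow_in[OF z y(3)] y(2) a] flow_pull[OF z y(3) a] by (simp add: y)
    qed
    have H_apply: "H n (h, ?c i n) m (z, \<beta>) = E m (flow m (z, ?c i m), pull ?Y m n \<beta> h)"
      if "h \<in> simps ?Y n" "z \<in> simps ?CF m" "\<beta> \<in> Delta m n" "i \<le> 1" for n h m z \<beta> i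
      using that const_in_Delta[OF that(4), of n] compose_const[OF that(3), of i] by (simp add: H_def map_transpose_apply)
    have Hin: "H n (h, ?c i n) \<in> simps ?Y n" if "h \<in> simps ?Y n" "i \<le> 1" for n h i
      using sset_hom_in[OF H, of "(h, ?c i n)" n] that const_in_Delta[OF that(2), of n] by simp
    show ?thesis
      unfolding homotopic_def
    proof (intro bexI[OF _ H] allI ballI conjI)
      fix n h assume h: "h \<in> simps ?Y n"
      have "H n (h, ?c 0 n) = ?R n (g n h)"
      proof (rule map_over_eqI[OF Hin[OF h] Rin[OF gin[OF h]]])
        fix m z \<beta> assume zb: "z \<in> simps ?CF m" "\<beta> \<in> Delta m n"
        show "H n (h, ?c 0 n) m (z, \<beta>) = ?R n (g n h) m (z, \<beta>)"
          using H_apply[OF h zb, of 0] R_apply[OF gin[OF h] zb] g_apply[OF h pin[OF zb(1)] zb(2)] flow_0[OF zb(1)] by simp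
      qed simp
      then show "H n (h, ?c 0 n) = sset_comp ?Y ?R g n h" using h by (simp add: sset_comp_def compose_def)
      have "H n (h, ?c 1 n) = h"
      proof (rule map_over_eqI[OF Hin[OF h] h])
        fix m z \<beta> assume zb: "z \<in> simps ?CF m" "\<beta> \<in> Delta m n"
        show "H n (h, ?c 1 n) m (z, \<beta>) = h m (z, \<beta>)"
          using H_apply[OF h zb, of 1] flow_1[OF zb(1)] Eincl[OF zb(1) sset_pull_in[OF Y zb(2) h]]
            map_eval_pull[OF zb, of ?p X f h] by simp
      qed simp
      then show "H n (h, ?c 1 n) = sset_id ?Y n h" using h by (simp add: sset_id_def)
    qed
  qed

  have homZ: "homotopic ?Z ?Z (sset_comp ?Z g ?R) (sset_id ?Z)"
  proof -
    let ?Y1 = "sset_prod ?Z (simplex 1)"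
    let ?Y0 = "{(n, h, \<gamma>). h \<in> simps ?Z n \<and> (\<gamma> = ?c 0 n \<or> \<gamma> = ?c 1 n)}"
    \<comment> \<open>At the end 0 of the interval this is the extension from which \<open>g\<close>
      after \<open>?R\<close> is obtained, at the end 1 the section \<open>h\<close> itself pulled
      back along \<open>proj\<close>. Over the chains, where \<gamma> is arbitrary, both branches
      coincide by \<open>uCF\<close>.\<close>
    let ?u = "\<lambda>n (k, (h, \<gamma>)). if \<gamma> = ?c 0 n then E n (k, ?R n h) else map_eval n (proj n k, h)"
    have Y1: "simplicial_set ?Y1" by (rule sset_prod_sset[OF Z simplex_sset])
    have c01: "?c 1 n \<noteq> ?c 0 n" for n
    proof
      assume "?c 1 n = ?c 0 n"
      then have "?c 1 n 0 = ?c 0 n 0" by (rule fun_cong)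
      then show False by simp
    qed
    have uCF: "?u n (incl n z, (h, \<gamma>)) = map_eval n (?p n z, h)" if z: "z \<in> simps ?CF n" and h: "h \<in> simps ?Z n" for n z h \<gamma>
      using Eincl[OF z Rin[OF h]] R_apply[OF h z Delta_id_in] pF_proj[OF z] by (simp add: map_eval_def)
    have Y0a: "y \<in> simps ?Y1 n" if "(n, y) \<in> ?Y0" for n y
      using that const_in_Delta[of 0 1 n] const_in_Delta[of 1 1 n] by auto
    have Y0b: "(m, pull ?Y1 m n \<alpha> y) \<in> ?Y0" if "(n, y) \<in> ?Y0" "\<alpha> \<in> Delta m n" for m n y \<alpha>
      using that sset_pull_in[OF Z that(2)] compose_const[OF that(2), of "0 :: nat"] compose_const[OF that(2), of "1 :: nat"] by (auto simp del: One_nat_def)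
    have projin: "proj n k \<in> simps C n" if "k \<in> simps cyl n" for n k using sset_hom_in[OF proj_hom that] .
    obtain G where G: "G \<in> sset_hom (sset_prod cyl ?Y1) X"
      and G1: "\<And>n k y. k \<in> simps cyl n \<Longrightarrow> y \<in> simps ?Y1 n \<Longrightarrow> fst k 0 = 1 \<or> (n, y) \<in> ?Y0 \<Longrightarrow> G n (k, y) = ?u n (k, y)"
      and G2: "\<And>n k y. k \<in> simps cyl n \<Longrightarrow> y \<in> simps ?Y1 n \<Longrightarrow> f n (G n (k, y)) = proj n k"
    proof (rule cyl_extend[OF rf Y1, of ?Y0 ?u])
      fix n k y assume k: "k \<in> simps cyl n" and y': "y \<in> simps ?Y1 n" and ky: "fst k 0 = 1 \<or> (n, y) \<in> ?Y0"
      obtain h \<gamma> where y: "y = (h, \<gamma>)" "h \<in> simps ?Z n" using y' by auto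
      show "?u n (k, y) \<in> simps X n"
        using Ein[OF k Rin[OF y(2)]] evZ(1)[OF projin[OF k] y(2)] by (simp add: y)
      show "f n (?u n (k, y)) = proj n k"
        using E2[OF k Rin[OF y(2)]] evZ(2)[OF projin[OF k] y(2)] by (simp add: y)
      show "?u m (pull cyl m n \<alpha> k, pull ?Y1 m n \<alpha> y) = pull X m n \<alpha> (?u n (k, y))" if a: "\<alpha> \<in> Delta m n" for m \<alpha>
      proof (cases "fst k 0 = 1")
        case True
        then obtain z where z: "k = incl n z" "z \<in> simps ?CF n" using incl_cases[OF k] by blast
        show ?thesis
          using uCF[OF z(2) y(2), of \<gamma>] evZ(3)[OF pin[OF z(2)] y(2) a] sset_hom_pull[OF pF_hom a z(2)]
            uCF[OF sset_pull_in[OF CF_sset a z(2)] sset_pull_in[OF Z a y(2)], of "compose {..m} \<gamma> \<alpha>"]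
          by (simp add: z(1) y(1) incl_pull[OF a])
      next
        case False
        then have "\<gamma> = ?c 0 n \<or> \<gamma> = ?c 1 n" using ky y by auto
        then show ?thesis
        proof
          assume "\<gamma> = ?c 0 n"
          then show ?thesis
            using Epull[OF k Rin[OF y(2)] a] sset_hom_pull[OF R a y(2)] compose_const[OF a, of "0 :: nat"] by (simp add: y(1))
        next
          assume "\<gamma> = ?c 1 n"
          then show ?thesis
            using evZ(3)[OF projin[OF k] y(2) a] sset_hom_pull[OF proj_hom a k] compose_const[OF a, of "1 :: nat"] c01
            by (simp add: y(1) del: One_nat_def)
        qed
      qed
    next
      show "y \<in> simps ?Y1 n" if "(n, y) \<in> ?Y0" for n y by (rule Y0a[OF that])
      show "(m, pull ?Y1 m n \<alpha> y) \<in> ?Y0" if "(n, y) \<in> ?Y0" "\<alpha> \<in> Delta m n" for m n y \<alpha> by (rule Y0b[OF that])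
    qed (rule that)
    \<comment> \<open>Restricting the second extension to \<C> gives the homotopy; at the end 1 it
      is constant because \<open>proj\<close> after \<open>jmap\<close> is the identity.\<close>
    let ?W = "\<lambda>m (c, y). G m (jmap m c, y)"
    define H where "H = map_transpose C ?Y1 ?W"
    have H: "H \<in> sset_hom ?Y1 ?Z"
      unfolding H_def
    proof (rule map_transpose_hom[OF C Y1], rule family_overI)
      fix m c y assume c: "c \<in> simps C m" and y: "y \<in> simps ?Y1 m"
      have jy: "(jmap m c, y) \<in> simps (sset_prod cyl ?Y1) m" using jmap_in[OF c] y by simp
      show "?W m (c, y) \<in> simps X m" using sset_hom_in[OF G jy] by simp
      show "f m (?W m (c, y)) = sset_id C m c" using G2[OF jmap_in[OF c] y] jmap_proj[OF c] id[OF c] by simp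
      show "?W k (pull C k m \<alpha> c, pull ?Y1 k m \<alpha> y) = pull X k m \<alpha> (?W m (c, y))" if a: "\<alpha> \<in> Delta k m" for k \<alpha>
        using sset_hom_pull[OF G a jy] jmap_pull[OF a c] by simp
    qed
    have Gu: "G m (jmap m c, (h, ?c i m)) = ?u m (jmap m c, (h, ?c i m))"
      if "c \<in> simps C m" "h \<in> simps ?Z m" "i = 0 \<or> i = 1" for m c h i
      by (rule G1[OF jmap_in[OF that(1)]]) (use that const_in_Delta[of i 1 m] in auto)
    have H_apply: "H n (h, ?c i n) m (c, \<beta>) = ?u m (jmap m c, (pull ?Z m n \<beta> h, ?c i m))"
      if "h \<in> simps ?Z n" "c \<in> simps C m" "\<beta> \<in> Delta m n" "i = 0 \<or> i = 1" for n h m c \<beta> i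
      using that Gu[OF that(2) sset_pull_in[OF Z that(3,1)] that(4)] const_in_Delta[of i 1 n] compose_const[OF that(3), of i]
      by (auto simp: H_def map_transpose_apply simp del: One_nat_def)
    have Hin: "H n (h, ?c i n) \<in> simps ?Z n" if "h \<in> simps ?Z n" "i \<le> 1" for n h i
      using sset_hom_in[OF H, of "(h, ?c i n)" n] that const_in_Delta[OF that(2), of n] by simp
    show ?thesis
      unfolding homotopic_def
    proof (intro bexI[OF _ H] allI ballI conjI)
      fix n h assume h: "h \<in> simps ?Z n"
      have "H n (h, ?c 0 n) = g n (?R n h)"
      proof (rule map_over_eqI[OF Hin[OF h] gin[OF Rin[OF h]]])
        fix m c \<beta> assume cb: "c \<in> simps C m" "\<beta> \<in> Delta m n"
        show "H n (h, ?c 0 n) m (c, \<beta>) = g n (?R n h) m (c, \<beta>)"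
          using H_apply[OF h cb, of 0] g_apply[OF Rin[OF h] cb] sset_hom_pull[OF R cb(2) h] by simp
      qed simp
      then show "H n (h, ?c 0 n) = sset_comp ?Z g ?R n h" using h by (simp add: sset_comp_def compose_def)
      have "H n (h, ?c 1 n) = h"
      proof (rule map_over_eqI[OF Hin[OF h] h])
        fix m c \<beta> assume cb: "c \<in> simps C m" "\<beta> \<in> Delta m n"
        show "H n (h, ?c 1 n) m (c, \<beta>) = h m (c, \<beta>)"
          using H_apply[OF h cb, of 1] c01[of m] jmap_proj[OF cb(1)] map_eval_pull[OF cb, of "sset_id C" X f h]
          by (simp del: One_nat_def)
      qed simp
      then show "H n (h, ?c 1 n) = sset_id ?Z n h" using h by (simp add: sset_id_def)
    qed
  qed
  show ?thesis
    unfolding homotopy_equivalence_def using R g homY homZ by blast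
qed

end

theorem theoremC6:
  fixes C :: "'c sset" and P :: "'p set" and r :: "'p rel"
    and F :: "nat \<Rightarrow> 'c \<Rightarrow> (nat \<Rightarrow> 'p)"
  assumes "quasi_category C"
    and "partial_order_on P r"
    and "F \<in> sset_hom C (nerve P r)"
  shows "cofinal_map TYPE('x) (CF C P r F) C (pF C P r F)"
proof -
  interpret chains C P r F
    using assms by unfold_locales (simp_all add: quasi_category_def)
  show ?thesis
    unfolding cofinal_map_def using CF_sset C pF_hom precomp_homotopy_equivalence by blast
qed

end
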